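(* For all $X\geq 3$ we have $$\sum_{1<m\leq X}\frac{\mu^2(2m)}{\tau(m)}L\left(1,\left(\frac{\cdot}{m}\right)\right)\ll\frac{X}{\sqrt{\log X}},$$ where the sum is over integers $m$ and the implied constant is absolute.
   Context: $\mu$ is the Möbius function, $\tau(m)$ is the number of positive divisors of $m$, $\left(\frac{\cdot}{m}\right)$ is the Jacobi symbol modulo odd $m$ (the factor $\mu^2(2m)$ restricts to odd square-free $m$), and $L\left(1,\left(\frac{\cdot}{m}\right)\right)=\sum_{n\ge1}\frac1n\left(\frac{n}{m}\right)$. $A\ll B$ means $|A|\leq CB$ for some constant $C>0$. *)

theory Defs
  imports Complex_Main "HOL-Number_Theory.Number_Theory" "HOL-Computational_Algebra.Squarefree"
begin

definition moebius_mu :: "nat \<Rightarrow> int" where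
  "moebius_mu n = (if squarefree n then (- 1) ^ card (prime_factors n) else 0)"

definition divisor_tau :: "nat \<Rightarrow> nat" where
  "divisor_tau n = card {d. d dvd n}"

text \<open>Only meaningful for odd \<open>m\<close>: at \<open>p = 2\<close> the library's \<open>Legendre\<close> is not the
  Kronecker symbol.\<close>

definition jacobi_symbol :: "int \<Rightarrow> nat \<Rightarrow> int" where
  "jacobi_symbol a m = (\<Prod>p\<in>prime_factors m. Legendre a (int p) ^ multiplicity p m)"

text \<open>The value \<open>L(1, \<chi>)\<close>. The series converges only conditionally for a nonprincipal
  character \<open>\<chi>\<close>, so it is taken in the natural order of summation (\<open>suminf\<close> rather than
  \<open>infsum\<close>). The index is shifted so that the sum starts at \<open>1\<close>.\<close>

definition L_one :: "(int \<Rightarrow> int) \<Rightarrow> real" where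
  "L_one \<chi> = (\<Sum>n. 1 / real (Suc n) * of_int (\<chi> (int (Suc n))))"

end

theory Submission
  imports Defs "HOL-Analysis.Analysis" "HOL-Real_Asymp.Real_Asymp"
begin

text \<open>The weight \<open>1 / tau(m)\<close> has mean value of order \<open>1 / sqrt (log X)\<close>, so the assertion is that \<open>L(1, (./m))\<close> stays bounded on
average against it. Absolute values may be taken inside the sum over \<open>m\<close>; only upper bounds are involved.

\<^bold>\<open>Truncation.\<close> The terms with even \<open>n\<close> only contribute the Euler factor at 2, which lies between two positive
constants, and the Polya-Vinogradov inequality \<open>polya_vinogradov_jacobi\<close> cuts the series at \<open>n = X powr (3/4)\<close>. The same inequality,
with the two arguments exchanged by quadratic reciprocity, shows that the sum of \<open>(n/m)\<close> over odd \<open>m\<close> up to \<open>X\<close> is of order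
at most \<open>sqrt n * log n\<close> when \<open>n\<close> is odd and not a square (\<open>jacobi_sum_modulus\<close>). Hence in the mean square over \<open>m\<close> of the part of the series
with \<open>n\<close> beyond \<open>(log X)^2\<close> only the pairs whose product is a square matter, and the mean square is of order at most \<open>1 / log X\<close>
(\<open>short_L_sum_difference_mean_square\<close>). By the inequality of the arithmetic and geometric mean this part contributes an admissible amount.

\<^bold>\<open>Short sums.\<close> There remains \<open>T(m)\<close>, the sum of \<open>(n/m) / n\<close> over odd \<open>n\<close> up to \<open>(log X)^2\<close>. Estimating
\<open>T(m)\<close> trivially would lose a factor \<open>log log X\<close>. Instead it is replaced by \<open>1 + T(m)^2\<close>, which is nonnegative and is again a combination of
symbols \<open>(n/m)\<close> with small \<open>n\<close>. Inserting \<open>log m\<close>, the sum of \<open>log p\<close> over primes \<open>p\<close> dividing \<open>m\<close>, and writing \<open>m = k p\<close> reduces the problem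
(\<open>short_L_sum_mean_square\<close>) to the sum of \<open>log p * T(k p)^2\<close> over \<open>p\<close> up to \<open>X / k\<close>. By positivity the primes can be
replaced by Selberg's majorant. In the resulting sums the nonsquare \<open>n\<close> cancel, because they are small compared with
\<open>X / k\<close>, and the square \<open>n\<close> have bounded total, so the sum is of order at most \<open>X / k\<close> (\<open>sieve_over_primes\<close>). Finally the sum of \<open>1 / (k tau(k))\<close> up to \<open>X\<close> is
of order at most \<open>sqrt (log X)\<close> (\<open>sum_inverse_divisor_tau_le\<close>), and division by \<open>log X\<close> gives the claim.\<close>

section \<open>Jacobi symbols and reciprocity\<close>

lemma odd_nat_prime_induct [consumes 1, case_names one prime_times]:
  fixes r :: nat
  assumes "odd r" "P 1"
    and "\<And>p r. prime p \<Longrightarrow> odd p \<Longrightarrow> odd r \<Longrightarrow> P r \<Longrightarrow> P (p * r)"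
  shows "P r"
  using assms(1)
proof (induction r rule: less_induct)
  case (less r)
  show ?case
  proof (cases "r = 1")
    case True
    then show ?thesis using assms(2) by simp
  next
    case False
    then obtain p where p: "prime p" "p dvd r" using prime_factor_nat by blast
    then obtain k where k: "r = p * k" by blast
    have "r > 0" using less.prems by (intro Nat.gr0I) auto
    have "odd p" "odd k" using less.prems k by auto
    moreover have "1 * k < p * k"
      using k \<open>r > 0\<close> prime_gt_1_nat[OF p(1)] by (intro mult_strict_right_mono) auto
    then have "k < r" by (simp only: k mult_1)
    ultimately have "P (p * k)" by (intro assms(3) p(1) less.IH)
    then show ?thesis by (simp only: k)
  qed
qed

lemma odd_prime_gt_2: "prime (p::nat) \<Longrightarrow> odd p \<Longrightarrow> p > 2"
  by (metis even_numeral nat_neq_iff not_less_eq numeral_2_eq_2 prime_gt_1_nat One_nat_def)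

lemma Legendre_cases: "Legendre a p \<in> {-1, 0, 1}"
  by (simp add: Legendre_def)

lemma Legendre_eq_0_iff: "Legendre a p = 0 \<longleftrightarrow> p dvd a"
  by (simp add: Legendre_def cong_0_iff)

text \<open>Both sides lie in \<open>{-1, 0, 1}\<close> and agree modulo \<open>p > 2\<close> by Euler's criterion.\<close>

lemma Legendre_mult:
  assumes "prime (p::nat)" "odd p"
  shows "Legendre (a * b) p = Legendre a p * Legendre b p"
proof -
  have p2: "p > 2" using odd_prime_gt_2 assms by blast
  have "[Legendre (a * b) p = (a * b) ^ ((p - 1) div 2)] (mod p)"
    by (intro euler_criterion assms p2)
  also have "(a * b) ^ ((p - 1) div 2) = a ^ ((p - 1) div 2) * b ^ ((p - 1) div 2)"
    by (simp add: power_mult_distrib)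
  also have "[\<dots> = Legendre a p * Legendre b p] (mod p)"
    by (intro cong_mult cong_sym[OF euler_criterion] assms p2)
  finally have c: "int p dvd Legendre (a * b) p - Legendre a p * Legendre b p"
    by (simp add: cong_iff_dvd_diff)
  have "\<bar>Legendre x p\<bar> \<le> 1" for x using Legendre_cases[of x p] by auto
  then have "\<bar>Legendre (a * b) p - Legendre a p * Legendre b p\<bar> \<le> 1 + 1 * 1"
    by (intro order.trans[OF abs_triangle_ineq4] add_mono) (auto simp: abs_mult intro!: mult_le_one)
  then have "\<bar>Legendre (a * b) p - Legendre a p * Legendre b p\<bar> < int p"
    using p2 by linarith
  then show ?thesis using c
    using zdvd_not_zless[of "\<bar>Legendre (a * b) p - Legendre a p * Legendre b p\<bar>" "int p"] by auto
qed

lemma Legendre_cong: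
  assumes "[a = b] (mod int p)"
  shows "Legendre a p = Legendre b p"
proof -
  have "[a = 0] (mod int p) \<longleftrightarrow> [b = 0] (mod int p)"
    using assms cong_trans cong_sym by blast
  moreover have "[y\<^sup>2 = a] (mod p) \<longleftrightarrow> [y\<^sup>2 = b] (mod p)" for y
    using assms cong_trans cong_sym by blast
  then have "QuadRes p a \<longleftrightarrow> QuadRes p b"
    unfolding QuadRes_def by simp
  ultimately show ?thesis by (simp add: Legendre_def)
qed

lemma Legendre_1: "prime (p::nat) \<Longrightarrow> Legendre 1 p = 1"
  unfolding Legendre_def QuadRes_def
  by (auto simp: cong_0_iff intro!: exI[of _ 1])

lemma jacobi_symbol_eq_prod_mset:
  "jacobi_symbol a m = (\<Prod>p\<in>#prime_factorization m. Legendre a (int p))"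
proof (cases "m = 0")
  case False
  then show ?thesis unfolding jacobi_symbol_def
    by (subst image_prod_mset_multiplicity)
      (auto simp: count_prime_factorization intro!: prod.cong)
qed (simp add: jacobi_symbol_def)

lemma jacobi_1_right [simp]: "jacobi_symbol a (Suc 0) = 1" "jacobi_symbol a 1 = 1"
  by (simp_all add: jacobi_symbol_eq_prod_mset)

lemma jacobi_prime: "prime p \<Longrightarrow> jacobi_symbol a p = Legendre a (int p)"
  by (simp add: jacobi_symbol_eq_prod_mset prime_factorization_prime)

lemma jacobi_mult_right:
  "m > 0 \<Longrightarrow> k > 0 \<Longrightarrow> jacobi_symbol a (m * k) = jacobi_symbol a m * jacobi_symbol a k"
  by (simp add: jacobi_symbol_eq_prod_mset prime_factorization_mult)

lemma jacobi_mult_left: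
  assumes "odd m"
  shows "jacobi_symbol (a * b) m = jacobi_symbol a m * jacobi_symbol b m"
  using assms
proof (induction m rule: odd_nat_prime_induct)
  case (prime_times p r)
  have "p > 0" "r > 0" using prime_times by (auto intro!: Nat.gr0I)
  then show ?case
    by (simp only: jacobi_mult_right jacobi_prime[OF prime_times(1)] prime_times.IH
        Legendre_mult[OF prime_times(1,2)] mult_ac)
qed auto

lemma jacobi_cases: "jacobi_symbol a m \<in> {-1, 0, 1}"
proof -
  have "(\<Prod>p\<in>#M. Legendre a (int p)) \<in> {-1, 0, 1}" for M :: "nat multiset"
  proof (induction M)
    case (add x M)
    then show ?case using Legendre_cases[of a "int x"] by auto
  qed auto
  then show ?thesis by (simp add: jacobi_symbol_eq_prod_mset)
qed

lemma abs_jacobi_le_real: "\<bar>real_of_int (jacobi_symbol a m)\<bar> \<le> 1"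
  using jacobi_cases[of a m] by auto

lemma jacobi_cong:
  assumes "[a = b] (mod int m)"
  shows "jacobi_symbol a m = jacobi_symbol b m"
proof -
  have "Legendre a p = Legendre b p" if "p \<in> prime_factors m" for p
    using that assms by (intro Legendre_cong) (meson cong_dvd_modulus of_nat_dvd_iff in_prime_factors_imp_dvd)
  then show ?thesis unfolding jacobi_symbol_def by (intro prod.cong) auto
qed

lemma jacobi_1_left [simp]: "jacobi_symbol 1 m = 1"
  unfolding jacobi_symbol_def
  by (intro prod.neutral) (metis Legendre_1 in_prime_factors_imp_prime of_nat_1 power_one)

lemma jacobi_eq_0_iff:
  assumes "m > 0"
  shows "jacobi_symbol (int n) m = 0 \<longleftrightarrow> \<not> coprime n m"
proof -
  have "jacobi_symbol (int n) m = 0 \<longleftrightarrow> (\<exists>p\<in>prime_factors m. Legendre (int n) (int p) ^ multiplicity p m = 0)"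
    unfolding jacobi_symbol_def by (rule prod_zero_iff) simp
  also have "\<dots> \<longleftrightarrow> (\<exists>p\<in>prime_factors m. p dvd n)"
    by (intro bex_cong refl) (auto simp: Legendre_eq_0_iff prime_factors_multiplicity)
  also have "\<dots> \<longleftrightarrow> \<not> coprime n m"
  proof
    assume "\<exists>p\<in>prime_factors m. p dvd n"
    then obtain p where "prime p" "p dvd m" "p dvd n" by auto
    then show "\<not> coprime n m" using coprime_common_divisor[of n m p] not_prime_unit[of p] by auto
  next
    assume "\<not> coprime n m"
    then have "gcd n m \<noteq> 1" by (simp only: coprime_iff_gcd_eq_1 not_False_eq_True)
    then obtain p where "prime p" "p dvd gcd n m" using prime_factor_nat by blast
    then show "\<exists>p\<in>prime_factors m. p dvd n"
      using assms by (intro bexI[of _ p]) (auto simp: in_prime_factors_iff)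
  qed
  finally show ?thesis .
qed

lemma jacobi_square:
  assumes "odd m"
  shows "jacobi_symbol (int (b ^ 2)) m = (if coprime b m then 1 else 0)"
proof -
  have "jacobi_symbol (int (b ^ 2)) m = jacobi_symbol (int b) m * jacobi_symbol (int b) m"
    using assms by (simp add: power2_eq_square jacobi_mult_left)
  also have "\<dots> = (if jacobi_symbol (int b) m = 0 then 0 else 1)"
    using jacobi_cases[of "int b" m] by (elim insertE emptyE) simp_all
  also have "m > 0" using assms by (intro Nat.gr0I) auto
  note jacobi_eq_0_iff[OF this, of b]
  finally show ?thesis by simp
qed

text \<open>For odd arguments this is \<open>(-1) ^ ((s - 1) div 2 * ((r - 1) div 2))\<close>, written so that its dependence on
the classes modulo 4 alone is visible.\<close>

definition reciprocity_sign :: "nat \<Rightarrow> nat \<Rightarrow> int" where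
  "reciprocity_sign s r = (if s mod 4 = 3 \<and> r mod 4 = 3 then -1 else 1)"

lemma odd_mod_4: "odd (r::nat) \<Longrightarrow> r mod 4 = 1 \<or> r mod 4 = 3"
  by presburger

lemma reciprocity_sign_commute: "reciprocity_sign s r = reciprocity_sign r s"
  by (auto simp: reciprocity_sign_def)

lemma reciprocity_sign_mult:
  assumes "odd p" "odd r"
  shows "reciprocity_sign s (p * r) = reciprocity_sign s p * reciprocity_sign s r"
proof -
  have "(p * r) mod 4 = ((p mod 4) * (r mod 4)) mod 4" by (simp add: mod_mult_eq)
  then show ?thesis using odd_mod_4[OF assms(1)] odd_mod_4[OF assms(2)]
    by (auto simp: reciprocity_sign_def)
qed

lemma Legendre_reciprocity:
  assumes "prime p" "odd p" "prime q" "odd q"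
  shows "Legendre (int p) (int q) = reciprocity_sign p q * Legendre (int q) (int p)"
proof (cases "p = q")
  case True
  then show ?thesis using assms by (simp add: Legendre_def cong_0_iff)
next
  case False
  have sg: "(-1::int) ^ ((p - 1) div 2 * ((q - 1) div 2)) = reciprocity_sign p q"
  proof -
    have ev: "even ((x - 1) div 2) \<longleftrightarrow> x mod 4 = 1" if "odd x" for x :: nat
      using that by presburger
    show ?thesis using ev[OF assms(2)] ev[OF assms(4)] odd_mod_4[OF assms(2)] odd_mod_4[OF assms(4)]
      by (auto simp: reciprocity_sign_def minus_one_power_iff)
  qed
  have "Legendre p q * Legendre q p = reciprocity_sign p q"
    using Quadratic_Reciprocity[of p q] assms False odd_prime_gt_2 sg by auto
  moreover have "reciprocity_sign p q \<in> {-1, 1}" by (simp add: reciprocity_sign_def)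
  ultimately show ?thesis
    using Legendre_cases[of "int p" "int q"] Legendre_cases[of "int q" "int p"]
    by (elim insertE emptyE) simp_all
qed

text \<open>All three functions are completely multiplicative in each of \<open>s\<close> and \<open>r\<close> on odd numbers, so the
law for two primes extends first to a prime \<open>s\<close> and arbitrary \<open>r\<close>, and then to arbitrary \<open>s\<close>.\<close>

lemma jacobi_reciprocity:
  assumes "odd s" "odd r"
  shows "jacobi_symbol (int s) r = reciprocity_sign s r * jacobi_symbol (int r) s"
proof -
  have prime_case: "jacobi_symbol (int q) r = reciprocity_sign q r * jacobi_symbol (int r) q"
    if q: "prime q" "odd q" for q
    using assms(2)
  proof (induction r rule: odd_nat_prime_induct)
    case (prime_times p r)
    have "p > 0" "r > 0" using prime_times by (auto intro!: Nat.gr0I)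
    have "jacobi_symbol (int q) (p * r) = Legendre (int q) (int p) * jacobi_symbol (int q) r"
      using \<open>p > 0\<close> \<open>r > 0\<close> prime_times(1) by (simp add: jacobi_mult_right jacobi_prime)
    also have "\<dots> = (reciprocity_sign q p * reciprocity_sign q r)
                    * (Legendre (int p) (int q) * jacobi_symbol (int r) q)"
      unfolding prime_times.IH by (subst Legendre_reciprocity[OF q prime_times(1,2)]) simp
    also have "\<dots> = reciprocity_sign q (p * r) * jacobi_symbol (int (p * r)) q"
      using q prime_times(2,3) by (simp add: reciprocity_sign_mult Legendre_mult jacobi_prime)
    finally show ?case .
  qed (simp add: reciprocity_sign_def)
  show ?thesis using assms(1)
  proof (induction s rule: odd_nat_prime_induct)
    case (prime_times p s)
    have "p > 0" "s > 0" using prime_times by (auto intro!: Nat.gr0I)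
    have "jacobi_symbol (int (p * s)) r = jacobi_symbol (int p) r * jacobi_symbol (int s) r"
      using assms(2) by (simp add: jacobi_mult_left)
    also have "\<dots> = (reciprocity_sign p r * reciprocity_sign s r)
                    * (jacobi_symbol (int r) p * jacobi_symbol (int r) s)"
      unfolding prime_times.IH prime_case[OF prime_times(1,2)] by simp
    also have "\<dots> = reciprocity_sign (p * s) r * jacobi_symbol (int r) (p * s)"
      using prime_times(2,3) \<open>p > 0\<close> \<open>s > 0\<close>
      by (simp add: reciprocity_sign_mult jacobi_mult_right reciprocity_sign_commute[of _ r])
    finally show ?case .
  qed (simp add: reciprocity_sign_def)
qed

section \<open>Gauss sums and the Polya-Vinogradov inequality\<close>

lemma sum_inverse_le_ln:
  assumes "n \<ge> 1"
  shows "(\<Sum>k=1..n. 1 / real k) \<le> 1 + ln (real n)"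
proof -
  obtain k where n: "n = Suc k" using assms by (cases n) auto
  have "harm (Suc k) - ln (real (Suc k)) \<le> harm (Suc 0) - ln (real (Suc 0))"
    using decseqD[OF decseq_harm_diff_ln, of 0 k] by simp
  then have "harm n \<le> 1 + ln (real n)" unfolding n by (simp add: harm_def)
  then show ?thesis by (simp add: harm_def inverse_eq_divide)
qed

lemma sin_ge_linear:
  assumes "0 \<le> x" "x \<le> pi / 2"
  shows "sin x \<ge> 2 * x / pi"
proof -
  have "convex_on {0..pi} (\<lambda>x. - sin x)"
    by (rule f''_ge0_imp_convex[where f' = "\<lambda>x. - cos x" and f'' = sin])
      (auto intro!: derivative_eq_intros sin_ge_zero)
  from convex_onD[OF this, of "2 * x / pi" 0 "pi / 2"] assms
  show ?thesis by (simp add: field_simps)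
qed

text \<open>The additive character \<open>e(t / s)\<close> of the integers modulo \<open>s\<close>.\<close>

definition nth_root_char :: "nat \<Rightarrow> int \<Rightarrow> complex" where
  "nth_root_char s t = cis (2 * pi * (of_int t / real s))"

lemma nth_root_char_add: "nth_root_char s (a + b) = nth_root_char s a * nth_root_char s b"
  by (simp add: nth_root_char_def cis_mult add_divide_distrib algebra_simps)

lemma nth_root_char_0 [simp]: "nth_root_char s 0 = 1"
  by (simp add: nth_root_char_def)

lemma norm_nth_root_char [simp]: "norm (nth_root_char s a) = 1"
  by (simp add: nth_root_char_def)

lemma cnj_nth_root_char: "cnj (nth_root_char s a) = nth_root_char s (- a)"
  by (simp add: nth_root_char_def cis_cnj)

lemma nth_root_char_cong:
  assumes "s > 0" "[a = b] (mod int s)"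
  shows "nth_root_char s a = nth_root_char s b"
proof -
  obtain k where k: "a = b + int s * k" using assms(2) by (metis cong_iff_lin cong_sym)
  have "nth_root_char s (int s * k) = 1"
    using assms(1) cis_multiple_2pi[of "of_int k"] by (simp add: nth_root_char_def)
  then show ?thesis by (simp add: k nth_root_char_add)
qed

lemma geometric_nth_root_char:
  assumes "u \<le> v"
  shows "(1 - nth_root_char s a) * (\<Sum>t\<in>{u..<v}. nth_root_char s (a * t))
           = nth_root_char s (a * u) - nth_root_char s (a * v)"
  using assms
proof (induction v rule: int_ge_induct)
  case (step v)
  let ?S = "\<Sum>t\<in>{u..<v}. nth_root_char s (a * t)"
  have "{u..<v + 1} = insert v {u..<v}" using step by auto
  then have "(\<Sum>t\<in>{u..<v + 1}. nth_root_char s (a * t)) = nth_root_char s (a * v) + ?S" by simp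
  moreover have "nth_root_char s (a * (v + 1)) = nth_root_char s a * nth_root_char s (a * v)"
    by (simp add: distrib_left nth_root_char_add)
  ultimately have "(1 - nth_root_char s a) * (\<Sum>t\<in>{u..<v + 1}. nth_root_char s (a * t))
      = nth_root_char s (a * v) - nth_root_char s (a * (v + 1)) + (1 - nth_root_char s a) * ?S"
    by (simp add: ring_distribs)
  then show ?case unfolding step.IH by simp
qed simp

text \<open>A geometric sum with ratio \<open>e(a / s)\<close> is at most \<open>1 / sin (pi a / s)\<close>, and Jordan's inequality bounds this by
\<open>s / 2\<close> times the reciprocal of the smaller of \<open>a\<close> and \<open>s - a\<close>. Adding both reciprocals removes the
case distinction.\<close>

lemma norm_geometric_nth_root_char:
  assumes s: "s > 0" and a: "0 < a" "a < int s" and uv: "u \<le> v"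
  shows "norm (\<Sum>t\<in>{u..<v}. nth_root_char s (a * t)) \<le> real s / 2 * (1 / of_int a + 1 / of_int (int s - a))"
proof -
  define z where "z = nth_root_char s a"
  define x where "x = pi * (of_int a / real s)"
  have x: "0 < x" "x < pi" unfolding x_def using s a by (auto simp: field_simps)
  have z: "z = cis (2 * x)" by (simp add: z_def nth_root_char_def x_def mult.assoc)
  have "(1 - cos (2 * x))\<^sup>2 + (sin (2 * x))\<^sup>2 = (2 * sin x)\<^sup>2"
  proof -
    have "(1 - cos (2 * x))\<^sup>2 + (sin (2 * x))\<^sup>2 = (2 * sin x)\<^sup>2 * ((sin x)\<^sup>2 + (cos x)\<^sup>2)"
      unfolding cos_double_sin sin_double by (simp add: power2_eq_square ring_distribs)
    then show ?thesis by simp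
  qed
  then have "norm (1 - z) = sqrt ((2 * sin x)\<^sup>2)"
    by (simp only: z cmod_def minus_complex.sel one_complex.sel cis.sel diff_0 power2_minus)
  then have nz: "norm (1 - z) = 2 * sin x"
    using x sin_ge_zero[of x] real_sqrt_abs[of "2 * sin x"] by (simp only: abs_of_nonneg less_imp_le mult_nonneg_nonneg zero_le_numeral)
  have sinpos: "sin x > 0" using x by (simp add: sin_gt_zero)
  have tel: "(1 - z) * (\<Sum>t\<in>{u..<v}. nth_root_char s (a * t)) = nth_root_char s (a * u) - nth_root_char s (a * v)"
    unfolding z_def by (rule geometric_nth_root_char[OF uv])
  have "norm (1 - z) * norm (\<Sum>t\<in>{u..<v}. nth_root_char s (a * t)) \<le> 1 + 1"
    unfolding norm_mult[symmetric] tel by (rule order.trans[OF norm_triangle_ineq4]) simp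
  then have "norm (\<Sum>t\<in>{u..<v}. nth_root_char s (a * t)) \<le> 1 / sin x"
    unfolding nz using sinpos by (simp add: field_simps)
  also have "1 / sin x \<le> real s / 2 * (1 / of_int a + 1 / of_int (int s - a))"
  proof (cases "x \<le> pi / 2")
    case True
    then have "sin x \<ge> 2 * (of_int a / real s)" using sin_ge_linear[of x] x by (simp add: x_def)
    then have "1 / sin x \<le> 1 / (2 * (of_int a / real s))" using a s sinpos by (intro divide_left_mono mult_pos_pos divide_pos_pos) auto
    also have "\<dots> = real s / 2 * (1 / of_int a)" by simp
    also have "\<dots> \<le> real s / 2 * (1 / of_int a + 1 / of_int (int s - a))"
      using a by (intro mult_left_mono) auto
    finally show ?thesis .
  next
    case False
    have "sin x = sin (pi - x)" by simp
    also have "\<dots> \<ge> 2 * (pi - x) / pi" using False x by (intro sin_ge_linear) auto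
    also have "2 * (pi - x) / pi = 2 * (of_int (int s - a) / real s)"
      using s by (simp add: x_def field_simps)
    finally have "sin x \<ge> 2 * (of_int (int s - a) / real s)" .
    then have "1 / sin x \<le> 1 / (2 * (of_int (int s - a) / real s))" using a s sinpos by (intro divide_left_mono mult_pos_pos divide_pos_pos) auto
    also have "\<dots> = real s / 2 * (1 / of_int (int s - a))" by simp
    also have "\<dots> \<le> real s / 2 * (1 / of_int a + 1 / of_int (int s - a))"
      using a by (intro mult_left_mono) auto
    finally show ?thesis .
  qed
  finally show ?thesis .
qed

lemma sum_nth_root_char_complete:
  assumes "s > 0" "\<not> int s dvd a"
  shows "(\<Sum>t\<in>{0..<int s}. nth_root_char s (a * t)) = 0"
proof -
  define z where "z = nth_root_char s a"
  have "z \<noteq> 1"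
  proof
    assume "z = 1"
    then have "cos (2 * pi * (of_int a / real s)) = 1"
      unfolding z_def nth_root_char_def by (metis cis.sel(1) one_complex.sel(1))
    then obtain k :: int where "2 * pi * (of_int a / real s) = of_int k * 2 * pi"
      using cos_one_2pi_int by blast
    then have "real_of_int a = of_int k * real s" using assms(1) by (simp add: field_simps)
    also have "\<dots> = of_int (k * int s)" by simp
    finally have "a = k * int s" by (simp only: of_int_eq_iff)
    then show False using assms(2) by simp
  qed
  have "(1 - z) * (\<Sum>t\<in>{0..<int s}. nth_root_char s (a * t)) = 0"
    unfolding z_def geometric_nth_root_char[of 0 "int s", simplified]
    using nth_root_char_cong[OF assms(1), of "a * int s" 0] by (simp add: cong_0_iff)
  then show ?thesis using \<open>z \<noteq> 1\<close> by simp
qed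

definition gauss_sum :: "nat \<Rightarrow> int \<Rightarrow> complex" where
  "gauss_sum s t = (\<Sum>a\<in>{0..<int s}. of_int (jacobi_symbol a s) * nth_root_char s (a * t))"

lemma bij_betw_mult_mod:
  assumes "s > 0" "coprime b (int s)"
  shows "bij_betw (\<lambda>a. (b * a) mod int s) {0..<int s} {0..<int s}"
proof -
  have "inj_on (\<lambda>a. (b * a) mod int s) {0..<int s}"
  proof (rule inj_onI)
    fix x y assume xy: "x \<in> {0..<int s}" "y \<in> {0..<int s}" "(b * x) mod int s = (b * y) mod int s"
    then have "[b * x = b * y] (mod int s)" by (simp only: Cong.cong_def)
    then have "[x = y] (mod int s)" using assms(2) by (simp add: cong_mult_lcancel)
    then show "x = y" using xy by (simp add: Cong.cong_def)
  qed
  moreover have "(\<lambda>a. (b * a) mod int s) ` {0..<int s} \<subseteq> {0..<int s}" using assms(1) by auto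
  ultimately show ?thesis
    unfolding bij_betw_def by (simp add: endo_inj_surj)
qed

text \<open>Substitute \<open>b * a\<close> for the summation variable \<open>a\<close>.\<close>

lemma gauss_sum_twist:
  assumes s: "odd s" and b: "coprime b (int s)"
  shows "gauss_sum s t = of_int (jacobi_symbol b s) * gauss_sum s (b * t)"
proof -
  have s0: "s > 0" using s by (intro Nat.gr0I) auto
  have "gauss_sum s t = (\<Sum>a\<in>{0..<int s}. of_int (jacobi_symbol ((b * a) mod int s) s) * nth_root_char s (((b * a) mod int s) * t))"
    unfolding gauss_sum_def by (rule sum.reindex_bij_betw[OF bij_betw_mult_mod[OF s0 b], symmetric])
  also have "\<dots> = (\<Sum>a\<in>{0..<int s}. of_int (jacobi_symbol b s) * (of_int (jacobi_symbol a s) * nth_root_char s (a * (b * t))))"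
  proof (rule sum.cong[OF refl])
    fix a assume "a \<in> {0..<int s}"
    have "jacobi_symbol ((b * a) mod int s) s = jacobi_symbol (b * a) s"
      by (rule jacobi_cong) (simp add: Cong.cong_def)
    moreover have "[((b * a) mod int s) * t = a * (b * t)] (mod int s)"
      by (simp add: Cong.cong_def mod_mult_left_eq) (simp add: mult_ac)
    then have "nth_root_char s (((b * a) mod int s) * t) = nth_root_char s (a * (b * t))"
      by (rule nth_root_char_cong[OF s0])
    ultimately show "of_int (jacobi_symbol ((b * a) mod int s) s) * nth_root_char s (((b * a) mod int s) * t)
        = of_int (jacobi_symbol b s) * (of_int (jacobi_symbol a s) * nth_root_char s (a * (b * t)))"
      using s by (simp add: jacobi_mult_left mult_ac)
  qed
  finally show ?thesis by (simp add: gauss_sum_def sum_distrib_left)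
qed

lemma gauss_sum_cong:
  assumes "s > 0" "[t = u] (mod int s)"
  shows "gauss_sum s t = gauss_sum s u"
  unfolding gauss_sum_def
  by (intro sum.cong refl arg_cong2[of _ _ _ _ "(*)"] nth_root_char_cong assms cong_scalar_left)

text \<open>Squaring identifies \<open>1\<close> and \<open>p - 1\<close>, so it is not injective on the nonzero residues, hence not surjective.\<close>

lemma ex_quadratic_nonresidue:
  assumes p: "prime (p::nat)" "odd p"
  shows "\<exists>x. Legendre x (int p) = -1"
proof (rule ccontr)
  assume *: "\<nexists>x. Legendre x (int p) = -1"
  have p2: "p > 2" using odd_prime_gt_2 p by blast
  define f where "f = (\<lambda>x::int. x\<^sup>2 mod int p)"
  \<comment> \<open>If no symbol is \<open>-1\<close>, every nonzero residue is a square.\<close>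
  have "{1..<int p} \<subseteq> f ` {1..<int p}"
  proof
    fix y assume y: "y \<in> {1..<int p}"
    then have "\<not> int p dvd y" by (auto simp: zdvd_not_zless)
    then have "Legendre y (int p) \<noteq> 0" by (simp add: Legendre_eq_0_iff)
    then have "Legendre y (int p) = 1" using * Legendre_cases[of y "int p"] by auto
    then obtain x where x: "[x\<^sup>2 = y] (mod int p)" by (auto simp: Legendre_def QuadRes_def split: if_splits)
    have "f (x mod int p) = y" using x y by (simp add: f_def Cong.cong_def power_mod)
    moreover have "x mod int p \<noteq> 0"
    proof
      assume "x mod int p = 0"
      then have "f (x mod int p) = 0" by (simp add: f_def)
      then show False using \<open>f (x mod int p) = y\<close> y by simp
    qed
    moreover have "x mod int p \<ge> 0" "x mod int p < int p" using p2 by auto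
    ultimately show "y \<in> f ` {1..<int p}" by (intro image_eqI[of _ _ "x mod int p"]) auto
  qed
  then have sub: "f ` {1..<int p} = {1..<int p}"
    using card_image_le[of "{1..<int p}" f] by (intro card_seteq[symmetric]) auto
  then have "inj_on f {1..<int p}" by (intro eq_card_imp_inj_on) auto
  moreover have "f 1 = f (int p - 1)"
  proof -
    have "[(int p - 1)\<^sup>2 = 1] (mod int p)"
      by (simp add: cong_iff_dvd_diff power2_eq_square algebra_simps)
    then show ?thesis by (simp add: f_def Cong.cong_def)
  qed
  ultimately have "1 = int p - 1" using p2 by (auto dest!: inj_onD)
  then show False using p2 by simp
qed

text \<open>This is where the character \<open>(a / s)\<close> has to be primitive. For a common prime factor \<open>p\<close> of \<open>s\<close> and \<open>t\<close>,
the Chinese remainder theorem gives a \<open>b\<close> that is \<open>1\<close> modulo \<open>s / p\<close> and a nonresidue modulo \<open>p\<close>.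
Substituting \<open>b * a\<close> for \<open>a\<close> changes the sign of the symbol but fixes \<open>e(a t / s)\<close>, so the sum is its
own negative.\<close>

lemma gauss_sum_not_coprime:
  assumes s: "odd s" "squarefree s" and t: "\<not> coprime t (int s)"
  shows "gauss_sum s t = 0"
proof -
  have s0: "s > 0" using s by (intro Nat.gr0I) auto
  have "gcd t (int s) \<noteq> 1" using t by (simp only: coprime_iff_gcd_eq_1 not_False_eq_True)
  then have "nat (gcd t (int s)) \<noteq> 1" by (simp add: nat_eq_iff)
  then obtain p where p: "prime p" "p dvd nat (gcd t (int s))" using prime_factor_nat by blast
  have "int p dvd int (nat (gcd t (int s)))" using p(2) by (simp only: int_dvd_int_iff)
  then have "int p dvd gcd t (int s)" by (simp only: int_nat_eq gcd_ge_0_int if_True)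
  then have pt: "int p dvd t" and ps: "p dvd s" by auto
  obtain k where k: "s = p * k" using ps by blast
  have "k > 0" "p > 0" using k s0 by auto
  have "\<not> p dvd k"
  proof
    assume "p dvd k"
    then have "p ^ 2 dvd s" by (simp add: k power2_eq_square)
    then show False using squarefreeD[OF s(2)] not_prime_unit[of p] p(1) by blast
  qed
  then have cop: "coprime p k" using p(1) by (rule prime_imp_coprime[rotated])
  have "odd p" using k s(1) by auto
  from ex_quadratic_nonresidue[OF p(1) this] obtain x where x: "Legendre x (int p) = -1" by blast
  obtain b where b: "[b = x] (mod int p)" "[b = 1] (mod int k)"
    using binary_chinese_remainder_int[of "int p" "int k" x 1] cop by auto
  have jb: "jacobi_symbol b s = -1"
    using \<open>k > 0\<close> \<open>p > 0\<close> x p jacobi_cong[OF b(2)] Legendre_cong[OF b(1)]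
    by (simp add: k jacobi_mult_right jacobi_prime)
  have "coprime b (int s)"
  proof -
    have "jacobi_symbol (int (nat (b mod int s))) s = -1"
      using jacobi_cong[of "b mod int s" b s] jb s0 by (simp add: Cong.cong_def)
    then have "coprime (nat (b mod int s)) s" using jacobi_eq_0_iff[OF s0, of "nat (b mod int s)"] by auto
    then have "coprime (b mod int s) (int s)" using s0 coprime_int_iff[of "nat (b mod int s)" s] by simp
    then show ?thesis using s0 by simp
  qed
  moreover have "[b * t = t] (mod int s)"
  proof -
    have "int k dvd b - 1" using b(2) by (simp add: cong_iff_dvd_diff)
    then have "int p * int k dvd t * (b - 1)" using pt by (intro mult_dvd_mono)
    then show ?thesis by (simp add: k cong_iff_dvd_diff algebra_simps)
  qed
  ultimately have "gauss_sum s t = - gauss_sum s t"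
    using gauss_sum_twist[OF s(1), of b t] gauss_sum_cong[OF s0, of "b * t" t] jb by simp
  then show ?thesis by simp
qed

lemma gauss_sum_eq_twist:
  assumes s: "odd s" "squarefree s"
  shows "gauss_sum s t = of_int (jacobi_symbol t s) * gauss_sum s 1"
proof (cases "coprime t (int s)")
  case False
  have s0: "s > 0" using s by (intro Nat.gr0I) auto
  have "\<not> coprime (t mod int s) (int s)" using False s0 by simp
  then have "\<not> coprime (nat (t mod int s)) s" using s0 coprime_int_iff[of "nat (t mod int s)" s] by simp
  then have "jacobi_symbol (t mod int s) s = 0"
    using jacobi_eq_0_iff[OF s0, of "nat (t mod int s)"] s0 by simp
  moreover have "jacobi_symbol (t mod int s) s = jacobi_symbol t s"
    by (rule jacobi_cong) (simp add: Cong.cong_def)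
  ultimately show ?thesis using gauss_sum_not_coprime[OF s False] by simp
next
  case True
  have s0: "s > 0" using s by (intro Nat.gr0I) auto
  have "coprime (t mod int s) (int s)" using True s0 by simp
  then have "coprime (nat (t mod int s)) s" using s0 coprime_int_iff[of "nat (t mod int s)" s] by simp
  then have "jacobi_symbol (t mod int s) s \<noteq> 0"
    using jacobi_eq_0_iff[OF s0, of "nat (t mod int s)"] s0 by simp
  moreover have "jacobi_symbol (t mod int s) s = jacobi_symbol t s"
    by (rule jacobi_cong) (simp add: Cong.cong_def)
  ultimately have "jacobi_symbol t s = 1 \<or> jacobi_symbol t s = -1" using jacobi_cases[of t s] by auto
  moreover have "gauss_sum s 1 = of_int (jacobi_symbol t s) * gauss_sum s t"
    using gauss_sum_twist[OF s(1) True, of 1] by (simp only: mult_1_right)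
  ultimately show ?thesis by (elim disjE) simp_all
qed

text \<open>Parseval: the mean square of \<open>gauss_sum s t\<close> over \<open>t\<close> modulo \<open>s\<close> is computed once from orthogonality
of the additive characters and once from \<open>gauss_sum_eq_twist\<close>.\<close>

lemma norm_gauss_sum:
  assumes s: "odd s" "squarefree s"
  shows "norm (gauss_sum s 1) = sqrt (real s)"
proof -
  have s0: "s > 0" using s by (intro Nat.gr0I) auto
  define N where "N = (\<Sum>a\<in>{0..<int s}. (of_int (jacobi_symbol a s))\<^sup>2 :: complex)"
  let ?I = "{0..<int s}"
  let ?J = "\<lambda>a. of_int (jacobi_symbol a s) :: complex"
  have "(\<Sum>t\<in>?I. gauss_sum s t * cnj (gauss_sum s t)) =
      (\<Sum>t\<in>?I. \<Sum>a\<in>?I. \<Sum>b\<in>?I. ?J a * ?J b * nth_root_char s ((a - b) * t))"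
  proof (rule sum.cong[OF refl])
    fix t
    have "nth_root_char s (a * t) * cnj (nth_root_char s (b * t)) = nth_root_char s ((a - b) * t)" for a b
      by (simp add: cnj_nth_root_char nth_root_char_add[symmetric] algebra_simps)
    then have "(?J a * nth_root_char s (a * t)) * cnj (?J b * nth_root_char s (b * t))
        = ?J a * ?J b * nth_root_char s ((a - b) * t)" for a b
      by (simp add: mult.assoc mult.left_commute)
    moreover have "gauss_sum s t * cnj (gauss_sum s t) =
        (\<Sum>a\<in>?I. \<Sum>b\<in>?I. (?J a * nth_root_char s (a * t)) * cnj (?J b * nth_root_char s (b * t)))"
      by (simp only: gauss_sum_def cnj_sum sum_product)
    ultimately show "gauss_sum s t * cnj (gauss_sum s t) =
        (\<Sum>a\<in>?I. \<Sum>b\<in>?I. ?J a * ?J b * nth_root_char s ((a - b) * t))"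
      by (simp only:)
  qed
  also have "\<dots> = (\<Sum>a\<in>?I. \<Sum>t\<in>?I. \<Sum>b\<in>?I. ?J a * ?J b * nth_root_char s ((a - b) * t))"
    by (rule sum.swap)
  also have "\<dots> = (\<Sum>a\<in>?I. \<Sum>b\<in>?I. \<Sum>t\<in>?I. ?J a * ?J b * nth_root_char s ((a - b) * t))"
    by (intro sum.cong refl sum.swap)
  also have "\<dots> = (\<Sum>a\<in>?I. \<Sum>b\<in>?I. ?J a * ?J b * (\<Sum>t\<in>?I. nth_root_char s ((a - b) * t)))"
    by (simp only: sum_distrib_left)
  also have "\<dots> = (\<Sum>a\<in>?I. \<Sum>b\<in>?I. if b = a then of_nat s * (?J a)\<^sup>2 else 0)"
  proof (intro sum.cong refl)
    fix a b assume ab: "a \<in> ?I" "b \<in> ?I"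
    show "?J a * ?J b * (\<Sum>t\<in>?I. nth_root_char s ((a - b) * t)) = (if b = a then of_nat s * (?J a)\<^sup>2 else 0)"
    proof (cases "a = b")
      case False
      have "\<not> int s dvd a - b"
      proof
        assume "int s dvd a - b"
        then have "[a = b] (mod int s)" by (simp add: cong_iff_dvd_diff)
        then show False using ab False by (simp add: Cong.cong_def)
      qed
      then show ?thesis using sum_nth_root_char_complete[OF s0] False by simp
    qed (simp add: power2_eq_square)
  qed
  also have "\<dots> = of_nat s * N" by (simp add: N_def sum_distrib_left)
  finally have 1: "(\<Sum>t\<in>?I. gauss_sum s t * cnj (gauss_sum s t)) = of_nat s * N" .
  have "(\<Sum>t\<in>?I. gauss_sum s t * cnj (gauss_sum s t)) = N * (gauss_sum s 1 * cnj (gauss_sum s 1))"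
    unfolding N_def sum_distrib_right
  proof (rule sum.cong[OF refl])
    fix t
    show "gauss_sum s t * cnj (gauss_sum s t) = (?J t)\<^sup>2 * (gauss_sum s 1 * cnj (gauss_sum s 1))"
      unfolding gauss_sum_eq_twist[OF s, of t] by (simp add: power2_eq_square mult_ac)
  qed
  with 1 have 2: "N * (gauss_sum s 1 * cnj (gauss_sum s 1)) = N * of_nat s" by (simp add: mult_ac)
  have "N \<noteq> 0"
  proof -
    define M where "M = (\<Sum>a\<in>?I. (jacobi_symbol a s)\<^sup>2)"
    have "M \<ge> (\<Sum>a\<in>{1 mod int s}. (jacobi_symbol a s)\<^sup>2)" unfolding M_def
      using s0 by (intro sum_mono2) auto
    also have "(\<Sum>a\<in>{1 mod int s}. (jacobi_symbol a s)\<^sup>2) = 1"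
      using jacobi_cong[of "1 mod int s" 1 s] by (simp add: Cong.cong_def)
    finally have "M \<noteq> 0" by simp
    moreover have "N = of_int M" by (simp add: N_def M_def)
    ultimately show ?thesis by simp
  qed
  with 2 have "gauss_sum s 1 * cnj (gauss_sum s 1) = of_nat s" by simp
  then have "complex_of_real ((norm (gauss_sum s 1))\<^sup>2) = of_real (real s)"
    by (simp only: complex_norm_square of_real_of_nat_eq)
  then have "(norm (gauss_sum s 1))\<^sup>2 = real s" by (simp only: of_real_eq_iff)
  then show ?thesis by (metis norm_ge_zero real_sqrt_unique)
qed

text \<open>Multiplying by the Gauss sum turns \<open>(t / s)\<close> into a combination of the additive characters \<open>e(a t / s)\<close>,
whose sums over an interval are geometric. The total is at most \<open>s (1 + ln s)\<close>, and dividing by the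
modulus \<open>sqrt s\<close> of the Gauss sum gives the bound.\<close>

theorem polya_vinogradov_jacobi:
  assumes s: "odd s" "squarefree s" "s > 1"
  shows "\<bar>\<Sum>t\<in>{u..<v}. real_of_int (jacobi_symbol t s)\<bar> \<le> sqrt (real s) * (1 + ln (real s))"
proof (cases "u \<le> v")
  case uv: True
  have s0: "s > 0" using s by simp
  define S where "S = (\<Sum>t\<in>{u..<v}. real_of_int (jacobi_symbol t s))"
  let ?E = "\<lambda>a. \<Sum>t\<in>{u..<v}. nth_root_char s (a * t)"
  have "jacobi_symbol (int 0) s = 0" using jacobi_eq_0_iff[OF s0, of 0] s by simp
  then have J0: "jacobi_symbol 0 s = 0" by simp
  have "of_real S * gauss_sum s 1 = (\<Sum>t\<in>{u..<v}. gauss_sum s t)"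
    unfolding S_def of_real_sum sum_distrib_right
    by (rule sum.cong[OF refl], subst gauss_sum_eq_twist[OF s(1,2)]) simp
  also have "\<dots> = (\<Sum>a\<in>{0..<int s}. of_int (jacobi_symbol a s) * ?E a)"
    unfolding gauss_sum_def sum_distrib_left by (rule sum.swap)
  also have "{0..<int s} = insert 0 (int ` {1..<s})"
    using s0 by (auto simp: image_iff) (metis atLeastLessThan_iff nat_0_le nat_less_iff of_nat_0_less_iff zero_less_nat_eq order_le_less Suc_leI One_nat_def)
  also have "(\<Sum>a\<in>insert 0 (int ` {1..<s}). of_int (jacobi_symbol a s) * ?E a)
      = (\<Sum>a\<in>{1..<s}. of_int (jacobi_symbol (int a) s) * ?E (int a))"
    by (subst sum.insert) (auto simp: J0 sum.reindex)
  finally have "\<bar>S\<bar> * sqrt (real s) = norm (\<Sum>a\<in>{1..<s}. of_int (jacobi_symbol (int a) s) * ?E (int a))"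
    by (metis norm_mult norm_of_real norm_gauss_sum[OF s(1,2)])
  also have "\<dots> \<le> (\<Sum>a\<in>{1..<s}. real s / 2 * (1 / real a + 1 / real (s - a)))"
  proof (intro order.trans[OF norm_sum] sum_mono)
    fix a assume a: "a \<in> {1..<s}"
    have "norm (of_int (jacobi_symbol (int a) s) * ?E (int a)) \<le> 1 * norm (?E (int a))"
      unfolding norm_mult using abs_jacobi_le_real[of "int a" s] by (intro mult_right_mono) auto
    also have "\<dots> \<le> real s / 2 * (1 / of_int (int a) + 1 / of_int (int s - int a))"
      using norm_geometric_nth_root_char[OF s0 _ _ uv, of "int a"] a by simp
    also have "\<dots> = real s / 2 * (1 / real a + 1 / real (s - a))"
      using a by (simp add: of_nat_diff)
    finally show "norm (of_int (jacobi_symbol (int a) s) * ?E (int a)) \<le> real s / 2 * (1 / real a + 1 / real (s - a))" .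
  qed
  also have "\<dots> = real s / 2 * ((\<Sum>a\<in>{1..<s}. 1 / real a) + (\<Sum>a\<in>{1..<s}. 1 / real (s - a)))"
    by (simp only: sum_distrib_left[symmetric] sum.distrib)
  also have "(\<Sum>a\<in>{1..<s}. 1 / real (s - a)) = (\<Sum>a\<in>{1..<s}. 1 / real a)"
    by (rule sum.reindex_bij_witness[of _ "\<lambda>a. s - a" "\<lambda>a. s - a"]) auto
  also have "real s / 2 * ((\<Sum>a\<in>{1..<s}. 1 / real a) + (\<Sum>a\<in>{1..<s}. 1 / real a))
      = real s * (\<Sum>a\<in>{1..<s}. 1 / real a)" by simp
  also have "\<dots> \<le> real s * (1 + ln (real s))"
  proof (rule mult_left_mono)
    have "(\<Sum>a\<in>{1..<s}. 1 / real a) \<le> (\<Sum>a=1..s. 1 / real a)"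
      by (intro sum_mono2) auto
    also have "\<dots> \<le> 1 + ln (real s)" using s by (intro sum_inverse_le_ln) auto
    finally show "(\<Sum>a\<in>{1..<s}. 1 / real a) \<le> 1 + ln (real s)" .
  qed simp
  also have "\<dots> = (sqrt (real s) * (1 + ln (real s))) * sqrt (real s)" by simp
  finally show ?thesis unfolding S_def[symmetric] using s0 by (subst (asm) mult_le_cancel_right) auto
next
  case False
  have "0 \<le> sqrt (real s) * (1 + ln (real s))" using s by (intro mult_nonneg_nonneg) auto
  then show ?thesis using False by simp
qed

section \<open>Character sums over the modulus\<close>

lemma jacobi_4_times:
  assumes "odd s"
  shows "jacobi_symbol (4 * a) s = jacobi_symbol a s"
proof -
  have "coprime 2 s" using assms by simp
  then have "jacobi_symbol (int (2 ^ 2)) s = 1" using jacobi_square[OF assms, of 2] by simp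
  then show ?thesis using jacobi_mult_left[OF assms, of 4 a] by simp
qed

text \<open>Since \<open>(4 / s) = 1\<close>, a progression \<open>4 t + c\<close> can be replaced by the interval \<open>t + c'\<close> with \<open>4 c'\<close>
congruent to \<open>c\<close> modulo \<open>s\<close>.\<close>

lemma jacobi_sum_class_mod_4:
  assumes s: "odd s" "squarefree s" "s > 1" and c: "c = 1 \<or> c = 3"
  shows "\<bar>\<Sum>r | r \<le> Z \<and> r mod 4 = c. real_of_int (jacobi_symbol (int r) s)\<bar>
           \<le> sqrt (real s) * (1 + ln (real s))"
proof -
  define T where "T = (Z + 4 - c) div 4"
  have "coprime (4::int) (int s)"
  proof -
    have "coprime (2::int) (int s)" using s(1) by simp
    then have "coprime ((2::int)^2) (int s)" by (simp only: coprime_power_left_iff) simp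
    then show ?thesis by simp
  qed
  then obtain y where y: "[4 * y = 1] (mod int s)" using cong_solve_coprime_int by blast
  define c' where "c' = y * int c"
  have c': "[4 * c' = int c] (mod int s)"
    using cong_scalar_right[OF y, of "int c"] by (simp add: c'_def mult.assoc)
  have *: "jacobi_symbol (int (4 * t + c)) s = jacobi_symbol (int t + c') s" for t
  proof -
    have "[int (4 * t + c) = 4 * (int t + c')] (mod int s)"
      using cong_add[OF cong_refl[of "4 * int t"] cong_sym[OF c']] by (simp add: distrib_left)
    then show ?thesis using jacobi_cong jacobi_4_times[OF s(1)] by metis
  qed
  have "{r. r \<le> Z \<and> r mod 4 = c} = (\<lambda>t. 4 * t + c) ` {0..<T}"
  proof (intro equalityI subsetI)
    fix r assume "r \<in> {r. r \<le> Z \<and> r mod 4 = c}"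
    then have r: "r \<le> Z" "r mod 4 = c" by auto
    then have "r = 4 * (r div 4) + c" using mult_div_mod_eq[of 4 r] by simp
    moreover from this have "r div 4 < T" using r c unfolding T_def by auto
    ultimately show "r \<in> (\<lambda>t. 4 * t + c) ` {0..<T}" by (intro image_eqI[of _ _ "r div 4"]) auto
  next
    fix r assume "r \<in> (\<lambda>t. 4 * t + c) ` {0..<T}"
    then show "r \<in> {r. r \<le> Z \<and> r mod 4 = c}" using c unfolding T_def by auto
  qed
  then have "(\<Sum>r | r \<le> Z \<and> r mod 4 = c. real_of_int (jacobi_symbol (int r) s))
      = (\<Sum>t\<in>{0..<T}. real_of_int (jacobi_symbol (int (4 * t + c)) s))"
    by (simp add: sum.reindex inj_on_def)
  also have "\<dots> = (\<Sum>t\<in>{0..<T}. real_of_int (jacobi_symbol (int t + c') s))"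
    by (simp only: *)
  also have "\<dots> = (\<Sum>t\<in>{c'..<c' + int T}. real_of_int (jacobi_symbol t s))"
    by (rule sum.reindex_bij_witness[of _ "\<lambda>t. nat (t - c')" "\<lambda>t. int t + c'"]) auto
  finally show ?thesis using polya_vinogradov_jacobi[OF s] by simp
qed

text \<open>Here the modulus of the symbol is the variable of summation. Reciprocity exchanges the two arguments at the cost
of a sign that is constant on each class modulo 4.\<close>

lemma jacobi_sum_squarefree_modulus:
  assumes s: "odd s" "squarefree s" "s > 1"
  shows "\<bar>\<Sum>r | r \<le> Z \<and> odd r. real_of_int (jacobi_symbol (int s) r)\<bar>
           \<le> 2 * (sqrt (real s) * (1 + ln (real s)))"
proof -
  let ?A = "\<lambda>c. {r. r \<le> Z \<and> r mod 4 = c}"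
  let ?J = "\<lambda>r. real_of_int (jacobi_symbol (int s) r)"
  have split: "{r. r \<le> Z \<and> odd r} = ?A 1 \<union> ?A 3"
  proof -
    have "odd r \<longleftrightarrow> r mod 4 = 1 \<or> r mod 4 = 3" for r :: nat by presburger
    then show ?thesis by auto
  qed
  have one: "\<bar>\<Sum>r\<in>?A c. ?J r\<bar> \<le> sqrt (real s) * (1 + ln (real s))" if c: "c = 1 \<or> c = 3" for c
  proof -
    have "(\<Sum>r\<in>?A c. ?J r) = (\<Sum>r\<in>?A c. real_of_int (reciprocity_sign s c) * real_of_int (jacobi_symbol (int r) s))"
    proof (rule sum.cong[OF refl])
      fix r assume "r \<in> ?A c"
      then have r: "r mod 4 = c" by simp
      then have "odd r" using c by presburger
      moreover have "reciprocity_sign s r = reciprocity_sign s c" using r c by (auto simp: reciprocity_sign_def)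
      ultimately show "?J r = real_of_int (reciprocity_sign s c) * real_of_int (jacobi_symbol (int r) s)"
        using jacobi_reciprocity[OF s(1)] by simp
    qed
    also have "\<dots> = real_of_int (reciprocity_sign s c) * (\<Sum>r\<in>?A c. real_of_int (jacobi_symbol (int r) s))"
      by (rule sum_distrib_left[symmetric])
    finally show ?thesis using jacobi_sum_class_mod_4[OF s c, of Z]
      by (simp add: abs_mult reciprocity_sign_def)
  qed
  have fin: "finite (?A c)" for c by (rule finite_subset[of _ "{..Z}"]) auto
  have "(\<Sum>r | r \<le> Z \<and> odd r. ?J r) = (\<Sum>r\<in>?A 1. ?J r) + (\<Sum>r\<in>?A 3. ?J r)"
    unfolding split using fin by (intro sum.union_disjoint) auto
  then show ?thesis using one[of 1] one[of 3] by linarith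
qed

text \<open>Removing the multiples of one more prime \<open>p\<close> subtracts \<open>(s / p)\<close> times a sum of the same kind up to \<open>Z / p\<close>,
so each prime at most doubles the bound.\<close>

lemma jacobi_sum_coprime_to_primes:
  fixes s :: nat
  assumes bound: "\<And>Z. \<bar>\<Sum>r | r \<le> Z \<and> odd r. real_of_int (jacobi_symbol (int s) r)\<bar> \<le> B"
    and "finite P" "\<And>p. p \<in> P \<Longrightarrow> prime p \<and> odd p"
  shows "\<bar>\<Sum>r | r \<le> Z \<and> odd r \<and> (\<forall>p\<in>P. \<not> p dvd r). real_of_int (jacobi_symbol (int s) r)\<bar> \<le> 2 ^ card P * B"
  using assms(2,3)
proof (induction P arbitrary: Z rule: finite_induct)
  case empty
  then show ?case using bound by simp
next
  case (insert p P)
  let ?J = "\<lambda>r. real_of_int (jacobi_symbol (int s) r)"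
  let ?A = "\<lambda>Z. {r. r \<le> Z \<and> odd r \<and> (\<forall>p\<in>P. \<not> p dvd r)}"
  have fin: "finite (?A Z)" for Z by (rule finite_subset[of _ "{..Z}"]) auto
  have p: "prime p" "odd p" using insert.prems by auto
  have p0: "p > 0" using p(1) by (simp add: prime_gt_0_nat)
  have IH: "\<bar>\<Sum>r\<in>?A Z. ?J r\<bar> \<le> 2 ^ card P * B" for Z using insert.IH insert.prems by blast
  have mult: "{r\<in>?A Z. p dvd r} = (\<lambda>r. p * r) ` ?A (Z div p)"
  proof (intro equalityI subsetI)
    fix r assume r: "r \<in> {r\<in>?A Z. p dvd r}"
    then obtain k where k: "r = p * k" by auto
    have "k \<le> Z div p" using r k p0 by (simp add: less_eq_div_iff_mult_less_eq mult.commute)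
    then show "r \<in> (\<lambda>r. p * r) ` ?A (Z div p)" using r k by (intro image_eqI[of _ _ k]) auto
  next
    fix r assume "r \<in> (\<lambda>r. p * r) ` ?A (Z div p)"
    then obtain k where k: "r = p * k" "k \<le> Z div p" "odd k" "\<forall>q\<in>P. \<not> q dvd k" by auto
    have "r \<le> Z" using k p0 by (simp add: less_eq_div_iff_mult_less_eq mult.commute)
    moreover have "\<not> q dvd r" if "q \<in> P" for q
    proof
      assume "q dvd r"
      moreover have "prime q" using insert.prems that by blast
      ultimately have "q dvd p \<or> q dvd k" using k(1) prime_dvd_mult_iff by blast
      then have "q dvd p" using k(4) that by blast
      then have "q = p" using \<open>prime q\<close> p(1) primes_dvd_imp_eq by blast
      then show False using that insert.hyps by blast
    qed
    ultimately show "r \<in> {r\<in>?A Z. p dvd r}" using k p by auto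
  qed
  have "(\<Sum>r\<in>{r\<in>?A Z. p dvd r}. ?J r) = (\<Sum>r\<in>?A (Z div p). ?J (p * r))"
    unfolding mult using p0 by (subst sum.reindex) (auto simp: inj_on_def)
  also have "\<dots> = (\<Sum>r\<in>?A (Z div p). ?J p * ?J r)"
  proof (rule sum.cong[OF refl])
    fix r assume "r \<in> ?A (Z div p)"
    then have "r > 0" by (auto intro!: Nat.gr0I)
    then show "?J (p * r) = ?J p * ?J r" using p0 by (simp add: jacobi_mult_right)
  qed
  finally have "\<bar>\<Sum>r\<in>{r\<in>?A Z. p dvd r}. ?J r\<bar> = \<bar>?J p\<bar> * \<bar>\<Sum>r\<in>?A (Z div p). ?J r\<bar>"
    by (simp only: sum_distrib_left[symmetric] abs_mult)
  also have "\<dots> \<le> 1 * (2 ^ card P * B)"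
    using IH abs_jacobi_le_real by (intro mult_mono) auto
  finally have 1: "\<bar>\<Sum>r\<in>{r\<in>?A Z. p dvd r}. ?J r\<bar> \<le> 2 ^ card P * B" by simp
  have "{r. r \<le> Z \<and> odd r \<and> (\<forall>q\<in>insert p P. \<not> q dvd r)} = ?A Z - {r\<in>?A Z. p dvd r}" by auto
  then have "(\<Sum>r | r \<le> Z \<and> odd r \<and> (\<forall>q\<in>insert p P. \<not> q dvd r). ?J r)
      = (\<Sum>r\<in>?A Z. ?J r) - (\<Sum>r\<in>{r\<in>?A Z. p dvd r}. ?J r)"
    using fin[of Z] by (simp only:) (rule sum_diff, auto)
  moreover have "2 ^ card (insert p P) * B = 2 * (2 ^ card P * B)" using insert.hyps by simp
  ultimately show ?case using 1 IH[of Z] by linarith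
qed

lemma two_power_card_prime_factors_le: "b > 0 \<Longrightarrow> 2 ^ card (prime_factors b) \<le> (b::nat)"
proof -
  assume b: "b > 0"
  have "2 ^ card (prime_factors b) = (\<Prod>p\<in>prime_factors b. 2::nat)" by simp
  also have "\<dots> \<le> (\<Prod>p\<in>prime_factors b. p ^ multiplicity p b)"
  proof (rule prod_mono, safe)
    fix p assume p: "p \<in> prime_factors b"
    then have "2 \<le> p" "multiplicity p b \<ge> 1"
      by (auto simp: prime_factors_multiplicity prime_ge_2_nat Suc_le_eq)
    then show "2 \<le> p ^ multiplicity p b"
      by (metis order.trans self_le_power One_nat_def Suc_le_eq le_zero_eq not_less_eq_eq one_le_numeral)
  qed
  also have "\<dots> = b" using b prod_prime_factors[of b] by simp
  finally show ?thesis .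
qed

lemma odd_squarefree_decompose:
  fixes n :: nat
  assumes "odd n"
  obtains s b where "n = s * b ^ 2" "squarefree s" "odd s" "odd b"
proof -
  have "n = squarefree_part n * square_part n ^ 2" by (rule squarefree_decompose)
  moreover from this have "odd (squarefree_part n)" "odd (square_part n)"
    using assms by (metis even_mult_iff, metis even_mult_iff even_power zero_less_numeral)
  ultimately show ?thesis using that by blast
qed

text \<open>Write \<open>n = s b^2\<close> with \<open>s\<close> squarefree. Then \<open>(n / r)\<close> is \<open>(s / r)\<close> for \<open>r\<close> coprime to \<open>b\<close> and zero otherwise,
and \<open>s > 1\<close> because \<open>n\<close> is not a square. The factor 2 lost for each prime of \<open>b\<close> is absorbed because
\<open>sqrt n = b sqrt s\<close>.\<close>

theorem jacobi_sum_modulus: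
  assumes n: "odd n" "\<nexists>k. n = k ^ 2"
  shows "\<bar>\<Sum>r | r \<le> Z \<and> odd r. real_of_int (jacobi_symbol (int n) r)\<bar>
           \<le> 2 * (sqrt (real n) * (1 + ln (real n)))"
proof -
  obtain s b where sb: "n = s * b ^ 2" "squarefree s" "odd s" "odd b"
    using odd_squarefree_decompose[OF n(1)] .
  have "s \<noteq> 1" using n(2) sb(1) by auto
  then have s: "s > 1" using sb(3) by (cases s) auto
  have b0: "b > 0" using sb(4) by (intro Nat.gr0I) auto
  let ?B = "2 * (sqrt (real s) * (1 + ln (real s)))"
  let ?A = "{r. r \<le> Z \<and> odd r \<and> (\<forall>p\<in>prime_factors b. \<not> p dvd r)}"
  have "(\<Sum>r | r \<le> Z \<and> odd r. real_of_int (jacobi_symbol (int n) r)) = (\<Sum>r\<in>?A. real_of_int (jacobi_symbol (int s) r))"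
  proof (rule sum.mono_neutral_cong_right)
    show "finite {r. r \<le> Z \<and> odd r}" by (rule finite_subset[of _ "{..Z}"]) auto
    have J: "jacobi_symbol (int n) r = jacobi_symbol (int s) r * (if coprime b r then 1 else 0)" if "odd r" for r
    proof -
      have "jacobi_symbol (int n) r = jacobi_symbol (int s * int (b ^ 2)) r" by (simp add: sb(1))
      then show ?thesis using jacobi_mult_left[OF that] jacobi_square[OF that] by simp
    qed
    have cop: "coprime b r \<longleftrightarrow> (\<forall>p\<in>prime_factors b. \<not> p dvd r)" for r
    proof
      assume "coprime b r"
      then show "\<forall>p\<in>prime_factors b. \<not> p dvd r"
        by (metis coprime_common_divisor in_prime_factors_iff not_prime_unit)
    next
      assume *: "\<forall>p\<in>prime_factors b. \<not> p dvd r"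
      show "coprime b r"
      proof (rule ccontr)
        assume "\<not> coprime b r"
        then have "gcd b r \<noteq> 1" by (simp only: coprime_iff_gcd_eq_1 not_False_eq_True)
        then obtain p where "prime p" "p dvd gcd b r" using prime_factor_nat by blast
        then show False using * b0 by (auto simp: in_prime_factors_iff)
      qed
    qed
    show "\<forall>r\<in>{r. r \<le> Z \<and> odd r} - ?A. real_of_int (jacobi_symbol (int n) r) = 0"
      using J cop by auto
    show "real_of_int (jacobi_symbol (int n) r) = real_of_int (jacobi_symbol (int s) r)" if "r \<in> ?A" for r
      using that J[of r] cop[of r] by auto
  qed auto
  also have "\<bar>\<dots>\<bar> \<le> 2 ^ card (prime_factors b) * ?B"
  proof (rule jacobi_sum_coprime_to_primes)
    fix Z show "\<bar>\<Sum>r | r \<le> Z \<and> odd r. real_of_int (jacobi_symbol (int s) r)\<bar> \<le> ?B"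
      by (rule jacobi_sum_squarefree_modulus[OF sb(3,2) s])
    show "prime p \<and> odd p" if "p \<in> prime_factors b" for p
      using that sb(4) by (auto dest: dvd_trans)
  qed simp
  also have "\<dots> \<le> real b * (2 * (sqrt (real s) * (1 + ln (real n))))"
  proof (intro mult_mono add_mono order_refl)
    have "real (2 ^ card (prime_factors b)) \<le> real b"
      using two_power_card_prime_factors_le[OF b0] by (simp only: of_nat_le_iff)
    then show "2 ^ card (prime_factors b) \<le> real b" by simp
    have "s \<le> n" using b0 by (simp add: sb(1))
    then show "ln (real s) \<le> ln (real n)" using s by simp
  qed (use s in auto)
  also have "real b * (2 * (sqrt (real s) * (1 + ln (real n)))) = 2 * (sqrt (real n) * (1 + ln (real n)))"
    by (simp add: sb(1) real_sqrt_mult)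
  finally show ?thesis .
qed

section \<open>Mean squares of character sums\<close>

lemma squarefree_part_eq_of_mult_square:
  fixes a b k :: nat
  assumes "a * b = k ^ 2" "a > 0" "b > 0"
  shows "squarefree_part a = squarefree_part b"
proof (rule multiplicity_eq_nat)
  show "squarefree_part a > 0" "squarefree_part b > 0"
    using squarefree_part_nonzero[of a] squarefree_part_nonzero[of b] by (auto intro!: Nat.gr0I simp del: squarefree_part_nonzero)
next
  fix p :: nat assume p: "prime p"
  have "k \<noteq> 0" using assms by (intro notI) simp
  have "multiplicity p a + multiplicity p b = multiplicity p (k ^ 2)"
    using assms p by (simp add: prime_elem_multiplicity_mult_distrib flip: assms(1))
  also have "\<dots> = 2 * multiplicity p k"
    using p \<open>k \<noteq> 0\<close> by (simp add: prime_elem_multiplicity_power_distrib)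
  finally have "multiplicity p a mod 2 = multiplicity p b mod 2" by presburger
  then show "multiplicity p (squarefree_part a) = multiplicity p (squarefree_part b)"
    using p assms by (simp add: prime_multiplicity_squarefree_part)
qed

definition zeta_three_halves :: real where
  "zeta_three_halves = (\<Sum>k. real k powr (-3/2))"

lemma sum_power_three_halves_le: "(\<Sum>k=1..N. 1 / (real k * sqrt (real k))) \<le> zeta_three_halves"
  and zeta_three_halves_nonneg: "zeta_three_halves \<ge> 0"
proof -
  have s: "summable (\<lambda>k. real k powr (-3/2))" by (simp add: summable_real_powr_iff)
  have eq: "1 / (real k * sqrt (real k)) = real k powr (-3/2)" if "k > 0" for k :: nat
  proof -
    have "real k powr (-3/2) = 1 / (real k powr (1 + 1/2))" using that by (simp add: powr_minus_divide)
    also have "real k powr (1 + 1/2) = real k * sqrt (real k)"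
      using that by (simp only: powr_add) (simp add: powr_half_sqrt)
    finally show ?thesis by simp
  qed
  have "(\<Sum>k=1..N. 1 / (real k * sqrt (real k))) = (\<Sum>k=1..N. real k powr (-3/2))"
    by (intro sum.cong refl eq) auto
  also have "\<dots> \<le> zeta_three_halves"
    unfolding zeta_three_halves_def by (intro sum_le_suminf s) auto
  finally show "(\<Sum>k=1..N. 1 / (real k * sqrt (real k))) \<le> zeta_three_halves" .
  show "zeta_three_halves \<ge> 0" unfolding zeta_three_halves_def by (intro suminf_nonneg s) auto
qed

text \<open>If \<open>a * b\<close> is a square, then \<open>a = s u^2\<close> and \<open>b = s v^2\<close> with the same squarefree \<open>s\<close>. Now \<open>a b = (s u v)^2\<close>,
and \<open>s u v >= M\<close>, so \<open>1 / (a b)\<close> is at most \<open>(s u v) powr (-3/2) / sqrt M\<close>; the sum of the first factor over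
all \<open>s, u, v\<close> is the cube of a convergent series.\<close>

lemma sum_square_pairs_le:
  assumes M: "M \<ge> 1"
  shows "(\<Sum>(a, b) | a \<in> {M..N} \<and> b \<in> {M..N} \<and> (\<exists>k. a * b = k ^ 2). 1 / (real a * real b))
           \<le> zeta_three_halves ^ 3 / sqrt (real M)"
proof -
  define h where "h = (\<lambda>k::nat. 1 / (real k * sqrt (real k)))"
  define Z where "Z = zeta_three_halves"
  have Z: "Z \<ge> 0" "\<And>N. (\<Sum>k=1..N. h k) \<le> Z"
    using sum_power_three_halves_le zeta_three_halves_nonneg by (simp_all add: h_def Z_def)
  have hmult: "h (a * b) = h a * h b" for a b by (simp add: h_def real_sqrt_mult mult_ac)
  have h0: "h k \<ge> 0" for k by (simp add: h_def)
  define P where "P = {(a, b). a \<in> {M..N} \<and> b \<in> {M..N} \<and> (\<exists>k. a * b = k ^ 2)}"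
  define f where "f = (\<lambda>(a::nat, b::nat). (squarefree_part a, square_part a, square_part b))"
  define g where "g = (\<lambda>(s, b1, b2). h s * (h b1 * h b2))"
  have fin: "finite P" unfolding P_def by (rule finite_subset[of _ "{M..N} \<times> {M..N}"]) auto
  have parts: "a = squarefree_part a * square_part a ^ 2" "b = squarefree_part a * square_part b ^ 2"
    if "(a, b) \<in> P" for a b
  proof -
    have "a > 0" "b > 0" using that M by (auto simp: P_def)
    then have "squarefree_part a = squarefree_part b"
      using squarefree_part_eq_of_mult_square that unfolding P_def by blast
    then show "a = squarefree_part a * square_part a ^ 2" "b = squarefree_part a * square_part b ^ 2"
      using squarefree_decompose[of a] squarefree_decompose[of b] by simp_all
  qed
  have inj: "inj_on f P"
  proof (rule inj_onI, clarify)
    fix a b a' b' assume *: "(a, b) \<in> P" "(a', b') \<in> P" "f (a, b) = f (a', b')"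
    then show "a = a' \<and> b = b'"
      using parts[OF *(1)] parts[OF *(2)] by (auto simp: f_def)
  qed
  have le: "(case x of (a, b) \<Rightarrow> 1 / (real a * real b)) \<le> g (f x) / sqrt (real M)" if x: "x \<in> P" for x
  proof -
    obtain a b where ab: "x = (a, b)" by fastforce
    define s where "s = squarefree_part a"
    define u where "u = s * (square_part a * square_part b)"
    have abP: "(a, b) \<in> P" using x ab by simp
    have "a = s * square_part a ^ 2" "b = s * square_part b ^ 2" using parts[OF abP] by (simp_all only: s_def)
    then have "a * b = s * square_part a ^ 2 * (s * square_part b ^ 2)" by simp
    also have "\<dots> = u ^ 2" by (simp only: u_def power2_eq_square mult_ac)
    finally have u: "a * b = u ^ 2" .
    have "M ^ 2 \<le> u ^ 2" using abP unfolding u[symmetric] P_def by (auto simp: power2_eq_square intro!: mult_mono)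
    then have Mu: "M \<le> u" by (simp add: power2_nat_le_eq_le)
    have "real a * real b = (real u)\<^sup>2" using u by (metis of_nat_mult of_nat_power)
    then have "1 / (real a * real b) = h u / sqrt (real u)"
      by (simp add: h_def power2_eq_square)
    also have "\<dots> \<le> h u / sqrt (real M)" using Mu M h0 by (intro divide_left_mono) auto
    also have "h u = g (f x)" by (simp add: ab f_def g_def u_def s_def hmult)
    finally show ?thesis by (simp add: ab)
  qed
  have img: "f ` P \<subseteq> {1..N} \<times> {1..N} \<times> {1..N}"
  proof -
    have "1 \<le> squarefree_part a \<and> squarefree_part a \<le> N \<and> 1 \<le> square_part a \<and> square_part a \<le> N
       \<and> 1 \<le> square_part b \<and> square_part b \<le> N" if ab: "(a, b) \<in> P" for a b
    proof -
      have ab0: "0 < a" "a \<le> N" "0 < b" "b \<le> N" using ab M by (auto simp: P_def)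
      have *: "1 \<le> squarefree_part c \<and> squarefree_part c \<le> N \<and> 1 \<le> square_part c \<and> square_part c \<le> N"
        if c: "0 < c" "c \<le> N" for c :: nat
      proof -
        have "squarefree_part c dvd c" "square_part c dvd c"
          using dvdI[OF squarefree_decompose[of c]] dvd_trans[OF _ square_part_square_dvd[of c], of "square_part c"]
          by (simp_all add: power2_eq_square)
        then show ?thesis using c by (auto dest: dvd_imp_le dvd_pos_nat simp: Suc_le_eq)
      qed
      show ?thesis using *[OF ab0(1,2)] *[OF ab0(3,4)] by simp
    qed
    then show ?thesis by (auto simp: f_def)
  qed
  have "(\<Sum>x\<in>P. case x of (a, b) \<Rightarrow> 1 / (real a * real b)) \<le> (\<Sum>x\<in>P. g (f x) / sqrt (real M))"
    by (intro sum_mono le)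
  also have "\<dots> = (\<Sum>y\<in>f ` P. g y) / sqrt (real M)"
    by (simp add: sum_divide_distrib sum.reindex[OF inj])
  also have "(\<Sum>y\<in>f ` P. g y) \<le> (\<Sum>y\<in>{1..N} \<times> {1..N} \<times> {1..N}. g y)"
    by (intro sum_mono2 img) (auto simp: g_def h0)
  also have "\<dots> = (\<Sum>k=1..N. h k) * ((\<Sum>k=1..N. h k) * (\<Sum>k=1..N. h k))"
    by (simp only: g_def sum_product sum.cartesian_product case_prod_unfold)
  also have "\<dots> \<le> Z * (Z * Z)" using Z by (intro mult_mono sum_nonneg mult_nonneg_nonneg h0) auto
  also have "\<dots> = Z ^ 3" by (simp add: power3_eq_cube)
  finally have "(\<Sum>x\<in>P. case x of (a, b) \<Rightarrow> 1 / (real a * real b)) \<le> Z ^ 3 / sqrt (real M)"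
    by (simp add: divide_right_mono)
  then show ?thesis unfolding P_def Z_def .
qed

lemma sum_inverse_sqrt_le: "(\<Sum>k=1..N. 1 / sqrt (real k)) \<le> 2 * sqrt (real N)"
proof (induction N)
  case (Suc N)
  have "1 / sqrt (real (Suc N)) \<le> 2 * sqrt (real (Suc N)) - 2 * sqrt (real N)"
  proof -
    define x y where "x = sqrt (real (Suc N))" and "y = sqrt (real N)"
    have xy: "x\<^sup>2 = y\<^sup>2 + 1" "x > 0" "y \<ge> 0" "y \<le> x" by (auto simp: x_def y_def)
    have "2 * (x * y) \<le> x\<^sup>2 + y\<^sup>2" by (rule sum_squares_bound[of x y, simplified mult.assoc])
    then have "1 \<le> (2 * x - 2 * y) * x" using xy(1) by (simp add: power2_eq_square algebra_simps)
    then have "1 / x \<le> 2 * x - 2 * y" using xy(2) by (simp add: divide_le_eq)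
    then show ?thesis by (simp add: x_def y_def)
  qed
  then show ?case using Suc by simp
qed simp

text \<open>Expanding the square leaves the sums of \<open>w r * (a b / r)\<close> over \<open>r\<close>. The pairs with \<open>a * b\<close> a square
contribute at most the total weight times \<open>sum_square_pairs_le\<close>; the remaining pairs are controlled by
the assumed cancellation. The weight \<open>w\<close> is constant in the mean square of the middle part of the L-series
and a sieve weight in the application to primes; \<open>M\<close> supplies the saving in the former.\<close>

theorem jacobi_quadratic_form_le:
  fixes c :: "nat \<Rightarrow> real"
  assumes MN: "M \<ge> 1" "N \<ge> 1" and S: "finite S" "\<forall>r\<in>S. odd r \<and> w r \<ge> 0" and E: "E \<ge> 0"
    and c: "\<And>n. \<bar>c n\<bar> \<le> 1 / real n"
    and bd: "\<And>n. odd n \<Longrightarrow> \<nexists>k. n = k ^ 2 \<Longrightarrow>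
      \<bar>\<Sum>r\<in>S. w r * real_of_int (jacobi_symbol (int n) r)\<bar> \<le> E * (sqrt (real n) * (1 + ln (real n)))"
  shows "(\<Sum>r\<in>S. w r * (\<Sum>n | n \<in> {M..N} \<and> odd n. c n * real_of_int (jacobi_symbol (int n) r))\<^sup>2)
       \<le> zeta_three_halves ^ 3 * (\<Sum>r\<in>S. w r) / sqrt (real M) + 8 * E * real N * (1 + ln (real N))"
proof -
  define K where "K = zeta_three_halves ^ 3"
  note K = sum_square_pairs_le[folded K_def]
  define A where "A = {n. n \<in> {M..N} \<and> odd n}"
  define J where "J = (\<lambda>n r. real_of_int (jacobi_symbol (int n) r))"
  define sq where "sq = (\<lambda>(a::nat, b::nat). \<exists>k. a * b = k ^ 2)"
  define T where "T = (\<lambda>n. \<Sum>r\<in>S. w r * J n r)"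
  have finA: "finite A" unfolding A_def by simp
  have A0: "a \<ge> 1" "a \<le> N" "odd a" if "a \<in> A" for a using that MN by (auto simp: A_def)
  have cc: "\<bar>c a * c b\<bar> \<le> 1 / (real a * real b)" for a b
  proof -
    have "\<bar>c a\<bar> * \<bar>c b\<bar> \<le> (1 / real a) * (1 / real b)" using c by (intro mult_mono) auto
    then show ?thesis by (simp add: abs_mult)
  qed
  have Jmult: "J (a * b) r = J a r * J b r" if "r \<in> S" for a b r
    using S(2) that jacobi_mult_left[of r "int a" "int b"] by (simp add: J_def)
  have "(\<Sum>r\<in>S. w r * (\<Sum>n\<in>A. c n * J n r)\<^sup>2)
      = (\<Sum>r\<in>S. \<Sum>(a, b)\<in>A \<times> A. c a * c b * (w r * J (a * b) r))"
  proof (rule sum.cong[OF refl])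
    fix r assume r: "r \<in> S"
    have "w r * (\<Sum>n\<in>A. c n * J n r)\<^sup>2 = (\<Sum>(a, b)\<in>A \<times> A. w r * ((c a * J a r) * (c b * J b r)))"
      unfolding power2_eq_square sum_product sum.cartesian_product
      by (simp only: sum_distrib_left case_prod_unfold)
    also have "\<dots> = (\<Sum>(a, b)\<in>A \<times> A. c a * c b * (w r * J (a * b) r))"
      by (rule sum.cong[OF refl]) (simp add: Jmult[OF r] mult_ac case_prod_unfold)
    finally show "w r * (\<Sum>n\<in>A. c n * J n r)\<^sup>2 = (\<Sum>(a, b)\<in>A \<times> A. c a * c b * (w r * J (a * b) r))" .
  qed
  also have "\<dots> = (\<Sum>x\<in>A \<times> A. case x of (a, b) \<Rightarrow> c a * c b * T (a * b))"
    by (subst sum.swap) (simp add: T_def case_prod_unfold sum_distrib_left)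
  also have "\<dots> \<le> (\<Sum>x\<in>A \<times> A. case x of (a, b) \<Rightarrow>
      (if sq x then 1 / (real a * real b) * (\<Sum>r\<in>S. w r) else 0)
      + 1 / (real a * real b) * (E * (sqrt (real (a * b)) * (1 + ln (real (a * b))))))"
  proof (rule sum_mono)
    fix x assume x: "x \<in> A \<times> A"
    obtain a b where ab: "x = (a, b)" by fastforce
    have a: "a \<ge> 1" "odd a" and b: "b \<ge> 1" "odd b" using x ab A0 by auto
    have nn: "E * (sqrt (real (a * b)) * (1 + ln (real (a * b)))) \<ge> 0"
    proof -
      have "real (a * b) \<ge> 1" using a b by (metis One_nat_def Suc_le_eq nat_0_less_mult_iff of_nat_1 of_nat_le_iff)
      then have "ln (real (a * b)) \<ge> 0" by simp
      then show ?thesis using E by (intro mult_nonneg_nonneg) auto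
    qed
    have "c a * c b * T (a * b) \<le> 1 / (real a * real b) * \<bar>T (a * b)\<bar>"
      using mult_right_mono[OF cc[of a b], of "\<bar>T (a * b)\<bar>"] abs_ge_self[of "c a * c b * T (a * b)"]
      by (simp add: abs_mult)
    moreover have "\<bar>T (a * b)\<bar> \<le> (if sq x then \<Sum>r\<in>S. w r else 0) + E * (sqrt (real (a * b)) * (1 + ln (real (a * b))))"
    proof (cases "sq x")
      case True
      have "\<bar>T (a * b)\<bar> \<le> (\<Sum>r\<in>S. w r)" unfolding T_def
      proof (intro order.trans[OF sum_abs] sum_mono)
        fix r assume "r \<in> S"
        then have "w r \<ge> 0" using S by auto
        then show "\<bar>w r * J (a * b) r\<bar> \<le> w r"
          using abs_jacobi_le_real[of "int (a * b)" r] by (simp add: abs_mult J_def mult_left_le)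
      qed
      then show ?thesis using True nn by simp
    next
      case False
      then show ?thesis using bd a b by (simp add: ab sq_def T_def J_def del: of_nat_mult)
    qed
    ultimately have "c a * c b * T (a * b) \<le> 1 / (real a * real b) *
        ((if sq x then \<Sum>r\<in>S. w r else 0) + E * (sqrt (real (a * b)) * (1 + ln (real (a * b)))))"
      by (rule order.trans[OF _ mult_left_mono]) simp
    then show "(case x of (a, b) \<Rightarrow> c a * c b * T (a * b)) \<le> (case x of (a, b) \<Rightarrow>
      (if sq x then 1 / (real a * real b) * (\<Sum>r\<in>S. w r) else 0)
      + 1 / (real a * real b) * (E * (sqrt (real (a * b)) * (1 + ln (real (a * b))))))"
      by (simp add: ab distrib_left split: if_splits)
  qed
  also have "\<dots> = (\<Sum>x\<in>A \<times> A. if sq x then (case x of (a, b) \<Rightarrow> 1 / (real a * real b) * (\<Sum>r\<in>S. w r)) else 0)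
      + (\<Sum>x\<in>A \<times> A. case x of (a, b) \<Rightarrow> 1 / (real a * real b) * (E * (sqrt (real (a * b)) * (1 + ln (real (a * b))))))"
    by (subst sum.distrib[symmetric]) (auto intro!: sum.cong)
  finally have total: "(\<Sum>r\<in>S. w r * (\<Sum>n\<in>A. c n * J n r)\<^sup>2) \<le> \<dots>" .
  have "(\<Sum>x\<in>A \<times> A. if sq x then (case x of (a, b) \<Rightarrow> 1 / (real a * real b) * (\<Sum>r\<in>S. w r)) else 0)
      = (\<Sum>x\<in>{x\<in>A \<times> A. sq x}. case x of (a, b) \<Rightarrow> 1 / (real a * real b)) * (\<Sum>r\<in>S. w r)"
    using finA by (subst sum.inter_filter[symmetric]) (auto simp: sum_distrib_right intro!: sum.cong)
  also have "\<dots> \<le> K / sqrt (real M) * (\<Sum>r\<in>S. w r)"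
  proof (rule mult_right_mono)
    have "(\<Sum>x\<in>{x\<in>A \<times> A. sq x}. case x of (a, b) \<Rightarrow> 1 / (real a * real b))
      \<le> (\<Sum>x\<in>{(a, b). a \<in> {M..N} \<and> b \<in> {M..N} \<and> (\<exists>k. a * b = k ^ 2)}. case x of (a, b) \<Rightarrow> 1 / (real a * real b))"
      by (rule sum_mono2) (auto simp: A_def sq_def intro: finite_subset[of _ "{M..N} \<times> {M..N}"])
    then show "(\<Sum>x\<in>{x\<in>A \<times> A. sq x}. case x of (a, b) \<Rightarrow> 1 / (real a * real b)) \<le> K / sqrt (real M)"
      using K[OF MN(1), of N] by linarith
    show "0 \<le> (\<Sum>r\<in>S. w r)" using S by (intro sum_nonneg) auto
  qed
  finally have diag: "(\<Sum>x\<in>A \<times> A. if sq x then (case x of (a, b) \<Rightarrow> 1 / (real a * real b) * (\<Sum>r\<in>S. w r)) else 0)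
      \<le> K / sqrt (real M) * (\<Sum>r\<in>S. w r)" .
  have "(\<Sum>x\<in>A \<times> A. case x of (a, b) \<Rightarrow> 1 / (real a * real b) * (E * (sqrt (real (a * b)) * (1 + ln (real (a * b))))))
      \<le> (\<Sum>x\<in>A \<times> A. case x of (a, b) \<Rightarrow> (1 / sqrt (real a) * (1 / sqrt (real b))) * (E * (2 * (1 + ln (real N)))))"
  proof (rule sum_mono)
    fix x assume x: "x \<in> A \<times> A"
    obtain a b where ab: "x = (a, b)" by fastforce
    have a: "a \<ge> 1" "a \<le> N" and b: "b \<ge> 1" "b \<le> N" using x ab A0 by auto
    have "1 / (real a * real b) * (E * (sqrt (real (a * b)) * (1 + ln (real (a * b)))))
      = (sqrt (real a) / real a) * (sqrt (real b) / real b) * (E * (1 + ln (real a * real b)))"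
      by (simp add: real_sqrt_mult)
    also have "sqrt (real a) / real a = 1 / sqrt (real a)" using a by (simp add: real_div_sqrt field_simps)
    also have "sqrt (real b) / real b = 1 / sqrt (real b)" using b by (simp add: real_div_sqrt field_simps)
    also have "1 / sqrt (real a) * (1 / sqrt (real b)) * (E * (1 + ln (real a * real b)))
        \<le> 1 / sqrt (real a) * (1 / sqrt (real b)) * (E * (2 * (1 + ln (real N))))"
    proof (intro mult_left_mono E)
      have arith: "1 + (x + y) \<le> 2 * (1 + z)" if "x \<le> z" "y \<le> z" for x y z :: real
        using that by simp
      have "ln (real a * real b) = ln (real a) + ln (real b)" using a b by (simp add: ln_mult)
      then show "1 + ln (real a * real b) \<le> 2 * (1 + ln (real N))"
        using arith[of "ln (real a)" "ln (real N)" "ln (real b)"] a b by simp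
    qed auto
    finally show "(case x of (a, b) \<Rightarrow> 1 / (real a * real b) * (E * (sqrt (real (a * b)) * (1 + ln (real (a * b))))))
      \<le> (case x of (a, b) \<Rightarrow> (1 / sqrt (real a) * (1 / sqrt (real b))) * (E * (2 * (1 + ln (real N)))))"
      by (simp only: ab prod.case)
  qed
  also have "\<dots> = (\<Sum>a\<in>A. 1 / sqrt (real a)) * (\<Sum>a\<in>A. 1 / sqrt (real a)) * (E * (2 * (1 + ln (real N))))"
    unfolding sum_product sum.cartesian_product
    by (simp only: sum_distrib_right case_prod_unfold)
  also have "\<dots> \<le> (2 * sqrt (real N)) * (2 * sqrt (real N)) * (E * (2 * (1 + ln (real N))))"
  proof -
    have "(\<Sum>a\<in>A. 1 / sqrt (real a)) \<le> (\<Sum>a=1..N. 1 / sqrt (real a))"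
      using A0 by (intro sum_mono2) auto
    then have "(\<Sum>a\<in>A. 1 / sqrt (real a)) \<le> 2 * sqrt (real N)" using sum_inverse_sqrt_le[of N] by linarith
    moreover have "0 \<le> (\<Sum>a\<in>A. 1 / sqrt (real a))" by (intro sum_nonneg) auto
    ultimately show ?thesis using E MN by (intro mult_right_mono mult_mono mult_nonneg_nonneg) auto
  qed
  also have "\<dots> = 8 * E * real N * (1 + ln (real N))" by simp
  finally have off: "(\<Sum>x\<in>A \<times> A. case x of (a, b) \<Rightarrow> 1 / (real a * real b) * (E * (sqrt (real (a * b)) * (1 + ln (real (a * b))))))
      \<le> 8 * E * real N * (1 + ln (real N))" .
  from total diag off have "(\<Sum>r\<in>S. w r * (\<Sum>n\<in>A. c n * J n r)\<^sup>2)
      \<le> K * (\<Sum>r\<in>S. w r) / sqrt (real M) + 8 * E * real N * (1 + ln (real N))" by simp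
  then show ?thesis by (simp only: A_def J_def K_def)
qed

section \<open>Selberg weights\<close>

lemma moebius_mu_1 [simp]: "moebius_mu (Suc 0) = 1" "moebius_mu 1 = 1"
  by (simp_all add: moebius_mu_def)

lemma abs_moebius_mu_le: "\<bar>real_of_int (moebius_mu d)\<bar> \<le> 1"
  by (simp add: moebius_mu_def power_abs)

lemma moebius_mu_mult_coprime:
  assumes "coprime a b"
  shows "moebius_mu (a * b) = moebius_mu a * moebius_mu b"
proof (cases "squarefree a \<and> squarefree b")
  case True
  then have ab: "a \<noteq> 0" "b \<noteq> 0" by (metis not_squarefree_0)+
  have "prime_factors a \<inter> prime_factors b = {}"
  proof (rule ccontr)
    assume "prime_factors a \<inter> prime_factors b \<noteq> {}"
    then obtain p where "prime p" "p dvd a" "p dvd b" by auto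
    then show False using assms coprime_common_divisor[of a b p] not_prime_unit[of p] by blast
  qed
  then have "card (prime_factors (a * b)) = card (prime_factors a) + card (prime_factors b)"
    using ab by (simp add: prime_factors_product card_Un_disjoint)
  then show ?thesis using True assms by (simp add: moebius_mu_def squarefree_mult_coprime power_add)
next
  case False
  then have "\<not> squarefree (a * b)" using squarefree_multD by blast
  then show ?thesis using False by (auto simp: moebius_mu_def)
qed

text \<open>For a prime \<open>p\<close> dividing \<open>u\<close>, the divisors \<open>v\<close> prime to \<open>p\<close> cancel against the divisors \<open>p * v\<close>.\<close>

lemma sum_moebius_mu_divisors:
  assumes "squarefree u" "u \<noteq> 1"
  shows "(\<Sum>v | v dvd u. moebius_mu v) = 0"
proof -
  obtain p where p: "prime p" "p dvd u" using assms(2) prime_factor_nat by blast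
  then obtain w where w: "u = p * w" by blast
  have u0: "u > 0" using assms(1) by (intro Nat.gr0I notI) simp
  then have w0: "w > 0" "p > 0" using w by auto
  have npw: "\<not> p dvd w"
  proof
    assume "p dvd w"
    then have "p ^ 2 dvd u" by (simp add: w power2_eq_square)
    then show False using squarefreeD[OF assms(1)] not_prime_unit[of p] p(1) by blast
  qed
  have split: "{v. v dvd u} = {v. v dvd w} \<union> (\<lambda>v. p * v) ` {v. v dvd w}"
  proof (intro equalityI subsetI)
    fix v assume v: "v \<in> {v. v dvd u}"
    show "v \<in> {v. v dvd w} \<union> (\<lambda>v. p * v) ` {v. v dvd w}"
    proof (cases "p dvd v")
      case True
      then obtain k where "v = p * k" by blast
      then show ?thesis using v w w0 by auto
    next
      case False
      then have "coprime v p" using prime_imp_coprime[OF p(1) False] by (simp only: coprime_commute)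
      then have "v dvd w" using v w by (simp add: coprime_dvd_mult_right_iff)
      then show ?thesis by simp
    qed
  qed (auto simp: w)
  have neg: "moebius_mu (p * v) = - moebius_mu v" if "v dvd w" for v
  proof -
    have "\<not> p dvd v" using npw that dvd_trans by blast
    then have "coprime p v" using prime_imp_coprime[OF p(1)] by simp
    moreover have "moebius_mu p = -1"
      using p(1) by (simp add: moebius_mu_def squarefree_prime prime_factorization_prime)
    ultimately show ?thesis by (simp add: moebius_mu_mult_coprime)
  qed
  have "(\<Sum>v | v dvd u. moebius_mu v) = (\<Sum>v | v dvd w. moebius_mu v) + (\<Sum>v\<in>(\<lambda>v. p * v) ` {v. v dvd w}. moebius_mu v)"
    unfolding split using w0 npw by (intro sum.union_disjoint) (auto dest: dvd_mult_left)
  also have "(\<Sum>v\<in>(\<lambda>v. p * v) ` {v. v dvd w}. moebius_mu v) = (\<Sum>v | v dvd w. - moebius_mu v)"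
    using w0 by (subst sum.reindex) (auto simp: inj_on_def neg)
  finally show ?thesis by (simp add: sum_negf)
qed

lemma sum_moebius_mu_between:
  assumes "squarefree t" "\<delta> > 0"
  shows "(\<Sum>d | \<delta> dvd d \<and> d dvd t. moebius_mu d) = (if t = \<delta> then moebius_mu \<delta> else 0)"
proof (cases "\<delta> dvd t")
  case False
  then have "{d. \<delta> dvd d \<and> d dvd t} = {}" using dvd_trans by blast
  moreover have "t \<noteq> \<delta>" using False by auto
  ultimately show ?thesis by (simp only: sum.empty if_False)
next
  case True
  then obtain u where u: "t = \<delta> * u" by blast
  have squ: "squarefree u" using assms(1) u squarefree_multD by blast
  have cop: "coprime \<delta> v" if "v dvd u" for v
  proof (rule coprimeI)
    fix c assume "c dvd \<delta>" "c dvd v"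
    then have "c ^ 2 dvd t" using that unfolding u power2_eq_square by (meson mult_dvd_mono dvd_trans)
    then show "is_unit c" using squarefreeD[OF assms(1)] by blast
  qed
  have "{d. \<delta> dvd d \<and> d dvd t} = (\<lambda>v. \<delta> * v) ` {v. v dvd u}"
    using assms(2) by (auto simp: u)
  then have "(\<Sum>d | \<delta> dvd d \<and> d dvd t. moebius_mu d) = (\<Sum>v | v dvd u. moebius_mu (\<delta> * v))"
    using assms(2) by (simp add: sum.reindex inj_on_def)
  also have "\<dots> = moebius_mu \<delta> * (\<Sum>v | v dvd u. moebius_mu v)"
    unfolding sum_distrib_left by (intro sum.cong refl moebius_mu_mult_coprime cop) auto
  also have "\<dots> = (if t = \<delta> then moebius_mu \<delta> else 0)"
  proof (cases "u = 1")
    case False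
    then show ?thesis using sum_moebius_mu_divisors[OF squ False] assms(2) u by simp
  qed (simp add: u)
  finally show ?thesis .
qed

text \<open>The normalising sum of the sieve. Selberg's optimal choice has \<open>totient t\<close> in place of \<open>t\<close>; with \<open>t\<close> itself
the weights below are trivially bounded by 1 and only a constant factor is lost.\<close>

definition sieve_mass :: "nat \<Rightarrow> real" where
  "sieve_mass D = (\<Sum>t | t \<in> {1..D} \<and> squarefree t. 1 / real t)"

text \<open>The solution of the linear system in \<open>selberg_weight_diagonal\<close>, obtained by Moebius inversion over multiples.\<close>

definition selberg_weight :: "nat \<Rightarrow> nat \<Rightarrow> real" where
  "selberg_weight D d =
     real_of_int (moebius_mu d) * real d * (\<Sum>t | t \<in> {1..D} \<and> squarefree t \<and> d dvd t. 1 / real t) / sieve_mass D"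

text \<open>Every \<open>k\<close> is \<open>s b^2\<close> with \<open>s\<close> squarefree, and the sum of \<open>1 / b^2\<close> is at most 2.\<close>

lemma sieve_mass_ge_ln: "sieve_mass D \<ge> ln (real D + 1) / 2"
proof -
  let ?S = "{t \<in> {1..D}. squarefree t}"
  define f where "f = (\<lambda>k::nat. (squarefree_part k, square_part k))"
  define g where "g = (\<lambda>(s::nat, b::nat). 1 / real s * (1 / (real b)\<^sup>2))"
  have inj: "inj_on f {1..D}"
    by (rule inj_onI) (auto simp: f_def intro: squarefree_decomposition_unique)
  have img: "f ` {1..D} \<subseteq> ?S \<times> {1..D}"
  proof
    fix x assume "x \<in> f ` {1..D}"
    then obtain k where k: "k \<in> {1..D}" "x = (squarefree_part k, square_part k)" by (auto simp: f_def)
    have "squarefree_part k dvd k" "square_part k dvd k"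
      using dvdI[OF squarefree_decompose[of k]] dvd_trans[OF _ square_part_square_dvd[of k], of "square_part k"]
      by (simp_all add: power2_eq_square)
    then have "squarefree_part k \<in> {1..D}" "square_part k \<in> {1..D}"
      using k(1) by (auto dest: dvd_imp_le dvd_pos_nat simp: Suc_le_eq)
    then show "x \<in> ?S \<times> {1..D}" using k(2) by auto
  qed
  have "(\<Sum>k=1..D. 1 / real k) = (\<Sum>k=1..D. g (f k))"
  proof (rule sum.cong[OF refl])
    fix k :: nat
    have "real k = real (squarefree_part k) * (real (square_part k))\<^sup>2"
      using squarefree_decompose[of k] by (metis of_nat_mult of_nat_power)
    then show "1 / real k = g (f k)" by (simp add: f_def g_def)
  qed
  also have "\<dots> = (\<Sum>x\<in>f ` {1..D}. g x)" using inj by (simp add: sum.reindex)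
  also have "\<dots> \<le> (\<Sum>x\<in>?S \<times> {1..D}. g x)"
    by (intro sum_mono2 img) (auto simp: g_def)
  also have "\<dots> = sieve_mass D * (\<Sum>b=1..D. 1 / (real b)\<^sup>2)"
    unfolding sieve_mass_def g_def sum_product sum.cartesian_product by (simp add: conj_commute)
  also have "\<dots> \<le> sieve_mass D * 2"
  proof (rule mult_left_mono)
    have "(\<Sum>b=1..n. 1 / (real b)\<^sup>2) \<le> 2 - 1 / real n" if "n \<ge> 1" for n
      using that
    proof (induction n rule: dec_induct)
      case (step n)
      have "1 / (real (Suc n))\<^sup>2 \<le> 1 / (real n * real (Suc n))"
        using step by (intro divide_left_mono) (auto simp: power2_eq_square)
      also have "\<dots> = 1 / real n - 1 / real (Suc n)" using step by (simp add: field_simps)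
      finally show ?case using step by simp
    qed simp
    then show "(\<Sum>b=1..D. 1 / (real b)\<^sup>2) \<le> 2"
      by (cases "D \<ge> 1") (smt (verit) divide_nonneg_nonneg of_nat_0_le_iff, simp)
    show "0 \<le> sieve_mass D" unfolding sieve_mass_def by (intro sum_nonneg) auto
  qed
  finally have "harm D \<le> sieve_mass D * 2" by (simp add: harm_def inverse_eq_divide)
  then show ?thesis using ln_le_harm[of D] by simp
qed

lemma sieve_mass_pos: "D \<ge> 1 \<Longrightarrow> sieve_mass D > 0"
  using sieve_mass_ge_ln[of D] by (smt (verit) divide_pos_pos ln_gt_zero of_nat_1 of_nat_le_iff)

lemma selberg_weight_1: "D \<ge> 1 \<Longrightarrow> selberg_weight D 1 = 1"
  using sieve_mass_pos[of D] by (simp add: selberg_weight_def sieve_mass_def)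

text \<open>Up to sign and the normalisation, the weight is the sum of \<open>1 / (t div d)\<close> over multiples \<open>t\<close> of \<open>d\<close>, which is part of
the sum defining \<open>sieve_mass\<close>.\<close>

lemma abs_selberg_weight_le:
  assumes "D \<ge> 1"
  shows "\<bar>selberg_weight D d\<bar> \<le> 1"
proof (cases "d > 0")
  case True
  let ?A = "{t. t \<in> {1..D} \<and> squarefree t \<and> d dvd t}"
  have "real d * (\<Sum>t\<in>?A. 1 / real t) = (\<Sum>t\<in>?A. 1 / real (t div d))"
    unfolding sum_distrib_left by (intro sum.cong refl) (auto simp: real_of_nat_div)
  also have "\<dots> = (\<Sum>e\<in>(\<lambda>t. t div d) ` ?A. 1 / real e)"
    by (subst sum.reindex) (auto simp: inj_on_def)
  also have "\<dots> \<le> sieve_mass D"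
    unfolding sieve_mass_def
  proof (rule sum_mono2)
    show "(\<lambda>t. t div d) ` ?A \<subseteq> {t. t \<in> {1..D} \<and> squarefree t}"
    proof safe
      fix t assume t: "t \<in> {1..D}" "squarefree t" "d dvd t"
      then obtain k where k: "t = d * k" by blast
      have "t div d = k" using k True by simp
      moreover have "k dvd t" "k > 0" "t > 0" using k t by auto
      moreover from this have "k \<le> t" by (auto dest: dvd_imp_le)
      ultimately show "t div d \<in> {1..D}" "squarefree (t div d)"
        using t squarefree_mono[of k t] by (auto dest: dvd_imp_le)
    qed
  qed auto
  finally have le: "real d * (\<Sum>t\<in>?A. 1 / real t) \<le> sieve_mass D" .
  have nn: "0 \<le> real d * (\<Sum>t\<in>?A. 1 / real t)" by (intro mult_nonneg_nonneg sum_nonneg) auto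
  have "\<bar>selberg_weight D d\<bar> = \<bar>real_of_int (moebius_mu d)\<bar> * ((real d * (\<Sum>t\<in>?A. 1 / real t)) / sieve_mass D)"
    using nn sieve_mass_pos[OF assms] unfolding selberg_weight_def
    by (simp add: abs_mult mult.assoc abs_of_nonneg sum_nonneg)
  also have "\<dots> \<le> 1 * 1"
    using le nn sieve_mass_pos[OF assms] abs_moebius_mu_le by (intro mult_mono) (auto simp: divide_le_eq_1)
  finally show ?thesis by simp
qed (simp add: selberg_weight_def)

text \<open>Interchanging the two summations leaves, for each \<open>t\<close>, the sum of the Moebius function between \<open>\<delta>\<close> and \<open>t\<close> in the
divisor lattice, which is zero unless \<open>t = \<delta>\<close>.\<close>

lemma selberg_weight_diagonal:
  assumes "D \<ge> 1" "\<delta> \<in> {1..D}"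
  shows "(\<Sum>d | d \<in> {1..D} \<and> \<delta> dvd d. selberg_weight D d / real d)
           = (if squarefree \<delta> then real_of_int (moebius_mu \<delta>) / (real \<delta> * sieve_mass D) else 0)"
proof -
  let ?S = "{t. t \<in> {1..D} \<and> squarefree t}"
  let ?A = "{d. d \<in> {1..D} \<and> \<delta> dvd d}"
  have "(\<Sum>d\<in>?A. selberg_weight D d / real d)
      = (\<Sum>d\<in>?A. \<Sum>t\<in>?S. if d dvd t then real_of_int (moebius_mu d) * (1 / real t) / sieve_mass D else 0)"
  proof (rule sum.cong[OF refl])
    fix d assume d: "d \<in> ?A"
    have "selberg_weight D d / real d = real_of_int (moebius_mu d) * (\<Sum>t | t \<in> ?S \<and> d dvd t. 1 / real t) / sieve_mass D"
      using d by (simp add: selberg_weight_def)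
    also have "\<dots> = (\<Sum>t | t \<in> ?S \<and> d dvd t. real_of_int (moebius_mu d) * (1 / real t) / sieve_mass D)"
      by (simp only: sum_distrib_left sum_divide_distrib)
    also have "\<dots> = (\<Sum>t\<in>?S. if d dvd t then real_of_int (moebius_mu d) * (1 / real t) / sieve_mass D else 0)"
      by (rule sum.inter_filter) simp
    finally show "selberg_weight D d / real d = (\<Sum>t\<in>?S. if d dvd t then real_of_int (moebius_mu d) * (1 / real t) / sieve_mass D else 0)" .
  qed
  also have "\<dots> = (\<Sum>t\<in>?S. \<Sum>d\<in>?A. if d dvd t then real_of_int (moebius_mu d) * (1 / real t) / sieve_mass D else 0)"
    by (rule sum.swap)
  also have "\<dots> = (\<Sum>t\<in>?S. if t = \<delta> then real_of_int (moebius_mu \<delta>) / (real \<delta> * sieve_mass D) else 0)"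
  proof (rule sum.cong[OF refl])
    fix t assume t: "t \<in> ?S"
    have "(\<Sum>d\<in>?A. if d dvd t then real_of_int (moebius_mu d) * (1 / real t) / sieve_mass D else 0)
        = (\<Sum>d | d \<in> ?A \<and> d dvd t. real_of_int (moebius_mu d) * (1 / real t) / sieve_mass D)"
      by (rule sum.inter_filter[symmetric]) simp
    also have "{d. d \<in> ?A \<and> d dvd t} = {d. \<delta> dvd d \<and> d dvd t}"
      using t by (auto dest: dvd_imp_le dvd_pos_nat simp: Suc_le_eq)
    also have "(\<Sum>d | \<delta> dvd d \<and> d dvd t. real_of_int (moebius_mu d) * (1 / real t) / sieve_mass D)
        = real_of_int (\<Sum>d | \<delta> dvd d \<and> d dvd t. moebius_mu d) * (1 / real t) / sieve_mass D"
      by (simp only: sum_distrib_right sum_divide_distrib of_int_sum)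
    also have "\<dots> = (if t = \<delta> then real_of_int (moebius_mu \<delta>) / (real \<delta> * sieve_mass D) else 0)"
      using t assms(2) by (subst sum_moebius_mu_between) auto
    finally show "(\<Sum>d\<in>?A. if d dvd t then real_of_int (moebius_mu d) * (1 / real t) / sieve_mass D else 0)
        = (if t = \<delta> then real_of_int (moebius_mu \<delta>) / (real \<delta> * sieve_mass D) else 0)" .
  qed
  also have "\<dots> = (if squarefree \<delta> then real_of_int (moebius_mu \<delta>) / (real \<delta> * sieve_mass D) else 0)"
    using assms(2) by (simp add: sum.delta')
  finally show ?thesis .
qed

text \<open>As \<open>lcm d e = d e / gcd d e\<close> and \<open>gcd d e\<close> is the sum of \<open>totient \<delta>\<close> over common divisors \<open>\<delta>\<close>, the form is diagonal
in the quantities of \<open>selberg_weight_diagonal\<close>, and \<open>totient \<delta> <= \<delta>\<close> bounds it.\<close>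

lemma selberg_quadratic_form_le:
  assumes D: "D \<ge> 1"
  shows "(\<Sum>d\<in>{1..D}. \<Sum>e\<in>{1..D}. selberg_weight D d * selberg_weight D e / real (lcm d e)) \<le> 1 / sieve_mass D"
proof -
  let ?I = "{1..D}"
  let ?\<rho> = "selberg_weight D"
  define y where "y = (\<lambda>\<delta>. \<Sum>d | d \<in> ?I \<and> \<delta> dvd d. ?\<rho> d / real d)"
  have "(\<Sum>d\<in>?I. \<Sum>e\<in>?I. ?\<rho> d * ?\<rho> e / real (lcm d e))
      = (\<Sum>d\<in>?I. \<Sum>e\<in>?I. \<Sum>\<delta>\<in>?I. real (totient \<delta>) *
           ((if \<delta> dvd d then ?\<rho> d / real d else 0) * (if \<delta> dvd e then ?\<rho> e / real e else 0)))"
  proof (intro sum.cong refl)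
    fix d e assume de: "d \<in> ?I" "e \<in> ?I"
    have lg: "real (lcm d e) * real (gcd d e) = real d * real e"
      by (metis of_nat_mult prod_gcd_lcm_nat mult.commute)
    have "gcd d e > 0" "lcm d e > 0" using de by (auto simp: lcm_pos_nat)
    then have "1 / real (lcm d e) = real (gcd d e) / (real d * real e)"
      using lg[symmetric] by (simp add: field_simps)
    then have "?\<rho> d * ?\<rho> e / real (lcm d e) = real (gcd d e) * (?\<rho> d / real d * (?\<rho> e / real e))"
      by (metis (no_types, lifting) times_divide_eq_right times_divide_times_eq mult.commute mult.right_neutral)
    also have "real (gcd d e) = (\<Sum>\<delta> | \<delta> dvd gcd d e. real (totient \<delta>))"
      using totient_divisor_sum[of "gcd d e"] by (metis of_nat_sum)
    also have "{\<delta>. \<delta> dvd gcd d e} = {\<delta>\<in>?I. \<delta> dvd d \<and> \<delta> dvd e}"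
      using de by (auto dest: dvd_imp_le dvd_pos_nat simp: Suc_le_eq)
    also have "(\<Sum>\<delta>\<in>{\<delta>\<in>?I. \<delta> dvd d \<and> \<delta> dvd e}. real (totient \<delta>)) * (?\<rho> d / real d * (?\<rho> e / real e))
        = (\<Sum>\<delta>\<in>?I. if \<delta> dvd d \<and> \<delta> dvd e then real (totient \<delta>) * (?\<rho> d / real d * (?\<rho> e / real e)) else 0)"
      by (simp only: sum_distrib_right) (rule sum.inter_filter, simp)
    also have "\<dots> = (\<Sum>\<delta>\<in>?I. real (totient \<delta>) *
           ((if \<delta> dvd d then ?\<rho> d / real d else 0) * (if \<delta> dvd e then ?\<rho> e / real e else 0)))"
      by (intro sum.cong refl) auto
    finally show "?\<rho> d * ?\<rho> e / real (lcm d e) = \<dots>" .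
  qed
  also have "\<dots> = (\<Sum>d\<in>?I. \<Sum>\<delta>\<in>?I. \<Sum>e\<in>?I. real (totient \<delta>) *
           ((if \<delta> dvd d then ?\<rho> d / real d else 0) * (if \<delta> dvd e then ?\<rho> e / real e else 0)))"
    by (intro sum.cong refl sum.swap)
  also have "\<dots> = (\<Sum>\<delta>\<in>?I. \<Sum>d\<in>?I. \<Sum>e\<in>?I. real (totient \<delta>) *
           ((if \<delta> dvd d then ?\<rho> d / real d else 0) * (if \<delta> dvd e then ?\<rho> e / real e else 0)))"
    by (rule sum.swap)
  also have "\<dots> = (\<Sum>\<delta>\<in>?I. real (totient \<delta>) * (y \<delta> * y \<delta>))"
  proof (intro sum.cong refl)
    fix \<delta>
    have y: "y \<delta> = (\<Sum>d\<in>?I. if \<delta> dvd d then ?\<rho> d / real d else 0)"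
      unfolding y_def using sum.inter_filter[of ?I "\<lambda>d. ?\<rho> d / real d" "\<lambda>d. \<delta> dvd d"] by simp
    show "(\<Sum>d\<in>?I. \<Sum>e\<in>?I. real (totient \<delta>) *
           ((if \<delta> dvd d then ?\<rho> d / real d else 0) * (if \<delta> dvd e then ?\<rho> e / real e else 0)))
        = real (totient \<delta>) * (y \<delta> * y \<delta>)"
      unfolding y sum_product by (simp only: sum_distrib_left)
  qed
  also have "\<dots> \<le> (\<Sum>\<delta>\<in>?I. if squarefree \<delta> then 1 / real \<delta> * (1 / (sieve_mass D)\<^sup>2) else 0)"
  proof (rule sum_mono)
    fix \<delta> assume \<delta>: "\<delta> \<in> ?I"
    show "real (totient \<delta>) * (y \<delta> * y \<delta>) \<le> (if squarefree \<delta> then 1 / real \<delta> * (1 / (sieve_mass D)\<^sup>2) else 0)"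
    proof (cases "squarefree \<delta>")
      case True
      have "real_of_int (moebius_mu \<delta>) * real_of_int (moebius_mu \<delta>) = 1"
        using True by (simp add: moebius_mu_def flip: power_add)
      then have "y \<delta> * y \<delta> = 1 / ((real \<delta> * sieve_mass D) * (real \<delta> * sieve_mass D))"
        using selberg_weight_diagonal[OF D \<delta>] True by (simp add: y_def)
      then have "real (totient \<delta>) * (y \<delta> * y \<delta>) \<le> real \<delta> * (1 / ((real \<delta> * sieve_mass D) * (real \<delta> * sieve_mass D)))"
        using totient_le[of \<delta>] by (simp only:) (intro mult_right_mono, auto)
      also have "\<dots> = 1 / real \<delta> * (1 / (sieve_mass D)\<^sup>2)"
        using \<delta> by (simp add: power2_eq_square)
      finally show ?thesis using True by simp
    next
      case False
      then have "y \<delta> = 0" using selberg_weight_diagonal[OF D \<delta>] by (simp add: y_def)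
      then show ?thesis using False by simp
    qed
  qed
  also have "\<dots> = (\<Sum>\<delta> | \<delta> \<in> ?I \<and> squarefree \<delta>. 1 / real \<delta> * (1 / (sieve_mass D)\<^sup>2))"
    using sum.inter_filter[of ?I "\<lambda>\<delta>. 1 / real \<delta> * (1 / (sieve_mass D)\<^sup>2)" squarefree] by simp
  also have "\<dots> = sieve_mass D * (1 / (sieve_mass D)\<^sup>2)"
    by (simp only: sum_distrib_right[symmetric] sieve_mass_def)
  also have "\<dots> = 1 / sieve_mass D" using sieve_mass_pos[OF D] by (simp add: power2_eq_square)
  finally show ?thesis .
qed

section \<open>Short character sums at primes\<close>

text \<open>A nonnegative function that is 1 at the primes beyond the sieving range. As a square of a divisor sum it
reduces to sums over multiples of least common multiples.\<close>

definition selberg_majorant :: "nat \<Rightarrow> nat \<Rightarrow> real" where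
  "selberg_majorant D r = (\<Sum>d | d \<in> {1..D} \<and> d dvd r. selberg_weight D d)\<^sup>2"

lemma selberg_majorant_nonneg: "selberg_majorant D r \<ge> 0"
  by (simp add: selberg_majorant_def)

lemma selberg_majorant_prime:
  assumes "D \<ge> 1" "prime p" "p > D"
  shows "selberg_majorant D p = 1"
proof -
  have "{d. d \<in> {1..D} \<and> d dvd p} = {1}"
    using assms by (auto simp: prime_nat_iff)
  then show ?thesis using selberg_weight_1[OF assms(1)] by (simp add: selberg_majorant_def)
qed

lemma sum_selberg_majorant:
  fixes h :: "nat \<Rightarrow> real"
  assumes "finite S"
  shows "(\<Sum>r\<in>S. selberg_majorant D r * h r)
    = (\<Sum>d\<in>{1..D}. \<Sum>e\<in>{1..D}. selberg_weight D d * selberg_weight D e * (\<Sum>r | r \<in> S \<and> lcm d e dvd r. h r))"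
proof -
  let ?I = "{1..D}"
  let ?\<rho> = "selberg_weight D"
  have "(\<Sum>r\<in>S. selberg_majorant D r * h r)
      = (\<Sum>r\<in>S. \<Sum>d\<in>?I. \<Sum>e\<in>?I. ?\<rho> d * ?\<rho> e * (if lcm d e dvd r then h r else 0))"
  proof (rule sum.cong[OF refl])
    fix r
    have s: "(\<Sum>d | d \<in> ?I \<and> d dvd r. ?\<rho> d) = (\<Sum>d\<in>?I. if d dvd r then ?\<rho> d else 0)"
      by (rule sum.inter_filter) simp
    have "selberg_majorant D r * h r = (\<Sum>d\<in>?I. \<Sum>e\<in>?I.
        (if d dvd r then ?\<rho> d else 0) * (if e dvd r then ?\<rho> e else 0) * h r)"
      unfolding selberg_majorant_def s power2_eq_square sum_product by (simp only: sum_distrib_right)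
    also have "\<dots> = (\<Sum>d\<in>?I. \<Sum>e\<in>?I. ?\<rho> d * ?\<rho> e * (if lcm d e dvd r then h r else 0))"
      by (intro sum.cong refl) auto
    finally show "selberg_majorant D r * h r = \<dots>" .
  qed
  also have "\<dots> = (\<Sum>d\<in>?I. \<Sum>r\<in>S. \<Sum>e\<in>?I. ?\<rho> d * ?\<rho> e * (if lcm d e dvd r then h r else 0))"
    by (rule sum.swap)
  also have "\<dots> = (\<Sum>d\<in>?I. \<Sum>e\<in>?I. \<Sum>r\<in>S. ?\<rho> d * ?\<rho> e * (if lcm d e dvd r then h r else 0))"
    by (intro sum.cong refl sum.swap)
  also have "\<dots> = (\<Sum>d\<in>?I. \<Sum>e\<in>?I. ?\<rho> d * ?\<rho> e * (\<Sum>r | r \<in> S \<and> lcm d e dvd r. h r))"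
    by (simp only: sum_distrib_left[symmetric] sum.inter_filter[OF assms])
  finally show ?thesis .
qed

lemma abs_selberg_pair_sum_le:
  assumes D: "D \<ge> 1" and t: "\<And>d e. d \<in> {1..D} \<Longrightarrow> e \<in> {1..D} \<Longrightarrow> \<bar>t d e\<bar> \<le> B" and B: "B \<ge> 0"
  shows "\<bar>\<Sum>d\<in>{1..D}. \<Sum>e\<in>{1..D}. selberg_weight D d * selberg_weight D e * t d e\<bar> \<le> (real D)\<^sup>2 * B"
proof -
  have "\<bar>\<Sum>d\<in>{1..D}. \<Sum>e\<in>{1..D}. selberg_weight D d * selberg_weight D e * t d e\<bar>
      \<le> (\<Sum>d\<in>{1..D}. \<Sum>e\<in>{1..D}. B)"
  proof (intro order.trans[OF sum_abs] sum_mono)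
    fix d e assume de: "d \<in> {1..D}" "e \<in> {1..D}"
    have "\<bar>selberg_weight D d * selberg_weight D e * t d e\<bar>
        = \<bar>selberg_weight D d\<bar> * \<bar>selberg_weight D e\<bar> * \<bar>t d e\<bar>" by (simp add: abs_mult)
    also have "\<dots> \<le> 1 * 1 * B"
      using abs_selberg_weight_le[OF D] t[OF de] by (intro mult_mono) auto
    finally show "\<bar>selberg_weight D d * selberg_weight D e * t d e\<bar> \<le> B" by simp
  qed
  also have "\<dots> = (real D)\<^sup>2 * B" by (simp add: power2_eq_square)
  finally show ?thesis .
qed

lemma selberg_majorant_sum_le:
  assumes D: "D \<ge> 1"
  shows "(\<Sum>r=1..Y. selberg_majorant D r) \<le> real Y / sieve_mass D + (real D)\<^sup>2"
proof -
  let ?I = "{1..D}"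
  let ?\<rho> = "selberg_weight D"
  define \<theta> where "\<theta> = (\<lambda>d e. real (Y div lcm d e) - real Y / real (lcm d e))"
  have "(\<Sum>r=1..Y. selberg_majorant D r) = (\<Sum>r\<in>{1..Y}. selberg_majorant D r * 1)" by simp
  also have "\<dots> = (\<Sum>d\<in>?I. \<Sum>e\<in>?I. ?\<rho> d * ?\<rho> e * (\<Sum>r | r \<in> {1..Y} \<and> lcm d e dvd r. 1))"
    by (rule sum_selberg_majorant) simp
  also have "\<dots> = (\<Sum>d\<in>?I. \<Sum>e\<in>?I. real Y * (?\<rho> d * ?\<rho> e / real (lcm d e)) + ?\<rho> d * ?\<rho> e * \<theta> d e)"
  proof (intro sum.cong refl)
    fix d e assume "d \<in> ?I" "e \<in> ?I"
    then have l: "lcm d e > 0" by (simp add: lcm_pos_nat)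
    have "{r. r \<in> {1..Y} \<and> lcm d e dvd r} = (\<lambda>k. lcm d e * k) ` {1..Y div lcm d e}"
    proof (intro equalityI subsetI)
      fix r assume r: "r \<in> {r. r \<in> {1..Y} \<and> lcm d e dvd r}"
      then obtain k where k: "r = lcm d e * k" by blast
      then have "k \<in> {1..Y div lcm d e}" using r l
        by (auto simp: less_eq_div_iff_mult_less_eq mult.commute Suc_le_eq)
      then show "r \<in> (\<lambda>k. lcm d e * k) ` {1..Y div lcm d e}" using k by blast
    qed (use l in \<open>auto simp: less_eq_div_iff_mult_less_eq mult.commute Suc_le_eq\<close>)
    moreover have "inj_on (\<lambda>k. lcm d e * k) {1..Y div lcm d e}" using l by (auto simp: inj_on_def)
    ultimately have "card {r. r \<in> {1..Y} \<and> lcm d e dvd r} = Y div lcm d e"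
      by (simp only: card_image card_atLeastAtMost diff_Suc_1 One_nat_def)
    then have "(\<Sum>r | r \<in> {1..Y} \<and> lcm d e dvd r. 1) = real (Y div lcm d e)" by simp
    then show "?\<rho> d * ?\<rho> e * (\<Sum>r | r \<in> {1..Y} \<and> lcm d e dvd r. 1)
        = real Y * (?\<rho> d * ?\<rho> e / real (lcm d e)) + ?\<rho> d * ?\<rho> e * \<theta> d e"
      by (simp only: \<theta>_def) (simp add: right_diff_distrib)
  qed
  also have "\<dots> = real Y * (\<Sum>d\<in>?I. \<Sum>e\<in>?I. ?\<rho> d * ?\<rho> e / real (lcm d e)) + (\<Sum>d\<in>?I. \<Sum>e\<in>?I. ?\<rho> d * ?\<rho> e * \<theta> d e)"
    by (simp only: sum.distrib sum_distrib_left)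
  also have "\<dots> \<le> real Y * (1 / sieve_mass D) + (real D)\<^sup>2 * 1"
  proof (rule add_mono)
    show "real Y * (\<Sum>d\<in>?I. \<Sum>e\<in>?I. ?\<rho> d * ?\<rho> e / real (lcm d e)) \<le> real Y * (1 / sieve_mass D)"
      by (intro mult_left_mono selberg_quadratic_form_le[OF D]) simp
    have "\<bar>\<theta> d e\<bar> \<le> 1" if "d \<in> ?I" "e \<in> ?I" for d e
    proof -
      have l: "real (lcm d e) > 0" using that by (simp add: lcm_pos_nat)
      have less: "real (Y mod lcm d e) < real (lcm d e)" using l by simp
      have "real Y = real (lcm d e) * real (Y div lcm d e) + real (Y mod lcm d e)"
        by (metis mult_div_mod_eq of_nat_add of_nat_mult)
      moreover have "q - y / L = - (m / L)" if "y = L * q + m" "L > 0" for y L q m :: real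
        using that by (simp add: field_simps)
      ultimately have "\<theta> d e = - (real (Y mod lcm d e) / real (lcm d e))"
        using l unfolding \<theta>_def by blast
      then show ?thesis using l less by (simp add: divide_le_eq)
    qed
    then have "\<bar>\<Sum>d\<in>?I. \<Sum>e\<in>?I. ?\<rho> d * ?\<rho> e * \<theta> d e\<bar> \<le> (real D)\<^sup>2 * 1"
      by (rule abs_selberg_pair_sum_le[OF D]) simp_all
    then show "(\<Sum>d\<in>?I. \<Sum>e\<in>?I. ?\<rho> d * ?\<rho> e * \<theta> d e) \<le> (real D)\<^sup>2 * 1" by simp
  qed
  finally show ?thesis by simp
qed

text \<open>On the multiples of \<open>l = lcm d e\<close> the symbol is \<open>(n / l)\<close> times the symbol at the cofactor, so the cancellation
in \<open>jacobi_sum_modulus\<close> survives for each of the \<open>D^2\<close> pairs.\<close>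

lemma selberg_majorant_jacobi_sum_le:
  assumes D: "D \<ge> 1" and n: "odd n" "\<nexists>k. n = k ^ 2"
  shows "\<bar>\<Sum>r | r \<le> Y \<and> odd r. selberg_majorant D r * real_of_int (jacobi_symbol (int n) r)\<bar>
           \<le> 2 * (real D)\<^sup>2 * (sqrt (real n) * (1 + ln (real n)))"
proof -
  let ?J = "\<lambda>r. real_of_int (jacobi_symbol (int n) r)"
  let ?B = "2 * (sqrt (real n) * (1 + ln (real n)))"
  define t where "t = (\<lambda>d e. \<Sum>r | r \<in> {r. r \<le> Y \<and> odd r} \<and> lcm d e dvd r. ?J r)"
  have "n > 0" using n(1) by (intro Nat.gr0I) auto
  then have B0: "?B \<ge> 0" by simp
  have fin: "finite {r. r \<le> Y \<and> odd r}" for Y :: nat by (rule finite_subset[of _ "{..Y}"]) auto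
  have "\<bar>t d e\<bar> \<le> ?B" if de: "d \<in> {1..D}" "e \<in> {1..D}" for d e
  proof (cases "odd (lcm d e)")
    case True
    define l where "l = lcm d e"
    have l: "l > 0" "odd l" using de True by (auto simp: l_def lcm_pos_nat)
    have "{r. r \<in> {r. r \<le> Y \<and> odd r} \<and> l dvd r} = (\<lambda>k. l * k) ` {r. r \<le> Y div l \<and> odd r}"
    proof (intro equalityI subsetI)
      fix r assume r: "r \<in> {r. r \<in> {r. r \<le> Y \<and> odd r} \<and> l dvd r}"
      then obtain k where k: "r = l * k" by blast
      then have "k \<in> {r. r \<le> Y div l \<and> odd r}" using r l
        by (auto simp: less_eq_div_iff_mult_less_eq mult.commute)
      then show "r \<in> (\<lambda>k. l * k) ` {r. r \<le> Y div l \<and> odd r}" using k by blast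
    qed (use l in \<open>auto simp: less_eq_div_iff_mult_less_eq mult.commute\<close>)
    then have "t d e = (\<Sum>k\<in>(\<lambda>k. l * k) ` {r. r \<le> Y div l \<and> odd r}. ?J k)"
      by (simp only: t_def l_def[symmetric])
    also have "\<dots> = (\<Sum>k | k \<le> Y div l \<and> odd k. ?J (l * k))"
      using l by (subst sum.reindex) (auto simp: inj_on_def)
    also have "\<dots> = (\<Sum>k | k \<le> Y div l \<and> odd k. ?J l * ?J k)"
    proof (rule sum.cong[OF refl])
      fix k assume "k \<in> {k. k \<le> Y div l \<and> odd k}"
      then have "k > 0" by (auto intro!: Nat.gr0I)
      then show "?J (l * k) = ?J l * ?J k" using l by (simp add: jacobi_mult_right)
    qed
    finally have "\<bar>t d e\<bar> = \<bar>?J l\<bar> * \<bar>\<Sum>k | k \<le> Y div l \<and> odd k. ?J k\<bar>"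
      by (simp only: sum_distrib_left[symmetric] abs_mult)
    also have "\<dots> \<le> 1 * ?B"
      using jacobi_sum_modulus[OF n] abs_jacobi_le_real by (intro mult_mono) auto
    finally show ?thesis by simp
  next
    case False
    then have "{r. r \<in> {r. r \<le> Y \<and> odd r} \<and> lcm d e dvd r} = {}" by (auto dest: dvd_trans)
    then have "t d e = 0" by (simp only: t_def sum.empty)
    then show ?thesis using B0 by simp
  qed
  then have "\<bar>\<Sum>d\<in>{1..D}. \<Sum>e\<in>{1..D}. selberg_weight D d * selberg_weight D e * t d e\<bar> \<le> (real D)\<^sup>2 * ?B"
    by (rule abs_selberg_pair_sum_le[OF D]) (use B0 in simp_all)
  then show ?thesis unfolding t_def by (simp only: sum_selberg_majorant[OF fin] mult_ac)
qed

lemma ln_le_sqrt: "x > 0 \<Longrightarrow> ln x \<le> 2 * sqrt (x::real)"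
proof -
  assume x: "x > 0"
  have "ln x = 2 * ln (sqrt x)" using x by (simp add: ln_sqrt)
  also have "ln (sqrt x) \<le> sqrt x - 1" using x by (intro ln_le_minus_one) auto
  finally show ?thesis by simp
qed

lemma sum_divide_abs_le:
  fixes c :: "nat \<Rightarrow> real"
  assumes "\<And>n. \<bar>c n\<bar> \<le> 1 / real n"
  shows "\<bar>\<Sum>n | n \<in> {1..N} \<and> odd n. c n * real_of_int (jacobi_symbol (int n) r)\<bar> \<le> (\<Sum>n=1..N. 1 / real n)"
proof -
  have "\<bar>\<Sum>n | n \<in> {1..N} \<and> odd n. c n * real_of_int (jacobi_symbol (int n) r)\<bar>
      \<le> (\<Sum>n | n \<in> {1..N} \<and> odd n. 1 / real n)"
  proof (intro order.trans[OF sum_abs] sum_mono)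
    fix n
    have "\<bar>c n\<bar> * \<bar>real_of_int (jacobi_symbol (int n) r)\<bar> \<le> (1 / real n) * 1"
      using assms abs_jacobi_le_real by (intro mult_mono) auto
    then show "\<bar>c n * real_of_int (jacobi_symbol (int n) r)\<bar> \<le> 1 / real n" by (simp add: abs_mult)
  qed
  also have "\<dots> \<le> (\<Sum>n=1..N. 1 / real n)" by (intro sum_mono2) auto
  finally show ?thesis .
qed

text \<open>The squares are nonnegative, so beyond a small range the primes may be replaced by the Selberg majorant of
level \<open>D\<close> about \<open>Y powr (1/4)\<close>, at the cost of a factor \<open>ln Y / sieve_mass D\<close>, which is bounded. The
quadratic form estimate then applies with \<open>M = 1\<close>; because \<open>Y >= N ^ 8\<close>, its error term, times \<open>ln Y\<close>, is of order at most \<open>Y\<close>.\<close>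

theorem sieve_over_primes:
  fixes c :: "nat \<Rightarrow> real"
  assumes N: "N \<ge> 1" and Y: "Y \<ge> N ^ 8" and c: "\<And>n. \<bar>c n\<bar> \<le> 1 / real n"
  shows "(\<Sum>p | p \<le> Y \<and> prime p \<and> odd p. ln (real p) *
        (\<Sum>n | n \<in> {1..N} \<and> odd n. c n * real_of_int (jacobi_symbol (int n) p))\<^sup>2)
          \<le> (10 * zeta_three_halves ^ 3 + 65) * real Y"
proof -
  define K where "K = zeta_three_halves ^ 3"
  have K: "K \<ge> 0" using zeta_three_halves_nonneg by (simp add: K_def)
  define F where "F = (\<lambda>r. \<Sum>n | n \<in> {1..N} \<and> odd n. c n * real_of_int (jacobi_symbol (int n) r))"
  \<comment> \<open>The level is \<open>D = floor q\<close> with \<open>q ^ 4 = Y\<close>, so that \<open>N ^ 2 <= q\<close>.\<close>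
  define q where "q = sqrt (sqrt (real Y))"
  define D where "D = nat \<lfloor>q\<rfloor>"
  have Y1: "real Y \<ge> 1" using N Y by (metis One_nat_def Suc_le_eq of_nat_1 of_nat_mono one_le_power order.trans)
  have q4: "q ^ 4 = real Y" by (simp add: q_def power4_eq_xxxx flip: power2_eq_square) (simp add: mult.assoc flip: power2_eq_square)
  have q1: "q \<ge> 1" using Y1 by (simp add: q_def)
  have D: "D \<ge> 1" "real D \<le> q" "q \<le> real D + 1" using q1 by (auto simp: D_def le_nat_iff)
  have qN: "real N ^ 2 \<le> q"
  proof -
    have "real (N ^ 8) \<le> real Y" using Y by (simp only: of_nat_le_iff)
    then have "(real N ^ 2) ^ 4 \<le> q ^ 4" by (simp add: q4 flip: power_mult)
    moreover have "q ^ 4 < (real N ^ 2) ^ 4" if "q < real N ^ 2"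
      using that q1 by (intro power_strict_mono) auto
    ultimately show ?thesis by (meson not_le)
  qed
  have lnY: "ln (real Y) \<le> 4 * q" "ln (real Y) \<ge> 0"
  proof -
    have "ln (real Y) = 4 * ln q" using q1 by (simp add: q4[symmetric] ln_realpow)
    also have "ln q \<le> q" using q1 ln_le_minus_one[of q] by simp
    finally show "ln (real Y) \<le> 4 * q" by simp
  qed (use Y1 in simp)
  let ?P = "{p. p \<le> Y \<and> prime p \<and> odd p}"
  let ?S = "{r. r \<le> Y \<and> odd r}"
  have fin: "finite ?S" "finite ?P" by (rule finite_subset[of _ "{..Y}"]; auto)+
  have F: "(F r)\<^sup>2 \<le> real N ^ 2" for r
  proof -
    have "\<bar>F r\<bar> \<le> (\<Sum>n=1..N. 1 / real n)" unfolding F_def by (rule sum_divide_abs_le[OF c])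
    also have "\<dots> \<le> (\<Sum>n=1..N. 1)" by (intro sum_mono) auto
    finally have "\<bar>F r\<bar> \<le> real N" by simp
    then show ?thesis by (metis abs_ge_zero power2_abs power_mono)
  qed
  have small: "(\<Sum>p\<in>{p\<in>?P. p \<le> D}. ln (real p) * (F p)\<^sup>2) \<le> real Y"
  proof -
    have "(\<Sum>p\<in>{p\<in>?P. p \<le> D}. ln (real p) * (F p)\<^sup>2) \<le> (\<Sum>p\<in>{p\<in>?P. p \<le> D}. q * q)"
    proof (intro sum_mono mult_mono)
      fix p assume p: "p \<in> {p\<in>?P. p \<le> D}"
      then have "p > 0" by (auto simp: prime_gt_0_nat)
      then have "ln (real p) \<le> real p" using ln_le_minus_one[of "real p"] by simp
      also have "real p \<le> q" using p D(2) by (simp add: order.trans[OF of_nat_mono])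
      finally show "ln (real p) \<le> q" .
      show "(F p)\<^sup>2 \<le> q" using F[of p] qN by simp
    qed (use q1 in auto)
    also have "\<dots> = real (card {p\<in>?P. p \<le> D}) * (q * q)" by simp
    also have "\<dots> \<le> q * (q * q)"
    proof (rule mult_right_mono)
      have "card {p\<in>?P. p \<le> D} \<le> card {1..D}" by (intro card_mono) (auto simp: prime_gt_0_nat Suc_le_eq)
      then show "real (card {p\<in>?P. p \<le> D}) \<le> q" using D(2) by simp
    qed simp
    also have "\<dots> \<le> q * (q * q) * q" using q1 mult_left_mono[of 1 q "q * (q * q)"] by simp
    also have "\<dots> = real Y" using q4 by (simp add: power4_eq_xxxx mult_ac)
    finally show ?thesis .
  qed
  have G: "ln (real Y) / sieve_mass D \<le> 8"
  proof -
    have "ln (real Y) = 4 * ln q" using q1 by (simp add: q4[symmetric] ln_realpow)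
    also have "\<dots> \<le> 4 * ln (real D + 1)" using q1 D(3) by simp
    also have "\<dots> \<le> 8 * sieve_mass D" using sieve_mass_ge_ln[of D] by simp
    finally show ?thesis using sieve_mass_pos[OF D(1)] by (simp add: divide_le_eq)
  qed
  have "(\<Sum>p\<in>{p\<in>?P. p > D}. ln (real p) * (F p)\<^sup>2) \<le> ln (real Y) * (\<Sum>r\<in>?S. selberg_majorant D r * (F r)\<^sup>2)"
  proof -
    have "(\<Sum>p\<in>{p\<in>?P. p > D}. ln (real p) * (F p)\<^sup>2) \<le> (\<Sum>p\<in>{p\<in>?P. p > D}. ln (real Y) * (selberg_majorant D p * (F p)\<^sup>2))"
    proof (rule sum_mono)
      fix p assume p: "p \<in> {p\<in>?P. p > D}"
      then have "selberg_majorant D p = 1" using selberg_majorant_prime[OF D(1)] by auto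
      moreover have "ln (real p) \<le> ln (real Y)" using p by (simp add: prime_gt_0_nat)
      ultimately show "ln (real p) * (F p)\<^sup>2 \<le> ln (real Y) * (selberg_majorant D p * (F p)\<^sup>2)"
        by (simp add: mult_right_mono)
    qed
    also have "\<dots> \<le> (\<Sum>r\<in>?S. ln (real Y) * (selberg_majorant D r * (F r)\<^sup>2))"
      using lnY by (intro sum_mono2 fin) (auto simp: selberg_majorant_nonneg)
    finally show ?thesis by (simp only: sum_distrib_left)
  qed
  also have "\<dots> \<le> ln (real Y) * (K * (real Y / sieve_mass D + q * q) + 16 * (q * q) * q)"
  proof (rule mult_left_mono[OF _ lnY(2)])
    have "(\<Sum>r\<in>?S. selberg_majorant D r * (F r)\<^sup>2)
        \<le> K * (\<Sum>r\<in>?S. selberg_majorant D r) / sqrt (real 1) + 8 * (2 * (real D)\<^sup>2) * real N * (1 + ln (real N))"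
      unfolding F_def K_def
    proof (rule jacobi_quadratic_form_le[OF _ N fin(1) _ _ c])
      show "\<forall>r\<in>?S. odd r \<and> selberg_majorant D r \<ge> 0" by (simp add: selberg_majorant_nonneg)
      show "\<bar>\<Sum>r\<in>?S. selberg_majorant D r * real_of_int (jacobi_symbol (int n) r)\<bar>
          \<le> 2 * (real D)\<^sup>2 * (sqrt (real n) * (1 + ln (real n)))" if "odd n" "\<nexists>k. n = k ^ 2" for n
        using that by (rule selberg_majorant_jacobi_sum_le[OF D(1)])
    qed auto
    also have "\<dots> = K * (\<Sum>r\<in>?S. selberg_majorant D r) + 16 * (real D)\<^sup>2 * (real N * (1 + ln (real N)))" by simp
    also have "\<dots> \<le> K * (real Y / sieve_mass D + q * q) + 16 * (q * q) * q"
    proof (intro add_mono mult_left_mono mult_mono)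
      have "(\<Sum>r\<in>?S. selberg_majorant D r) \<le> (\<Sum>r=1..Y. selberg_majorant D r)"
        by (intro sum_mono2) (auto simp: selberg_majorant_nonneg intro!: Nat.gr0I simp: Suc_le_eq)
      also have "\<dots> \<le> real Y / sieve_mass D + (real D)\<^sup>2" by (rule selberg_majorant_sum_le[OF D(1)])
      also have "(real D)\<^sup>2 \<le> q * q" unfolding power2_eq_square using D(2) q1 by (intro mult_mono) auto
      finally show "(\<Sum>r\<in>?S. selberg_majorant D r) \<le> real Y / sieve_mass D + q * q" by simp
      show "(real D)\<^sup>2 \<le> q * q" unfolding power2_eq_square using D(2) q1 by (intro mult_mono) auto
      have "1 + ln (real N) \<le> real N" using N ln_le_minus_one[of "real N"] by simp
      then have "real N * (1 + ln (real N)) \<le> real N * real N" by (intro mult_left_mono) auto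
      then show "real N * (1 + ln (real N)) \<le> q" using qN by (simp add: power2_eq_square)
    qed (use K N q1 in auto)
    finally show "(\<Sum>r\<in>?S. selberg_majorant D r * (F r)\<^sup>2) \<le> K * (real Y / sieve_mass D + q * q) + 16 * (q * q) * q" .
  qed
  also have "\<dots> = K * real Y * (ln (real Y) / sieve_mass D) + K * (ln (real Y) * (q * q)) + 16 * (ln (real Y) * (q * q * q))"
    by (simp add: algebra_simps add_divide_distrib)
  also have "\<dots> \<le> K * real Y * 8 + K * (2 * real Y) + 16 * (4 * real Y)"
  proof (intro add_mono mult_left_mono G)
    have "q * q = sqrt (real Y)" by (simp add: q_def)
    moreover have "ln (real Y) \<le> 2 * sqrt (real Y)" using Y1 by (intro ln_le_sqrt) auto
    ultimately have "ln (real Y) * (q * q) \<le> 2 * sqrt (real Y) * sqrt (real Y)"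
      using Y1 by (intro mult_mono) auto
    then show "ln (real Y) * (q * q) \<le> 2 * real Y"
      by (simp only: mult.assoc real_sqrt_mult_self abs_of_nat)
    have "ln (real Y) * (q * q * q) \<le> 4 * q * (q * q * q)" using lnY q1 by (intro mult_right_mono) auto
    also have "\<dots> = 4 * real Y" using q4 by (simp add: power4_eq_xxxx mult_ac)
    finally show "ln (real Y) * (q * q * q) \<le> 4 * real Y" .
  qed (use K in auto)
  finally have large: "(\<Sum>p\<in>{p\<in>?P. p > D}. ln (real p) * (F p)\<^sup>2) \<le> K * real Y * 8 + K * (2 * real Y) + 16 * (4 * real Y)" .
  have "?P = {p\<in>?P. p \<le> D} \<union> {p\<in>?P. p > D}" by auto
  then have "(\<Sum>p\<in>?P. ln (real p) * (F p)\<^sup>2)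
      = (\<Sum>p\<in>{p\<in>?P. p \<le> D}. ln (real p) * (F p)\<^sup>2) + (\<Sum>p\<in>{p\<in>?P. p > D}. ln (real p) * (F p)\<^sup>2)"
    using fin(2) by (metis (no_types, lifting) sum.union_disjoint finite_Un disjoint_iff mem_Collect_eq not_less)
  also have "\<dots> \<le> real Y + (K * real Y * 8 + K * (2 * real Y) + 16 * (4 * real Y))"
    by (intro add_mono small large)
  also have "\<dots> = (10 * K + 65) * real Y" by (simp add: algebra_simps)
  finally show ?thesis unfolding F_def K_def .
qed

section \<open>Short L-sums on average against the divisor weight\<close>

lemma divisor_tau_pos: "k > 0 \<Longrightarrow> divisor_tau k \<ge> 1"
proof -
  assume k: "k > 0"
  have "card {1::nat} \<le> card {d. d dvd k}" using k by (intro card_mono) auto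
  then show ?thesis by (simp add: divisor_tau_def)
qed

lemma divisor_tau_mono: "a dvd b \<Longrightarrow> b > 0 \<Longrightarrow> divisor_tau a \<le> divisor_tau b"
  unfolding divisor_tau_def by (intro card_mono Collect_mono impI) (simp, erule dvd_trans)

lemma divisor_tau_submult:
  assumes "a > 0" "b > 0"
  shows "divisor_tau (a * b) \<le> divisor_tau a * divisor_tau b"
proof -
  have "{d. d dvd a * b} \<subseteq> (\<lambda>(x, y). x * y) ` ({d. d dvd a} \<times> {d. d dvd b})"
  proof
    fix d assume "d \<in> {d. d dvd a * b}"
    then obtain x y where "d = x * y" "x dvd a" "y dvd b" using division_decomp[of d a b] by auto
    then show "d \<in> (\<lambda>(x, y). x * y) ` ({d. d dvd a} \<times> {d. d dvd b})" by (intro image_eqI[of _ _ "(x, y)"]) auto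
  qed
  then have "divisor_tau (a * b) \<le> card ((\<lambda>(x, y). x * y) ` ({d. d dvd a} \<times> {d. d dvd b}))"
    unfolding divisor_tau_def using assms by (intro card_mono) auto
  also have "\<dots> \<le> card ({d. d dvd a} \<times> {d. d dvd b})"
    using assms by (intro card_image_le) auto
  finally show ?thesis by (simp add: divisor_tau_def card_cartesian_product)
qed

text \<open>Square the sum and collect the pairs \<open>(a, b)\<close> with \<open>a b = k\<close>. There are at most \<open>divisor_tau k\<close> of them, each of weight at
most \<open>1 / (divisor_tau k * k)\<close> by submultiplicativity, so the square is at most a harmonic sum up to \<open>X^2\<close>.\<close>

lemma sum_inverse_divisor_tau_le:
  assumes X: "X \<ge> 1"
  shows "(\<Sum>m=1..X. 1 / (real (divisor_tau m) * real m)) \<le> sqrt (1 + 2 * ln (real X))"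
proof -
  define f where "f = (\<lambda>m. 1 / (real (divisor_tau m) * real m))"
  let ?I = "{1..X}"
  let ?P = "\<lambda>k. {x \<in> ?I \<times> ?I. fst x * snd x = k}"
  have "(\<Sum>m\<in>?I. f m)\<^sup>2 = (\<Sum>x\<in>?I \<times> ?I. f (fst x) * f (snd x))"
    unfolding power2_eq_square sum_product sum.cartesian_product by (simp only: case_prod_unfold)
  also have "\<dots> \<le> (\<Sum>x\<in>?I \<times> ?I. 1 / (real (divisor_tau (fst x * snd x)) * real (fst x * snd x)))"
  proof (rule sum_mono)
    fix x assume "x \<in> ?I \<times> ?I"
    then have x: "fst x > 0" "snd x > 0" by auto
    then have "real (divisor_tau (fst x * snd x)) \<le> real (divisor_tau (fst x) * divisor_tau (snd x))"
      using divisor_tau_submult by (simp only: of_nat_le_iff)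
    moreover have "real (divisor_tau (fst x * snd x)) \<ge> 1" using divisor_tau_pos[of "fst x * snd x"] x by simp
    ultimately have "1 / (real (divisor_tau (fst x) * divisor_tau (snd x)) * real (fst x * snd x))
        \<le> 1 / (real (divisor_tau (fst x * snd x)) * real (fst x * snd x))"
      using x by (intro divide_left_mono mult_right_mono mult_pos_pos) auto
    then show "f (fst x) * f (snd x) \<le> 1 / (real (divisor_tau (fst x * snd x)) * real (fst x * snd x))"
      by (simp add: f_def mult_ac)
  qed
  also have "\<dots> = (\<Sum>k\<in>{1..X*X}. \<Sum>x\<in>?P k. 1 / (real (divisor_tau (fst x * snd x)) * real (fst x * snd x)))"
  proof (rule sum.group[symmetric])
    show "(\<lambda>x. fst x * snd x) ` (?I \<times> ?I) \<subseteq> {1..X * X}"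
    proof
      fix y assume "y \<in> (\<lambda>x. fst x * snd x) ` (?I \<times> ?I)"
      then obtain a b where "y = a * b" "1 \<le> a" "a \<le> X" "1 \<le> b" "b \<le> X" by auto
      then show "y \<in> {1..X * X}" using mult_le_mono[of 1 a 1 b] mult_le_mono[of a X b X] by simp
    qed
  qed auto
  also have "\<dots> \<le> (\<Sum>k\<in>{1..X*X}. 1 / real k)"
  proof (rule sum_mono)
    fix k assume k: "k \<in> {1..X*X}"
    have "(\<Sum>x\<in>?P k. 1 / (real (divisor_tau (fst x * snd x)) * real (fst x * snd x)))
        = (\<Sum>x\<in>?P k. 1 / (real (divisor_tau k) * real k))"
      by (rule sum.cong[OF refl]) auto
    also have "\<dots> = real (card (?P k)) * (1 / (real (divisor_tau k) * real k))" by simp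
    also have "\<dots> \<le> real (divisor_tau k) * (1 / (real (divisor_tau k) * real k))"
    proof (rule mult_right_mono)
      have "inj_on fst (?P k)"
      proof (rule inj_onI)
        fix x y assume "x \<in> ?P k" "y \<in> ?P k" "fst x = fst y"
        then have "fst x * snd x = fst x * snd y" "fst x > 0" by auto
        then have "snd x = snd y" by simp
        then show "x = y" using \<open>fst x = fst y\<close> by (simp add: prod_eq_iff)
      qed
      moreover have "fst ` ?P k \<subseteq> {d. d dvd k}" by auto
      ultimately have "card (?P k) \<le> divisor_tau k"
        unfolding divisor_tau_def using k by (intro card_inj_on_le[of fst]) auto
      then show "real (card (?P k)) \<le> real (divisor_tau k)" by simp
    qed simp
    also have "\<dots> = 1 / real k" using divisor_tau_pos[of k] k by simp
    finally show "(\<Sum>x\<in>?P k. 1 / (real (divisor_tau (fst x * snd x)) * real (fst x * snd x))) \<le> 1 / real k" .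
  qed
  also have "\<dots> \<le> 1 + ln (real (X * X))" using X by (intro sum_inverse_le_ln) (simp add: Suc_le_eq)
  also have "\<dots> = 1 + 2 * ln (real X)" using X by (simp add: ln_mult)
  finally have "(\<Sum>m\<in>?I. f m)\<^sup>2 \<le> 1 + 2 * ln (real X)" .
  then show ?thesis unfolding f_def by (rule real_le_rsqrt)
qed

lemma ln_squarefree:
  assumes "squarefree (m::nat)"
  shows "ln (real m) = (\<Sum>p\<in>prime_factors m. ln (real p))"
proof -
  have m0: "m \<noteq> 0" using assms by (intro notI) simp
  have mult: "p ^ multiplicity p m = p" if p: "p \<in> prime_factors m" for p
  proof -
    have pp: "prime p" using p by (rule in_prime_factors_imp_prime)
    have "\<not> 2 \<le> multiplicity p m"
    proof
      assume "2 \<le> multiplicity p m"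
      then have "p ^ 2 dvd m" by (rule multiplicity_dvd')
      then have "p dvd 1" by (rule squarefreeD[OF assms])
      then show False using pp by (simp add: prime_nat_iff)
    qed
    moreover have "multiplicity p m > 0" using p unfolding prime_factors_multiplicity by simp
    ultimately have "multiplicity p m = 1" by linarith
    then show ?thesis by simp
  qed
  have "normalize m = (\<Prod>p\<in>prime_factors m. p ^ multiplicity p m)"
    by (rule prod_prime_factors[OF m0, symmetric])
  also have "\<dots> = (\<Prod>p\<in>prime_factors m. p)"
    by (rule prod.cong[OF refl mult])
  finally have "m = (\<Prod>p\<in>prime_factors m. p)" unfolding normalize_nat_def id_def .
  then have "real m = real (\<Prod>p\<in>prime_factors m. p)" by (rule arg_cong)
  then have "ln (real m) = ln (\<Prod>p\<in>prime_factors m. real p)" by (simp only: of_nat_prod)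
  moreover have "ln (\<Prod>p\<in>prime_factors m. real p) = (\<Sum>p\<in>prime_factors m. ln (real p))"
    by (intro ln_prod) (use in_prime_factors_imp_prime prime_gt_0_nat in \<open>force+\<close>)
  ultimately show ?thesis by (simp only:)
qed

lemma sum_ln_quotient_le: "(\<Sum>m=1..X. ln (real X / real m)) \<le> 4 * real X"
proof -
  have "(\<Sum>m=1..X. ln (real X / real m)) \<le> (\<Sum>m=1..X. 2 * sqrt (real X) * (1 / sqrt (real m)))"
  proof (rule sum_mono)
    fix m assume "m \<in> {1..X}"
    then have "real X / real m > 0" by auto
    then show "ln (real X / real m) \<le> 2 * sqrt (real X) * (1 / sqrt (real m))"
      using ln_le_sqrt[of "real X / real m"] by (simp add: real_sqrt_divide)
  qed
  also have "\<dots> = 2 * sqrt (real X) * (\<Sum>m=1..X. 1 / sqrt (real m))" by (rule sum_distrib_left[symmetric])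
  also have "\<dots> \<le> 2 * sqrt (real X) * (2 * sqrt (real X))"
    by (intro mult_left_mono sum_inverse_sqrt_le) auto
  finally show ?thesis by simp
qed

text \<open>The condition confines \<open>k\<close> to the range from \<open>X / M\<close> to \<open>X\<close>.\<close>

lemma sum_inverse_upper_range_le:
  assumes "X \<ge> 1" "M \<ge> 1"
  shows "(\<Sum>k | k \<in> {1..X} \<and> X div k < M. 1 / real k) \<le> 1 + ln (real M)"
proof -
  define k0 where "k0 = X div M"
  have k0: "k0 \<le> X" by (simp add: k0_def)
  have "(\<Sum>k | k \<in> {1..X} \<and> X div k < M. 1 / real k) \<le> (\<Sum>k\<in>{k0<..X}. 1 / real k)"
  proof (rule sum_mono2)
    show "{k. k \<in> {1..X} \<and> X div k < M} \<subseteq> {k0<..X}"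
    proof
      fix k assume "k \<in> {k. k \<in> {1..X} \<and> X div k < M}"
      then have k: "1 \<le> k" "k \<le> X" "X div k < M" by auto
      then have "X < M * k" by (simp add: div_less_iff_less_mult)
      then have "X div M < k" using assms by (simp add: div_less_iff_less_mult mult.commute)
      then show "k \<in> {k0<..X}" using k by (simp add: k0_def)
    qed
  qed auto
  also have "\<dots> = (\<Sum>k=1..X. 1 / real k) - (\<Sum>k=1..k0. 1 / real k)"
  proof -
    have "{1..X} = {1..k0} \<union> {k0<..X}" "{1..k0} \<inter> {k0<..X} = {}" using k0 by auto
    then have "(\<Sum>k=1..X. 1 / real k) = (\<Sum>k=1..k0. 1 / real k) + (\<Sum>k\<in>{k0<..X}. 1 / real k)"
      by (metis (no_types, lifting) finite_atLeastAtMost finite_greaterThanAtMost sum.union_disjoint)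
    then show ?thesis by simp
  qed
  also have "\<dots> \<le> (1 + ln (real X)) - ln (real k0 + 1)"
    using sum_inverse_le_ln[OF assms(1)] ln_le_harm[of k0] by (simp add: harm_def inverse_eq_divide)
  also have "\<dots> \<le> 1 + ln (real M)"
  proof -
    have "X < M * (k0 + 1)"
      unfolding k0_def using assms by (metis Suc_eq_plus1 dividend_less_times_div less_eq_Suc_le mult_Suc_right One_nat_def add.commute)
    then have "real X \<le> real M * (real k0 + 1)" by (metis of_nat_Suc of_nat_mult of_nat_le_iff less_imp_le Suc_eq_plus1 add.commute)
    then have "ln (real X) \<le> ln (real M * (real k0 + 1))" using assms by (intro ln_mono) auto
    also have "\<dots> = ln (real M) + ln (real k0 + 1)" using assms by (simp add: ln_mult)
    finally show ?thesis by simp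
  qed
  finally show ?thesis .
qed

definition odd_squarefrees :: "nat \<Rightarrow> nat set" where
  "odd_squarefrees X = {m. 1 \<le> m \<and> m \<le> X \<and> odd m \<and> squarefree m}"

text \<open>Only odd \<open>n\<close> occur, so that reciprocity alone describes the symbol as a function of its modulus.\<close>

definition short_L_sum :: "nat \<Rightarrow> nat \<Rightarrow> real" where
  "short_L_sum N m = (\<Sum>n | n \<in> {1..N} \<and> odd n. 1 / real n * real_of_int (jacobi_symbol (int n) m))"

lemma finite_odd_squarefrees [simp]: "finite (odd_squarefrees X)"
  unfolding odd_squarefrees_def by (rule finite_subset[of _ "{..X}"]) auto

lemma abs_short_L_sum_le:
  assumes "N \<ge> 1"
  shows "\<bar>short_L_sum N m\<bar> \<le> 1 + ln (real N)"
  using sum_divide_abs_le[where c = "\<lambda>n. 1 / real n" and N = N and r = m] sum_inverse_le_ln[OF assms]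
  unfolding short_L_sum_def by simp

lemma short_L_sum_square_le:
  assumes "N \<ge> 1"
  shows "(short_L_sum N m)\<^sup>2 \<le> (1 + ln (real N))\<^sup>2"
  using power_mono[OF abs_short_L_sum_le[OF assms, of m] abs_ge_zero, of 2] by simp

text \<open>For \<open>Y\<close> below the sieving threshold the trivial bounds \<open>8 * ln N\<close> for \<open>ln p\<close> and \<open>1 + ln N\<close> for the short sum are used. This
loses powers of \<open>ln N\<close>, but it is applied with \<open>Y = X div k\<close>, which is that small only for \<open>k\<close> between \<open>X / N ^ 8\<close>
and \<open>X\<close>, where the sum of \<open>1 / k\<close> is at most \<open>1 + 8 * ln N\<close>.\<close>

lemma short_L_sum_twisted_primes:
  assumes k: "k > 0" and N: "N \<ge> 1"
  shows "(\<Sum>p | p \<le> Y \<and> prime p \<and> odd p. ln (real p) * (short_L_sum N (k * p))\<^sup>2)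
    \<le> (if Y \<ge> N ^ 8 then (10 * zeta_three_halves ^ 3 + 65) * real Y else 8 * (1 + ln (real N)) ^ 3 * real Y)"
proof (cases "Y \<ge> N ^ 8")
  case True
  define c where "c = (\<lambda>n. 1 / real n * real_of_int (jacobi_symbol (int n) k))"
  have c: "\<bar>c n\<bar> \<le> 1 / real n" for n
  proof -
    have "\<bar>c n\<bar> = 1 / real n * \<bar>real_of_int (jacobi_symbol (int n) k)\<bar>" by (simp add: c_def abs_mult)
    also have "\<dots> \<le> 1 / real n * 1" by (intro mult_left_mono abs_jacobi_le_real) auto
    finally show ?thesis by simp
  qed
  have "(\<Sum>p | p \<le> Y \<and> prime p \<and> odd p. ln (real p) * (short_L_sum N (k * p))\<^sup>2)
    = (\<Sum>p | p \<le> Y \<and> prime p \<and> odd p. ln (real p) *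
        (\<Sum>n | n \<in> {1..N} \<and> odd n. c n * real_of_int (jacobi_symbol (int n) p))\<^sup>2)"
  proof (rule sum.cong[OF refl])
    fix p assume "p \<in> {p. p \<le> Y \<and> prime p \<and> odd p}"
    then have p: "p > 0" by (simp add: prime_gt_0_nat)
    have "short_L_sum N (k * p) = (\<Sum>n | n \<in> {1..N} \<and> odd n. c n * real_of_int (jacobi_symbol (int n) p))"
      unfolding short_L_sum_def c_def by (intro sum.cong refl) (simp add: jacobi_mult_right[OF k p])
    then show "ln (real p) * (short_L_sum N (k * p))\<^sup>2 = ln (real p) *
        (\<Sum>n | n \<in> {1..N} \<and> odd n. c n * real_of_int (jacobi_symbol (int n) p))\<^sup>2" by (simp only:)
  qed
  also have "\<dots> \<le> (10 * zeta_three_halves ^ 3 + 65) * real Y"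
    by (rule sieve_over_primes[OF N True c])
  finally show ?thesis using True by simp
next
  case False
  let ?P = "{p. p \<le> Y \<and> prime p \<and> odd p}"
  define L where "L = 1 + ln (real N)"
  have L1: "L \<ge> 1" using N by (simp add: L_def)
  have "(\<Sum>p\<in>?P. ln (real p) * (short_L_sum N (k * p))\<^sup>2) \<le> (\<Sum>p\<in>?P. (8 * L) * L\<^sup>2)"
  proof (intro sum_mono mult_mono)
    fix p assume p: "p \<in> ?P"
    then have "p > 0" "p \<le> N ^ 8" using False by (auto simp: prime_gt_0_nat)
    then have "real p \<le> real (N ^ 8)" by (simp only: of_nat_le_iff)
    then have "ln (real p) \<le> ln (real (N ^ 8))" using \<open>p > 0\<close> by (intro ln_mono) auto
    also have "\<dots> = 8 * ln (real N)" using N by (simp add: ln_realpow)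
    finally show "ln (real p) \<le> 8 * L" by (simp add: L_def)
    show "(short_L_sum N (k * p))\<^sup>2 \<le> L\<^sup>2" unfolding L_def by (rule short_L_sum_square_le[OF N])
  qed (use L1 in auto)
  also have "\<dots> = real (card ?P) * (8 * L ^ 3)" by (simp add: power2_eq_square power3_eq_cube)
  also have "\<dots> \<le> real Y * (8 * L ^ 3)"
  proof (rule mult_right_mono)
    have "card ?P \<le> card {1..Y}" by (intro card_mono) (auto simp: prime_gt_0_nat Suc_le_eq)
    then show "real (card ?P) \<le> real Y" by simp
  qed (use L1 in simp)
  finally show ?thesis using False by (simp add: L_def mult_ac)
qed

text \<open>Split \<open>ln X = ln (X / m) + ln m\<close>. The first part is small on average over \<open>m\<close>. In the second, \<open>ln m\<close> is the sum of
\<open>ln p\<close> over the primes dividing \<open>m\<close>; writing \<open>m = k p\<close> and bounding the weight of \<open>m\<close> by that of \<open>k\<close>, the sum over \<open>p\<close> is at most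
a constant times \<open>X / k\<close> by the sieve. It remains to sum the weight of \<open>k\<close> divided by \<open>k\<close>, which is of order
\<open>sqrt (ln X)\<close>.\<close>

theorem short_L_sum_mean_square:
  assumes X: "X \<ge> 1" and N: "N \<ge> 1"
  shows "ln (real X) * (\<Sum>m\<in>odd_squarefrees X. 1 / real (divisor_tau m) * (short_L_sum N m)\<^sup>2)
     \<le> real X * ((10 * zeta_three_halves ^ 3 + 65) * sqrt (1 + 2 * ln (real X)) + 68 * (1 + ln (real N)) ^ 4)"
proof -
  let ?O = "odd_squarefrees X"
  define f where "f = (\<lambda>m. 1 / real (divisor_tau m))"
  define T where "T = (\<lambda>m. (short_L_sum N m)\<^sup>2)"
  define L where "L = 1 + ln (real N)"
  define K where "K = 10 * zeta_three_halves ^ 3 + 65"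
  have K: "K \<ge> 0" using zeta_three_halves_nonneg by (simp add: K_def)
  have L1: "L \<ge> 1" using N by (simp add: L_def)
  have Lp: "L ^ i \<le> L ^ j" if "i \<le> j" for i j using L1 that by (rule power_increasing[rotated])
  have f: "0 \<le> f m" "f m \<le> 1" if "m > 0" for m
    using divisor_tau_pos[OF that] by (auto simp: f_def)
  have T: "0 \<le> T m" "T m \<le> L\<^sup>2" for m unfolding T_def L_def by (auto intro: short_L_sum_square_le[OF N])
  have O: "m \<ge> 1" "m \<le> X" "odd m" "squarefree m" if "m \<in> ?O" for m using that by (auto simp: odd_squarefrees_def)
  have part1: "(\<Sum>m\<in>?O. f m * T m * ln (real X / real m)) \<le> 4 * L ^ 4 * real X"
  proof -
    have "(\<Sum>m\<in>?O. f m * T m * ln (real X / real m)) \<le> (\<Sum>m\<in>?O. 1 * L\<^sup>2 * ln (real X / real m))"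
    proof (intro sum_mono mult_mono f T)
      fix m assume "m \<in> ?O"
      then show "0 \<le> ln (real X / real m)" using O[of m] by (simp add: ln_ge_zero)
    qed (use O in \<open>force simp: Suc_le_eq\<close>)+
    also have "\<dots> = L\<^sup>2 * (\<Sum>m\<in>?O. ln (real X / real m))" by (simp add: sum_distrib_left)
    also have "\<dots> \<le> L\<^sup>2 * (\<Sum>m=1..X. ln (real X / real m))"
      by (intro mult_left_mono sum_mono2) (auto simp: odd_squarefrees_def)
    also have "\<dots> \<le> L\<^sup>2 * (4 * real X)" by (intro mult_left_mono sum_ln_quotient_le) auto
    also have "\<dots> \<le> L ^ 4 * (4 * real X)" by (intro mult_right_mono Lp) auto
    finally show ?thesis by (simp add: mult_ac)
  qed
  \<comment> \<open>The reindexing \<open>(m, p)\<close> to \<open>(m div p, p)\<close> embeds \<open>?A\<close> into \<open>?B\<close>.\<close>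
  let ?A = "SIGMA m : ?O. prime_factors m"
  let ?B = "SIGMA k : ?O. {p. p \<le> X div k \<and> prime p \<and> odd p}"
  let ?h = "\<lambda>(m::nat, p::nat). (m div p, p)"
  have A: "m = m div p * p" "p > 0" "m div p \<in> ?O" "p \<le> X div (m div p)" "prime p" "odd p" "m > 0"
    if "(m, p) \<in> ?A" for m p
  proof -
    have m: "m \<in> ?O" and p: "prime p" "p dvd m" using that by auto
    show eq: "m = m div p * p" using p by simp
    show p0: "p > 0" using p by (simp add: prime_gt_0_nat)
    show m0: "m > 0" using O[OF m] by simp
    have dv: "m div p dvd m" using eq by (metis dvd_triv_left)
    have d0: "m div p > 0" using eq m0 by (metis gr0I mult_0)
    have le: "m div p \<le> m" using dv m0 by (rule dvd_imp_le)
    show "m div p \<in> ?O"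
      unfolding odd_squarefrees_def mem_Collect_eq
    proof (intro conjI)
      show "1 \<le> m div p" using d0 by simp
      show "m div p \<le> X" using le O(2)[OF m] by (rule order.trans)
      show "odd (m div p)" using O(3)[OF m] dvd_trans[OF _ dv] by blast
      show "squarefree (m div p)" using dv O(4)[OF m] by (rule squarefree_mono)
    qed
    have "p * (m div p) \<le> X" using O(2)[OF m] eq by (simp add: mult.commute)
    then show "p \<le> X div (m div p)" using d0 by (simp add: less_eq_div_iff_mult_less_eq)
    show "prime p" by fact
    show "odd p" using O(3)[OF m] dvd_trans[OF _ p(2)] by blast
  qed
  have part2: "(\<Sum>m\<in>?O. f m * T m * ln (real m)) \<le> real X * (K * sqrt (1 + 2 * ln (real X)) + 64 * L ^ 4)"
  proof -
    have "(\<Sum>m\<in>?O. f m * T m * ln (real m)) = (\<Sum>m\<in>?O. \<Sum>p\<in>prime_factors m. f m * T m * ln (real p))"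
      by (rule sum.cong[OF refl]) (simp add: ln_squarefree O sum_distrib_left)
    also have "\<dots> = (\<Sum>(m, p)\<in>?A. f m * T m * ln (real p))"
      by (rule sum.Sigma) auto
    also have "\<dots> \<le> (\<Sum>(m, p)\<in>?A. f (m div p) * (ln (real p) * T (m div p * p)))"
    proof (rule sum_mono, clarify)
      fix m p assume mp: "m \<in> ?O" "p \<in># prime_factorization m"
      then have "(m, p) \<in> ?A" by simp
      note A = A[OF this]
      have "f m \<le> f (m div p)"
      proof -
        have "m div p dvd m" using A(1) by (metis dvd_triv_left)
        then have "divisor_tau (m div p) \<le> divisor_tau m" using A(7) by (rule divisor_tau_mono)
        moreover have "divisor_tau (m div p) \<ge> 1" using A(3) O by (intro divisor_tau_pos) (auto simp: Suc_le_eq)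
        ultimately show ?thesis unfolding f_def by (intro divide_left_mono) auto
      qed
      then have "f m * (T m * ln (real p)) \<le> f (m div p) * (T m * ln (real p))"
        using T A(2) by (intro mult_right_mono mult_nonneg_nonneg) auto
      then show "f m * T m * ln (real p) \<le> f (m div p) * (ln (real p) * T (m div p * p))"
        using A(1) by (simp add: mult_ac)
    qed
    also have "\<dots> = (\<Sum>x\<in>?A. (\<lambda>(k, p). f k * (ln (real p) * T (k * p))) (?h x))"
      by (intro sum.cong refl) auto
    also have "\<dots> = (\<Sum>x\<in>?h ` ?A. (\<lambda>(k, p). f k * (ln (real p) * T (k * p))) x)"
    proof (rule sum.reindex[symmetric, unfolded o_def])
      show "inj_on ?h ?A"
      proof (rule inj_onI)
        fix x y assume x: "x \<in> ?A" and y: "y \<in> ?A" and eq: "?h x = ?h y"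
        obtain m p m' p' where xy: "x = (m, p)" "y = (m', p')" by (metis surj_pair)
        show "x = y" using A(1)[of m p] A(1)[of m' p'] x y eq unfolding xy by (metis prod.inject case_prod_conv)
      qed
    qed
    also have "\<dots> \<le> (\<Sum>x\<in>?B. (\<lambda>(k, p). f k * (ln (real p) * T (k * p))) x)"
    proof (rule sum_mono2)
      show "finite ?B" by (intro finite_SigmaI) (auto intro: finite_subset[of _ "{..X}"])
      show "?h ` ?A \<subseteq> ?B"
      proof
        fix y assume "y \<in> ?h ` ?A"
        then obtain m p where mp: "(m, p) \<in> ?A" "y = (m div p, p)" by auto
        show "y \<in> ?B" using A[OF mp(1)] mp(2) by simp
      qed
      fix x assume "x \<in> ?B - ?h ` ?A"
      then obtain k p where "x = (k, p)" "k \<in> ?O" "prime p" by auto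
      then show "0 \<le> (\<lambda>(k, p). f k * (ln (real p) * T (k * p))) x"
        using f(1)[of k] T O(1)[of k] prime_gt_0_nat[of p] by (auto intro!: mult_nonneg_nonneg)
    qed
    also have "\<dots> = (\<Sum>k\<in>?O. \<Sum>p | p \<le> X div k \<and> prime p \<and> odd p. f k * (ln (real p) * T (k * p)))"
      by (rule sum.Sigma[symmetric]) (auto intro: finite_subset[of _ "{..X}"])
    also have "\<dots> \<le> (\<Sum>k\<in>?O. K * real X * (f k / real k) + (if X div k < N ^ 8 then 8 * L ^ 3 * real X * (1 / real k) else 0))"
    proof (rule sum_mono)
      fix k assume k: "k \<in> ?O"
      then have k0: "k > 0" using O[of k] by simp
      let ?U = "\<Sum>p | p \<le> X div k \<and> prime p \<and> odd p. ln (real p) * T (k * p)"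
      have div_le: "real (X div k) \<le> real X / real k" by (rule of_nat_div_le_of_nat)
      have "(\<Sum>p | p \<le> X div k \<and> prime p \<and> odd p. f k * (ln (real p) * T (k * p))) = f k * ?U"
        by (rule sum_distrib_left[symmetric])
      also have "\<dots> \<le> K * real X * (f k / real k) + (if X div k < N ^ 8 then 8 * L ^ 3 * real X * (1 / real k) else 0)"
      proof (cases "X div k \<ge> N ^ 8")
        case True
        then have "?U \<le> K * real (X div k)"
          using short_L_sum_twisted_primes[OF k0 N, of "X div k"] by (simp add: T_def K_def)
        also have "\<dots> \<le> K * (real X / real k)" using div_le K by (rule mult_left_mono)
        finally have "f k * ?U \<le> f k * (K * (real X / real k))" using f(1)[OF k0] by (rule mult_left_mono)
        then show ?thesis using True by (simp add: mult_ac)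
      next
        case False
        then have U: "?U \<le> 8 * L ^ 3 * real (X div k)"
          using short_L_sum_twisted_primes[OF k0 N, of "X div k"] by (simp add: T_def L_def)
        also have "\<dots> \<le> 8 * L ^ 3 * (real X / real k)" using div_le L1 by (intro mult_left_mono) auto
        finally have "f k * ?U \<le> 1 * (8 * L ^ 3 * (real X / real k))"
          using f[OF k0] T prime_gt_0_nat L1 by (intro mult_mono sum_nonneg mult_nonneg_nonneg) (auto simp: Suc_le_eq)
        moreover have "0 \<le> K * real X * (f k / real k)" using K f(1)[OF k0] by simp
        ultimately show ?thesis using False by simp
      qed
      finally show "(\<Sum>p | p \<le> X div k \<and> prime p \<and> odd p. f k * (ln (real p) * T (k * p)))
        \<le> K * real X * (f k / real k) + (if X div k < N ^ 8 then 8 * L ^ 3 * real X * (1 / real k) else 0)" .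
    qed
    also have "\<dots> = K * real X * (\<Sum>k\<in>?O. f k / real k) + (\<Sum>k\<in>?O. if X div k < N ^ 8 then 8 * L ^ 3 * real X * (1 / real k) else 0)"
      by (simp only: sum.distrib sum_distrib_left)
    also have "\<dots> \<le> K * real X * sqrt (1 + 2 * ln (real X)) + 8 * L ^ 3 * real X * (8 * L)"
    proof (intro add_mono mult_left_mono)
      have "(\<Sum>k\<in>?O. f k / real k) \<le> (\<Sum>k=1..X. f k / real k)"
        by (intro sum_mono2) (auto simp: odd_squarefrees_def f_def)
      also have "\<dots> = (\<Sum>k=1..X. 1 / (real (divisor_tau k) * real k))" by (simp add: f_def)
      also have "\<dots> \<le> sqrt (1 + 2 * ln (real X))" by (rule sum_inverse_divisor_tau_le[OF X])
      finally show "(\<Sum>k\<in>?O. f k / real k) \<le> sqrt (1 + 2 * ln (real X))" .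
      have "(\<Sum>k\<in>?O. if X div k < N ^ 8 then 8 * L ^ 3 * real X * (1 / real k) else 0)
          \<le> (\<Sum>k\<in>{1..X}. if X div k < N ^ 8 then 8 * L ^ 3 * real X * (1 / real k) else 0)"
        using L1 by (intro sum_mono2) (auto simp: odd_squarefrees_def)
      also have "\<dots> = (\<Sum>k | k \<in> {1..X} \<and> X div k < N ^ 8. 8 * L ^ 3 * real X * (1 / real k))"
        by (rule sum.inter_filter[symmetric]) simp
      also have "\<dots> = 8 * L ^ 3 * real X * (\<Sum>k | k \<in> {1..X} \<and> X div k < N ^ 8. 1 / real k)"
        by (rule sum_distrib_left[symmetric])
      also have "\<dots> \<le> 8 * L ^ 3 * real X * (8 * L)"
      proof (rule mult_left_mono)
        have "(\<Sum>k | k \<in> {1..X} \<and> X div k < N ^ 8. 1 / real k) \<le> 1 + ln (real (N ^ 8))"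
          using X N by (intro sum_inverse_upper_range_le) auto
        also have "\<dots> = 1 + 8 * ln (real N)" using N by (simp add: ln_realpow)
        finally show "(\<Sum>k | k \<in> {1..X} \<and> X div k < N ^ 8. 1 / real k) \<le> 8 * L" by (simp add: L_def)
      qed (use L1 in simp)
      finally show "(\<Sum>k\<in>?O. if X div k < N ^ 8 then 8 * L ^ 3 * real X * (1 / real k) else 0) \<le> 8 * L ^ 3 * real X * (8 * L)" .
    qed (use K in simp)
    also have "\<dots> = real X * (K * sqrt (1 + 2 * ln (real X)) + 64 * L ^ 4)"
      by (simp add: algebra_simps power3_eq_cube power4_eq_xxxx)
    finally show ?thesis .
  qed
  have "ln (real X) * (\<Sum>m\<in>?O. f m * T m) = (\<Sum>m\<in>?O. f m * T m * ln (real X / real m)) + (\<Sum>m\<in>?O. f m * T m * ln (real m))"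
    unfolding sum_distrib_left sum.distrib[symmetric]
  proof (rule sum.cong[OF refl])
    fix m assume "m \<in> ?O"
    then have eq: "ln (real X / real m) = ln (real X) - ln (real m)" using O(1)[of m] X by (simp add: ln_div)
    show "ln (real X) * (f m * T m) = f m * T m * ln (real X / real m) + f m * T m * ln (real m)"
      unfolding eq by (simp add: algebra_simps)
  qed
  also have "\<dots> \<le> 4 * L ^ 4 * real X + real X * (K * sqrt (1 + 2 * ln (real X)) + 64 * L ^ 4)"
    by (intro add_mono part1 part2)
  also have "\<dots> = real X * (K * sqrt (1 + 2 * ln (real X)) + 68 * L ^ 4)" by (simp add: algebra_simps)
  finally show ?thesis by (simp add: f_def T_def K_def L_def)
qed

section \<open>Truncation of the L-series\<close>

text \<open>Partial summation, arranged as an induction: the partial sum differs from its boundary term by a telescoping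
amount.\<close>

lemma abel_tail_bound:
  fixes a :: "nat \<Rightarrow> real"
  assumes B: "\<And>n. \<bar>\<Sum>j\<in>{M<..n}. a j\<bar> \<le> B"
  shows "\<bar>\<Sum>n\<in>{M<..M'}. a n / real n\<bar> \<le> B / real (M + 1)"
proof (cases "M \<le> M'")
  case True
  define R where "R = (\<lambda>n. \<Sum>j\<in>{M<..n}. a j)"
  have "\<bar>(\<Sum>n\<in>{M<..M'}. a n / real n) - R M' / real (M' + 1)\<bar> \<le> B * (1 / real (M + 1) - 1 / real (M' + 1))"
    using True
  proof (induction M' rule: dec_induct)
    case base
    show ?case by (simp add: R_def)
  next
    case (step n)
    define u v where "u = 1 / real (n + 1)" and "v = 1 / real (n + 2)"
    have uv: "u - v \<ge> 0" unfolding u_def v_def by (simp add: divide_left_mono)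
    have split: "{M<..Suc n} = insert (Suc n) {M<..n}" using step by auto
    have R: "R (Suc n) = a (Suc n) + R n" by (simp add: R_def split)
    have "(\<Sum>n\<in>{M<..Suc n}. a n / real n) - R (Suc n) / real (Suc n + 1)
        = ((\<Sum>n\<in>{M<..n}. a n / real n) - R n * u) + R (Suc n) * (u - v)"
      unfolding split by (simp add: R u_def v_def algebra_simps add_divide_distrib)
    also have "\<bar>\<dots>\<bar> \<le> \<bar>(\<Sum>n\<in>{M<..n}. a n / real n) - R n * u\<bar> + \<bar>R (Suc n)\<bar> * (u - v)"
      using uv by (intro order.trans[OF abs_triangle_ineq]) (simp add: abs_mult)
    also have "\<dots> \<le> B * (1 / real (M + 1) - u) + B * (u - v)"
      using step.IH B uv unfolding R_def u_def by (intro add_mono mult_right_mono) auto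
    also have "\<dots> = B * (1 / real (M + 1) - 1 / real (Suc n + 1))"
      by (simp add: v_def algebra_simps)
    finally show ?case .
  qed
  moreover have "\<bar>R M' / real (M' + 1)\<bar> \<le> B * (1 / real (M' + 1))"
    using B[of M'] by (simp add: R_def abs_divide divide_right_mono)
  ultimately have "\<bar>\<Sum>n\<in>{M<..M'}. a n / real n\<bar> \<le> B * (1 / real (M + 1) - 1 / real (M' + 1)) + B * (1 / real (M' + 1))"
    by linarith
  then show ?thesis by (simp add: right_diff_distrib)
next
  case False
  have "B \<ge> 0" using B[of 0] by linarith
  then show ?thesis using False by simp
qed

text \<open>As the Polya-Vinogradov bound holds on every interval, partial summation shows both that the partial sums form a
Cauchy sequence and how far they are from the limit.\<close>

lemma L_one_tail:
  assumes m: "odd m" "squarefree m" "m > 1"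
  shows "\<bar>L_one (\<lambda>n. jacobi_symbol n m) - (\<Sum>n=1..M. 1 / real n * real_of_int (jacobi_symbol (int n) m))\<bar>
    \<le> sqrt (real m) * (1 + ln (real m)) / real (M + 1)"
proof -
  define B where "B = sqrt (real m) * (1 + ln (real m))"
  define a where "a = (\<lambda>n::nat. real_of_int (jacobi_symbol (int n) m))"
  define P where "P = (\<lambda>M. \<Sum>n=1..M. a n / real n)"
  define f where "f = (\<lambda>n. 1 / real (Suc n) * real_of_int (jacobi_symbol (int (Suc n)) m))"
  have B0: "B \<ge> 0" using m by (simp add: B_def)
  have bound: "\<bar>\<Sum>j\<in>{M<..n}. a j\<bar> \<le> B" for M n
  proof -
    have "(\<Sum>j\<in>{M<..n}. a j) = (\<Sum>t\<in>{int M + 1..<int n + 1}. real_of_int (jacobi_symbol t m))"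
      unfolding a_def by (rule sum.reindex_bij_witness[of _ nat int]) auto
    then show ?thesis using polya_vinogradov_jacobi[OF m] by (simp add: B_def)
  qed
  have diff: "\<bar>P M' - P M\<bar> \<le> B / real (M + 1)" if "M \<le> M'" for M M'
  proof -
    have "{1..M'} = {1..M} \<union> {M<..M'}" using that by auto
    then have "P M' = P M + (\<Sum>n\<in>{M<..M'}. a n / real n)"
      unfolding P_def by (simp only:) (rule sum.union_disjoint, auto)
    then show ?thesis using abel_tail_bound[where a = a and B = B and M = M and M' = M'] bound by simp
  qed
  have "Cauchy P"
  proof (rule metric_CauchyI)
    fix e :: real assume e: "e > 0"
    obtain N where N: "B / e < real N" using reals_Archimedean2 by blast
    have N0: "B / real (k + 1) < e" if "k \<ge> N" for k
    proof -
      have "B / e < real (k + 1)" using N that by linarith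
      then show ?thesis using e by (simp add: divide_less_eq mult.commute)
    qed
    show "\<exists>N. \<forall>i\<ge>N. \<forall>j\<ge>N. dist (P i) (P j) < e"
    proof (intro exI allI impI)
      fix i j assume ij: "i \<ge> N" "j \<ge> N"
      show "dist (P i) (P j) < e"
      proof (cases "i \<le> j")
        case True
        then show ?thesis using diff[OF True] N0[OF ij(1)] by (simp add: dist_real_def)
      next
        case False
        then have "j \<le> i" by simp
        then show ?thesis using diff[OF \<open>j \<le> i\<close>] N0[OF ij(2)] by (simp add: dist_real_def)
      qed
    qed
  qed
  then obtain L where L: "P \<longlonglongrightarrow> L" using Cauchy_convergent convergent_def by blast
  have "(\<Sum>n<k. f n) = P k" for k
    unfolding P_def f_def a_def
    by (rule sum.reindex_bij_witness[of _ "\<lambda>n. n - 1" Suc]) auto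
  then have "f sums L" using L by (simp add: sums_def)
  then have "L_one (\<lambda>n. jacobi_symbol n m) = L" unfolding L_one_def f_def by (simp add: sums_iff)
  moreover have "\<bar>L - P M\<bar> \<le> B / real (M + 1)"
  proof (rule tendsto_upperbound)
    show "(\<lambda>k. \<bar>P k - P M\<bar>) \<longlonglongrightarrow> \<bar>L - P M\<bar>" by (intro tendsto_intros L)
    show "\<forall>\<^sub>F k in sequentially. \<bar>P k - P M\<bar> \<le> B / real (M + 1)"
      using eventually_ge_at_top[of M] by eventually_elim (rule diff)
  qed simp
  moreover have "P M = (\<Sum>n=1..M. 1 / real n * real_of_int (jacobi_symbol (int n) m))"
    by (simp add: P_def a_def)
  ultimately show ?thesis by (simp add: B_def)
qed

lemma short_L_sum_even_part:
  assumes "odd m"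
  shows "short_L_sum (2 * N) m = (\<Sum>n=1..2 * N. 1 / real n * real_of_int (jacobi_symbol (int n) m))
    - real_of_int (jacobi_symbol 2 m) / 2 * (\<Sum>n=1..N. 1 / real n * real_of_int (jacobi_symbol (int n) m))"
proof -
  let ?h = "\<lambda>n. 1 / real n * real_of_int (jacobi_symbol (int n) m)"
  have eq: "{1..2 * N} = {n. n \<in> {1..2 * N} \<and> odd n} \<union> (\<lambda>n. 2 * n) ` {1..N}"
  proof (intro equalityI subsetI)
    fix n assume n: "n \<in> {1..2 * N}"
    show "n \<in> {n. n \<in> {1..2 * N} \<and> odd n} \<union> (\<lambda>n. 2 * n) ` {1..N}"
    proof (cases "even n")
      case True
      then obtain k where "n = 2 * k" by blast
      then show ?thesis using n by auto
    qed (use n in simp)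
  qed auto
  have "(\<Sum>n=1..2 * N. ?h n) = sum ?h ({n. n \<in> {1..2 * N} \<and> odd n} \<union> (\<lambda>n. 2 * n) ` {1..N})"
    by (rule arg_cong[OF eq])
  also have "\<dots> = (\<Sum>n | n \<in> {1..2 * N} \<and> odd n. ?h n) + (\<Sum>n\<in>(\<lambda>n. 2 * n) ` {1..N}. ?h n)"
    by (rule sum.union_disjoint) auto
  also have "(\<Sum>n\<in>(\<lambda>n. 2 * n) ` {1..N}. ?h n) = (\<Sum>n=1..N. real_of_int (jacobi_symbol 2 m) / 2 * ?h n)"
    by (subst sum.reindex) (auto simp: inj_on_def jacobi_mult_left[OF assms] intro!: sum.cong)
  finally show ?thesis by (simp add: short_L_sum_def sum_distrib_left)
qed

text \<open>The odd terms of the series add up to \<open>(1 - (2 / m) / 2)\<close> times the value, that is, the Euler factor at 2 is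
removed, and this factor is at least \<open>1 / 2\<close>. The error is the tail of the series, at \<open>2 N\<close> and (for the even terms) at \<open>N\<close>.\<close>

lemma abs_L_one_le_short_L_sum:
  assumes m: "odd m" "squarefree m" "m > 1" and N: "N \<ge> 1"
  shows "\<bar>L_one (\<lambda>n. jacobi_symbol n m)\<bar>
    \<le> 2 * \<bar>short_L_sum (2 * N) m\<bar> + 2 * (sqrt (real m) * (1 + ln (real m)) / real N)"
proof -
  define B where "B = sqrt (real m) * (1 + ln (real m))"
  define L where "L = L_one (\<lambda>n. jacobi_symbol n m)"
  define P where "P = (\<lambda>M. \<Sum>n=1..M. 1 / real n * real_of_int (jacobi_symbol (int n) m))"
  define \<epsilon> where "\<epsilon> = real_of_int (jacobi_symbol 2 m) / 2"
  have B0: "B \<ge> 0" using m by (simp add: B_def)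
  have eps: "\<bar>\<epsilon>\<bar> \<le> 1 / 2" using abs_jacobi_le_real[of 2 m] by (simp add: \<epsilon>_def)
  have tail: "\<bar>L - P M\<bar> \<le> B / real (M + 1)" for M
    unfolding L_def P_def B_def by (rule L_one_tail[OF m])
  have short: "short_L_sum (2 * N) m = P (2 * N) - \<epsilon> * P N"
    unfolding P_def \<epsilon>_def by (rule short_L_sum_even_part[OF m(1)])
  have 1: "\<bar>L - P (2 * N)\<bar> \<le> B / real N / 2"
  proof -
    have "B / real (2 * N + 1) \<le> B / real (2 * N)" using N B0 by (intro divide_left_mono) auto
    then show ?thesis using tail[of "2 * N"] by simp
  qed
  have 2: "\<bar>\<epsilon> * (L - P N)\<bar> \<le> B / real N / 2"
  proof -
    have "B / real (N + 1) \<le> B / real N" using N B0 by (intro divide_left_mono) auto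
    then have "\<bar>L - P N\<bar> \<le> B / real N" using tail[of N] by simp
    then have "\<bar>\<epsilon>\<bar> * \<bar>L - P N\<bar> \<le> 1 / 2 * (B / real N)" using eps by (intro mult_mono) auto
    then show ?thesis by (simp add: abs_mult)
  qed
  have "\<bar>\<epsilon> * L\<bar> \<le> 1 / 2 * \<bar>L\<bar>" unfolding abs_mult using eps by (intro mult_right_mono) auto
  then have "\<bar>L\<bar> / 2 \<le> \<bar>L - \<epsilon> * L\<bar>" by linarith
  also have "L - \<epsilon> * L = short_L_sum (2 * N) m + (L - P (2 * N)) - \<epsilon> * (L - P N)"
    unfolding short by (simp add: algebra_simps)
  also have "\<bar>\<dots>\<bar> \<le> \<bar>short_L_sum (2 * N) m\<bar> + B / real N / 2 + B / real N / 2"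
  proof -
    have "\<bar>a + b - c\<bar> \<le> \<bar>a\<bar> + x + y" if "\<bar>b\<bar> \<le> x" "\<bar>c\<bar> \<le> y" for a b c x y :: real
      using that by linarith
    then show ?thesis using 1 2 by blast
  qed
  finally have "\<bar>L\<bar> \<le> 2 * \<bar>short_L_sum (2 * N) m\<bar> + 2 * (B / real N)" by (simp add: mult_ac)
  then show ?thesis by (simp add: L_def B_def)
qed

lemma short_L_sum_1 [simp]: "short_L_sum (Suc 0) m = 1"
proof -
  have "{n::nat. n \<in> {1..Suc 0} \<and> odd n} = {1}" by auto
  then show ?thesis by (simp add: short_L_sum_def)
qed

text \<open>The squares are nonnegative, so the sum may be extended to all odd \<open>m\<close>. There \<open>jacobi_sum_modulus\<close> supplies the
cancellation that the quadratic form estimate requires, with constant weight.\<close>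

lemma short_L_sum_difference_mean_square:
  assumes N: "N1 \<ge> N0" "N1 \<ge> 1"
  shows "(\<Sum>m\<in>odd_squarefrees X. (short_L_sum N1 m - short_L_sum N0 m)\<^sup>2)
    \<le> zeta_three_halves ^ 3 * real X / sqrt (real (N0 + 1)) + 16 * real N1 * (1 + ln (real N1))"
proof -
  let ?S = "{r. r \<le> X \<and> odd r}"
  define E where "E = (\<lambda>r. \<Sum>n | n \<in> {N0 + 1..N1} \<and> odd n. 1 / real n * real_of_int (jacobi_symbol (int n) r))"
  have fin: "finite ?S" by (rule finite_subset[of _ "{..X}"]) auto
  have E: "short_L_sum N1 m - short_L_sum N0 m = E m" for m
  proof -
    have eq: "{n. n \<in> {1..N1} \<and> odd n} = {n. n \<in> {1..N0} \<and> odd n} \<union> {n. n \<in> {N0 + 1..N1} \<and> odd n}"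
      using N(1) by auto
    have "short_L_sum N1 m = short_L_sum N0 m + E m"
      unfolding short_L_sum_def E_def by (subst eq, rule sum.union_disjoint) auto
    then show ?thesis by simp
  qed
  have "(\<Sum>m\<in>odd_squarefrees X. (short_L_sum N1 m - short_L_sum N0 m)\<^sup>2) = (\<Sum>m\<in>odd_squarefrees X. (E m)\<^sup>2)"
    by (simp only: E)
  also have "\<dots> \<le> (\<Sum>r\<in>?S. 1 * (E r)\<^sup>2)"
    unfolding mult_1 by (intro sum_mono2 fin) (auto simp: odd_squarefrees_def)
  also have "\<dots> \<le> zeta_three_halves ^ 3 * (\<Sum>r\<in>?S. 1) / sqrt (real (N0 + 1)) + 8 * 2 * real N1 * (1 + ln (real N1))"
    unfolding E_def
  proof (rule jacobi_quadratic_form_le[OF _ N(2) fin])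
    show "\<bar>\<Sum>r\<in>?S. 1 * real_of_int (jacobi_symbol (int n) r)\<bar> \<le> 2 * (sqrt (real n) * (1 + ln (real n)))"
      if "odd n" "\<nexists>k. n = k ^ 2" for n
      using jacobi_sum_modulus[OF that] by simp
  qed auto
  also have "\<dots> \<le> zeta_three_halves ^ 3 * real X / sqrt (real (N0 + 1)) + 8 * 2 * real N1 * (1 + ln (real N1))"
  proof (intro add_mono order_refl divide_right_mono mult_left_mono)
    have "card ?S \<le> card {1..X}" by (intro card_mono) (auto simp: Suc_le_eq intro!: Nat.gr0I)
    then show "(\<Sum>r\<in>?S. 1) \<le> real X" by simp
  qed (use zeta_three_halves_nonneg in auto)
  finally show ?thesis by simp
qed

lemma moebius_mu_double_square:
  "(moebius_mu (2 * m))\<^sup>2 = (if odd m \<and> squarefree m then 1 else 0)"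
proof (cases "odd m \<and> squarefree m")
  case True
  then have "squarefree (2 * m)" by (subst squarefree_mult_coprime) (auto simp: squarefree_prime)
  then show ?thesis using True by (simp add: moebius_mu_def flip: power_mult)
next
  case False
  have "\<not> squarefree (2 * m)"
  proof
    assume sq: "squarefree (2 * m)"
    then have "squarefree m" using squarefree_multD by blast
    then have "even m" using False by blast
    then have "2 ^ 2 dvd 2 * m" by (auto simp: power2_eq_square)
    from squarefreeD[OF sq this] show False by simp
  qed
  then show ?thesis using False by (auto simp: moebius_mu_def)
qed

text \<open>Up to a factor at most 2 and the truncation error, the value at \<open>m\<close> is \<open>T m + E m\<close>, the odd terms up to \<open>N0\<close> and those from \<open>N0\<close> to \<open>2 N\<close>. Twice the former is
at most \<open>1 + T^2\<close>, where \<open>1\<close> is itself the square of the short sum of length one, so that both summands fall under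
\<open>short_L_sum_mean_square\<close>. Twice the latter is at most \<open>\<delta> + E^2 / \<delta>\<close>, where \<open>\<delta>\<close> balances the two summands.\<close>

lemma weighted_L_one_sum_bound:
  assumes X: "X \<ge> 3" and N0: "N0 \<ge> 1" "N0 \<le> 2 * N" and N: "N \<ge> 1" and d: "\<delta> > 0"
  shows "(\<Sum>m\<in>odd_squarefrees X - {1}. 1 / real (divisor_tau m) * \<bar>L_one (\<lambda>n. jacobi_symbol n m)\<bar>)
    \<le> real X * (2 * (10 * zeta_three_halves ^ 3 + 65) * sqrt (1 + 2 * ln (real X)) + 136 * (1 + ln (real N0)) ^ 4) / ln (real X)
      + \<delta> * real X
      + (zeta_three_halves ^ 3 * real X / sqrt (real (N0 + 1)) + 32 * real N * (1 + ln (real (2 * N)))) / \<delta>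
      + real X * (2 * (sqrt (real X) * (1 + ln (real X)) / real N))"
proof -
  let ?O = "odd_squarefrees X"
  define K where "K = 10 * zeta_three_halves ^ 3 + 65"
  define f where "f = (\<lambda>m. 1 / real (divisor_tau m))"
  define T where "T = (\<lambda>m. short_L_sum N0 m)"
  define E where "E = (\<lambda>m. short_L_sum (2 * N) m - short_L_sum N0 m)"
  define b where "b = 2 * (sqrt (real X) * (1 + ln (real X)) / real N)"
  have l: "ln (real X) > 0" using X by simp
  have b0: "b \<ge> 0" using l by (simp add: b_def)
  have O: "m \<ge> 1" "m \<le> X" "odd m" "squarefree m" if "m \<in> ?O" for m using that by (auto simp: odd_squarefrees_def)
  have f: "0 \<le> f m" "f m \<le> 1" if "m \<in> ?O" for m
    using divisor_tau_pos[of m] O(1)[OF that] by (auto simp: f_def)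
  have "(\<Sum>m\<in>?O - {1}. f m * \<bar>L_one (\<lambda>n. jacobi_symbol n m)\<bar>)
      \<le> (\<Sum>m\<in>?O - {1}. f m * (1 + (T m)\<^sup>2) + (\<delta> + (E m)\<^sup>2 / \<delta>) + b)"
  proof (rule sum_mono)
    fix m assume m: "m \<in> ?O - {1}"
    then have mO: "m \<in> ?O" and m1: "m > 1" using O[of m] by auto
    have "sqrt (real m) * (1 + ln (real m)) / real N \<le> sqrt (real X) * (1 + ln (real X)) / real N"
      using O[OF mO] m1 by (intro divide_right_mono mult_mono add_mono ln_mono) auto
    then have "\<bar>L_one (\<lambda>n. jacobi_symbol n m)\<bar> \<le> 2 * \<bar>short_L_sum (2 * N) m\<bar> + b"
      using abs_L_one_le_short_L_sum[OF O(3,4)[OF mO] m1 N] by (simp add: b_def)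
    also have "\<bar>short_L_sum (2 * N) m\<bar> \<le> \<bar>T m\<bar> + \<bar>E m\<bar>" by (simp add: T_def E_def)
    also have "2 * (\<bar>T m\<bar> + \<bar>E m\<bar>) + b \<le> (1 + (T m)\<^sup>2) + (\<delta> + (E m)\<^sup>2 / \<delta>) + b"
    proof -
      have 1: "2 * \<bar>T m\<bar> \<le> 1 + (T m)\<^sup>2" using sum_squares_bound[of "\<bar>T m\<bar>" 1] by simp
      have "2 * \<bar>E m\<bar> * \<delta> \<le> \<delta> * \<delta> + (E m)\<^sup>2"
        using sum_squares_bound[of "\<bar>E m\<bar>" \<delta>] by (simp add: power2_eq_square)
      then have "2 * \<bar>E m\<bar> \<le> (\<delta> * \<delta> + (E m)\<^sup>2) / \<delta>" using d by (simp add: le_divide_eq)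
      also have "\<dots> = \<delta> + (E m)\<^sup>2 / \<delta>" using d by (simp add: add_divide_distrib)
      finally show ?thesis using 1 by simp
    qed
    finally have "\<bar>L_one (\<lambda>n. jacobi_symbol n m)\<bar> \<le> (1 + (T m)\<^sup>2) + ((\<delta> + (E m)\<^sup>2 / \<delta>) + b)" by simp
    then have "f m * \<bar>L_one (\<lambda>n. jacobi_symbol n m)\<bar> \<le> f m * ((1 + (T m)\<^sup>2) + ((\<delta> + (E m)\<^sup>2 / \<delta>) + b))"
      using f[OF mO] by (intro mult_left_mono)
    also have "\<dots> = f m * (1 + (T m)\<^sup>2) + f m * ((\<delta> + (E m)\<^sup>2 / \<delta>) + b)" by (rule distrib_left)
    also have "\<dots> \<le> f m * (1 + (T m)\<^sup>2) + 1 * ((\<delta> + (E m)\<^sup>2 / \<delta>) + b)"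
      using f[OF mO] d b0 by (intro add_left_mono mult_right_mono) auto
    finally show "f m * \<bar>L_one (\<lambda>n. jacobi_symbol n m)\<bar> \<le> f m * (1 + (T m)\<^sup>2) + (\<delta> + (E m)\<^sup>2 / \<delta>) + b" by simp
  qed
  also have "\<dots> \<le> (\<Sum>m\<in>?O. f m * (1 + (T m)\<^sup>2) + (\<delta> + (E m)\<^sup>2 / \<delta>) + b)"
    using f d b0 by (intro sum_mono2) auto
  also have "\<dots> = (\<Sum>m\<in>?O. f m * (short_L_sum 1 m)\<^sup>2) + (\<Sum>m\<in>?O. f m * (T m)\<^sup>2)
      + real (card ?O) * \<delta> + (\<Sum>m\<in>?O. (E m)\<^sup>2) / \<delta> + real (card ?O) * b"
    by (simp add: sum.distrib distrib_left sum_divide_distrib)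
  also have "\<dots> \<le> real X * (K * sqrt (1 + 2 * ln (real X)) + 68 * (1 + ln (real 1)) ^ 4) / ln (real X)
      + real X * (K * sqrt (1 + 2 * ln (real X)) + 68 * (1 + ln (real N0)) ^ 4) / ln (real X)
      + real X * \<delta>
      + (zeta_three_halves ^ 3 * real X / sqrt (real (N0 + 1)) + 16 * real (2 * N) * (1 + ln (real (2 * N)))) / \<delta>
      + real X * b"
  proof (intro add_mono divide_right_mono mult_right_mono)
    have ms: "(\<Sum>m\<in>?O. f m * (short_L_sum M m)\<^sup>2)
        \<le> real X * (K * sqrt (1 + 2 * ln (real X)) + 68 * (1 + ln (real M)) ^ 4) / ln (real X)" if "M \<ge> 1" for M
    proof -
      have "(\<Sum>m\<in>?O. f m * (short_L_sum M m)\<^sup>2) * ln (real X)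
          \<le> real X * (K * sqrt (1 + 2 * ln (real X)) + 68 * (1 + ln (real M)) ^ 4)"
        using short_L_sum_mean_square[OF _ that, of X] X by (simp only: f_def K_def mult.commute[of _ "ln (real X)"])
      then show ?thesis by (simp only: pos_le_divide_eq[OF l])
    qed
    show "(\<Sum>m\<in>?O. f m * (short_L_sum 1 m)\<^sup>2)
        \<le> real X * (K * sqrt (1 + 2 * ln (real X)) + 68 * (1 + ln (real 1)) ^ 4) / ln (real X)"
      by (rule ms) simp
    show "(\<Sum>m\<in>?O. f m * (T m)\<^sup>2)
        \<le> real X * (K * sqrt (1 + 2 * ln (real X)) + 68 * (1 + ln (real N0)) ^ 4) / ln (real X)"
      unfolding T_def by (rule ms[OF N0(1)])
    show "(\<Sum>m\<in>?O. (E m)\<^sup>2) \<le> zeta_three_halves ^ 3 * real X / sqrt (real (N0 + 1)) + 16 * real (2 * N) * (1 + ln (real (2 * N)))"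
      unfolding E_def using N N0 by (intro short_L_sum_difference_mean_square) auto
    have "card ?O \<le> card {1..X}" by (intro card_mono) (auto simp: odd_squarefrees_def)
    then show c: "real (card ?O) \<le> real X" by simp
    show "real (card ?O) \<le> real X" by (rule c)
  qed (use d b0 in auto)
  also have "\<dots> \<le> real X * (2 * K * sqrt (1 + 2 * ln (real X)) + 136 * (1 + ln (real N0)) ^ 4) / ln (real X)
      + \<delta> * real X
      + (zeta_three_halves ^ 3 * real X / sqrt (real (N0 + 1)) + 32 * real N * (1 + ln (real (2 * N)))) / \<delta>
      + real X * b"
  proof -
    have "(1 + ln (real N0)) ^ 4 \<ge> 1" using N0 by (intro one_le_power) auto
    then have "real X * (K * sqrt (1 + 2 * ln (real X)) + 68) + real X * (K * sqrt (1 + 2 * ln (real X)) + 68 * (1 + ln (real N0)) ^ 4)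
        \<le> real X * (2 * K * sqrt (1 + 2 * ln (real X)) + 136 * (1 + ln (real N0)) ^ 4)"
      unfolding distrib_left[symmetric] by (intro mult_left_mono) auto
    then have "(real X * (K * sqrt (1 + 2 * ln (real X)) + 68) + real X * (K * sqrt (1 + 2 * ln (real X)) + 68 * (1 + ln (real N0)) ^ 4)) / ln (real X)
        \<le> real X * (2 * K * sqrt (1 + 2 * ln (real X)) + 136 * (1 + ln (real N0)) ^ 4) / ln (real X)"
      using l by (intro divide_right_mono) auto
    then show ?thesis by (simp add: add_divide_distrib mult_ac)
  qed
  finally show ?thesis by (simp add: f_def K_def b_def)
qed

section \<open>The upper bound\<close>

lemma eventually_parameter_bounds:
  "eventually (\<lambda>x::real. x \<ge> 3 \<and> ln x \<ge> 1 \<and> (1 + ln ((ln x)\<^sup>2 + 1)) ^ 4 \<le> sqrt (ln x)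
     \<and> 32 * (x powr (3/4) + 1) * (1 + ln (2 * (x powr (3/4) + 1))) * sqrt (ln x) \<le> x / sqrt (ln x)
     \<and> 2 * (sqrt x * (1 + ln x)) / x powr (3/4) \<le> 1 / sqrt (ln x)
     \<and> (ln x)\<^sup>2 + 1 \<le> 2 * x powr (3/4)) at_top"
proof (intro eventually_conj)
  show "\<forall>\<^sub>F x::real in at_top. x \<ge> 3" by real_asymp
  show "\<forall>\<^sub>F x::real in at_top. ln x \<ge> 1" by real_asymp
  show "\<forall>\<^sub>F x::real in at_top. (1 + ln ((ln x)\<^sup>2 + 1)) ^ 4 \<le> sqrt (ln x)" by real_asymp
  show "\<forall>\<^sub>F x::real in at_top. 32 * (x powr (3/4) + 1) * (1 + ln (2 * (x powr (3/4) + 1))) * sqrt (ln x) \<le> x / sqrt (ln x)"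
    by real_asymp
  show "\<forall>\<^sub>F x::real in at_top. 2 * (sqrt x * (1 + ln x)) / x powr (3/4) \<le> 1 / sqrt (ln x)" by real_asymp
  show "\<forall>\<^sub>F x::real in at_top. (ln x)\<^sup>2 + 1 \<le> 2 * x powr (3/4)" by real_asymp
qed

text \<open>With \<open>l = ln X\<close>, the choices are \<open>N0 = l^2\<close>, \<open>N = X powr (3/4)\<close> and \<open>\<delta> = 1 / sqrt l\<close>. A length \<open>l^2\<close> makes the diagonal
part of \<open>E\<close> of size \<open>X / l\<close>, while its logarithm is so small that the powers of \<open>ln N0\<close> stay below
\<open>sqrt l\<close>. Any exponent strictly between \<open>1/2\<close> and \<open>1\<close> would serve for \<open>N\<close>: the tail needs \<open>N\<close> to exceed
\<open>sqrt X\<close> and the off-diagonal part of \<open>E\<close> needs it to be smaller than \<open>X\<close>, in both cases by powers of \<open>l\<close>.\<close>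

lemma weighted_L_one_sum_asymptotic_bound:
  "\<exists>C X0. C > 0 \<and> (\<forall>X\<ge>X0. X \<ge> 3 \<and>
     (\<Sum>m\<in>odd_squarefrees X - {1}. 1 / real (divisor_tau m) * \<bar>L_one (\<lambda>n. jacobi_symbol n m)\<bar>)
       \<le> C * (real X / sqrt (ln (real X))))"
proof -
  define K where "K = 10 * zeta_three_halves ^ 3 + 65"
  define Z where "Z = zeta_three_halves ^ 3"
  have Z0: "Z \<ge> 0" using zeta_three_halves_nonneg by (simp add: Z_def)
  then have K0: "K \<ge> 0" by (simp add: K_def Z_def)
  obtain x0 where x0: "\<And>x::real. x \<ge> x0 \<Longrightarrow> x \<ge> 3 \<and> ln x \<ge> 1 \<and> (1 + ln ((ln x)\<^sup>2 + 1)) ^ 4 \<le> sqrt (ln x)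
     \<and> 32 * (x powr (3/4) + 1) * (1 + ln (2 * (x powr (3/4) + 1))) * sqrt (ln x) \<le> x / sqrt (ln x)
     \<and> 2 * (sqrt x * (1 + ln x)) / x powr (3/4) \<le> 1 / sqrt (ln x)
     \<and> (ln x)\<^sup>2 + 1 \<le> 2 * x powr (3/4)"
    using eventually_parameter_bounds unfolding eventually_at_top_linorder by blast
  have "X \<ge> 3 \<and> (\<Sum>m\<in>odd_squarefrees X - {1}. 1 / real (divisor_tau m) * \<bar>L_one (\<lambda>n. jacobi_symbol n m)\<bar>)
       \<le> (4 * K + 136 + 1 + Z + 1 + 1) * (real X / sqrt (ln (real X)))" if X: "X \<ge> nat \<lceil>x0\<rceil>" for X
  proof -
    define x where "x = real X"
    define l where "l = ln x"
    define N0 where "N0 = nat \<lceil>l\<^sup>2\<rceil>"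
    define N where "N = nat \<lceil>x powr (3/4)\<rceil>"
    define W where "W = x / sqrt l"
    have "x \<ge> x0" using X unfolding x_def by linarith
    note x = x0[OF this, folded l_def]
    have x3: "x \<ge> 3" and l1: "l \<ge> 1" using x by auto
    have X3: "X \<ge> 3" using x3 by (simp add: x_def)
    have sl: "sqrt l > 0" "sqrt l * sqrt l = l" using l1 by auto
    have W0: "W \<ge> 0" using x3 sl by (simp add: W_def)
    have lsq: "l\<^sup>2 \<ge> 1" using l1 by (simp add: one_le_power)
    have N0: "real N0 \<ge> l\<^sup>2" "real N0 \<le> l\<^sup>2 + 1" unfolding N0_def using lsq by linarith+
    have N0': "N0 \<ge> 1" using N0(1) lsq by linarith
    have pw: "x powr (3/4) \<ge> 1" using x3 by (intro ge_one_powr_ge_zero) auto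
    have N: "real N \<ge> x powr (3/4)" "real N \<le> x powr (3/4) + 1" unfolding N_def using pw by linarith+
    have N1: "N \<ge> 1" using N(1) pw by linarith
    have N0N: "N0 \<le> 2 * N"
    proof -
      have "real N0 \<le> l\<^sup>2 + 1" by (rule N0)
      also have "\<dots> \<le> 2 * x powr (3/4)" using x by simp
      also have "\<dots> \<le> 2 * real N" using N(1) by simp
      finally show ?thesis by linarith
    qed
    have "(\<Sum>m\<in>odd_squarefrees X - {1}. 1 / real (divisor_tau m) * \<bar>L_one (\<lambda>n. jacobi_symbol n m)\<bar>)
       \<le> x * (2 * K * sqrt (1 + 2 * l) + 136 * (1 + ln (real N0)) ^ 4) / l
      + 1 / sqrt l * x
      + (Z * x / sqrt (real (N0 + 1)) + 32 * real N * (1 + ln (real (2 * N)))) / (1 / sqrt l)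
      + x * (2 * (sqrt x * (1 + l)) / real N)"
      using weighted_L_one_sum_bound[OF X3 N0' N0N N1, of "1 / sqrt l"] sl
      by (simp add: x_def l_def K_def Z_def)
    also have "x * (2 * K * sqrt (1 + 2 * l) + 136 * (1 + ln (real N0)) ^ 4) / l \<le> (4 * K + 136) * W"
    proof -
      have "sqrt (1 + 2 * l) \<le> sqrt (4 * l)" using l1 by (intro real_sqrt_le_mono) simp
      also have "\<dots> = 2 * sqrt l" by (simp add: real_sqrt_mult)
      finally have 1: "sqrt (1 + 2 * l) \<le> 2 * sqrt l" .
      have "(1 + ln (real N0)) ^ 4 \<le> (1 + ln (l\<^sup>2 + 1)) ^ 4"
        using N0 N0' by (intro power_mono add_mono ln_mono) auto
      also have "\<dots> \<le> sqrt l" using x by simp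
      finally have 2: "(1 + ln (real N0)) ^ 4 \<le> sqrt l" .
      have "x * (2 * K * sqrt (1 + 2 * l) + 136 * (1 + ln (real N0)) ^ 4) / l
          \<le> x * (2 * K * (2 * sqrt l) + 136 * sqrt l) / l"
        using K0 x3 l1 by (intro divide_right_mono mult_left_mono add_mono 1 2) auto
      also have "\<dots> = (4 * K + 136) * (x * (sqrt l / l))" by (simp add: algebra_simps add_divide_distrib)
      also have "sqrt l / l = 1 / sqrt l" using sl l1 by (simp add: field_simps)
      finally show ?thesis by (simp add: W_def)
    qed
    also have "1 / sqrt l * x = 1 * W" by (simp add: W_def)
    also have "(Z * x / sqrt (real (N0 + 1)) + 32 * real N * (1 + ln (real (2 * N)))) / (1 / sqrt l) \<le> (Z + 1) * W"
    proof -
      have "l \<le> sqrt (real (N0 + 1))" using N0(1) l1 by (intro real_le_rsqrt) simp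
      then have "Z * x / sqrt (real (N0 + 1)) \<le> Z * x / l" using Z0 x3 l1 by (intro divide_left_mono) auto
      then have "Z * x / sqrt (real (N0 + 1)) * sqrt l \<le> Z * x / l * sqrt l" using sl by (intro mult_right_mono) auto
      also have "\<dots> = Z * (x * (sqrt l / l))" by simp
      also have "sqrt l / l = 1 / sqrt l" using sl l1 by (simp add: field_simps)
      finally have 1: "Z * x / sqrt (real (N0 + 1)) * sqrt l \<le> Z * W" by (simp add: W_def)
      have "32 * real N * (1 + ln (real (2 * N))) * sqrt l
          \<le> 32 * (x powr (3/4) + 1) * (1 + ln (2 * (x powr (3/4) + 1))) * sqrt l"
        using N N1 sl pw by (intro mult_mono add_mono ln_mono mult_nonneg_nonneg add_nonneg_nonneg) auto
      also have "\<dots> \<le> W" using x by (simp add: W_def)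
      finally have "32 * real N * (1 + ln (real (2 * N))) * sqrt l \<le> W" .
      with 1 show ?thesis by (simp add: distrib_right)
    qed
    also have "x * (2 * (sqrt x * (1 + l)) / real N) \<le> 1 * W"
    proof -
      have "2 * (sqrt x * (1 + l)) / real N \<le> 2 * (sqrt x * (1 + l)) / x powr (3/4)"
        using N N1 pw x3 l1 by (intro divide_left_mono mult_pos_pos mult_nonneg_nonneg) auto
      also have "\<dots> \<le> 1 / sqrt l" using x by simp
      finally have "x * (2 * (sqrt x * (1 + l)) / real N) \<le> x * (1 / sqrt l)"
        using x3 by (intro mult_left_mono) auto
      then show ?thesis by (simp add: W_def)
    qed
    also have "(4 * K + 136) * W + 1 * W + (Z + 1) * W + 1 * W = (4 * K + 136 + 1 + Z + 1 + 1) * W"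
      by (simp add: algebra_simps)
    finally show ?thesis using X3 by (simp add: W_def x_def l_def)
  qed
  moreover have "4 * K + 136 + 1 + Z + 1 + 1 > 0" using K0 Z0 by simp
  ultimately show ?thesis by blast
qed

theorem corollary1p3:
  shows "\<exists>C::real. C > 0 \<and> (\<forall>X::real. X \<ge> 3 \<longrightarrow>
    \<bar>\<Sum>m | 1 < m \<and> real m \<le> X.
        of_int ((moebius_mu (2 * m))\<^sup>2) / real (divisor_tau m)
          * L_one (\<lambda>n. jacobi_symbol n m)\<bar>
      \<le> C * (X / sqrt (ln X)))"
proof -
  define g where "g = (\<lambda>m. 1 / real (divisor_tau m) * \<bar>L_one (\<lambda>n. jacobi_symbol n m)\<bar>)"
  obtain C X0 where C: "C > 0" and X0: "\<And>X. X \<ge> X0 \<Longrightarrow> X \<ge> 3 \<and>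
     (\<Sum>m\<in>odd_squarefrees X - {1}. g m) \<le> C * (real X / sqrt (ln (real X)))"
    using weighted_L_one_sum_asymptotic_bound unfolding g_def by blast
  \<comment> \<open>Below the threshold \<open>X0\<close> all sums are at most the constant \<open>D\<close>, and \<open>X / sqrt (ln X) >= 1\<close>.\<close>
  define D where "D = (\<Sum>m\<in>odd_squarefrees X0 - {1}. g m)"
  have g0: "g m \<ge> 0" for m by (simp add: g_def)
  have D0: "D \<ge> 0" unfolding D_def by (intro sum_nonneg g0)
  have "\<bar>\<Sum>m | 1 < m \<and> real m \<le> X.
        of_int ((moebius_mu (2 * m))\<^sup>2) / real (divisor_tau m) * L_one (\<lambda>n. jacobi_symbol n m)\<bar>
      \<le> (2 * C + D) * (X / sqrt (ln X))" if X: "X \<ge> 3" for X :: real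
  proof -
    define n where "n = nat \<lfloor>X\<rfloor>"
    have n: "real n \<le> X" "X \<le> real n + 1" "n \<ge> 3"
      unfolding n_def using X by (linarith, linarith, simp add: le_nat_iff le_floor_iff)
    have lX: "ln X > 0" using X by simp
    have W1: "X / sqrt (ln X) \<ge> 1"
    proof -
      have "X * 1 \<le> X * X" using X by (intro mult_left_mono) auto
      then have "ln X \<le> X * X" using X ln_le_minus_one[of X] by linarith
      then have "sqrt (ln X) \<le> X" using X by (intro real_le_lsqrt) (auto simp: power2_eq_square)
      then show ?thesis using lX by (simp add: le_divide_eq)
    qed
    have set_eq: "{m. 1 < m \<and> real m \<le> X} = {m. 1 < m \<and> m \<le> n}"
      using X by (auto simp: n_def le_nat_iff le_floor_iff)
    have "\<bar>\<Sum>m | 1 < m \<and> real m \<le> X.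
        of_int ((moebius_mu (2 * m))\<^sup>2) / real (divisor_tau m) * L_one (\<lambda>n. jacobi_symbol n m)\<bar>
        \<le> (\<Sum>m | 1 < m \<and> m \<le> n. if odd m \<and> squarefree m then g m else 0)"
      unfolding set_eq
    proof (intro order.trans[OF sum_abs] sum_mono)
      fix m
      show "\<bar>of_int ((moebius_mu (2 * m))\<^sup>2) / real (divisor_tau m) * L_one (\<lambda>n. jacobi_symbol n m)\<bar>
          \<le> (if odd m \<and> squarefree m then g m else 0)"
        unfolding moebius_mu_double_square by (auto simp: g_def abs_mult)
    qed
    also have "\<dots> = (\<Sum>m | m \<in> {m. 1 < m \<and> m \<le> n} \<and> (odd m \<and> squarefree m). g m)"
      by (rule sum.inter_filter[symmetric]) (rule finite_subset[of _ "{..n}"], auto)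
    also have "{m. m \<in> {m. 1 < m \<and> m \<le> n} \<and> (odd m \<and> squarefree m)} = odd_squarefrees n - {1}"
      by (auto simp: odd_squarefrees_def)
    also have "(\<Sum>m\<in>odd_squarefrees n - {1}. g m) \<le> (2 * C + D) * (X / sqrt (ln X))"
    proof (cases "n \<ge> X0")
      case True
      have "X \<le> real n * real n"
      proof -
        have "3 * real n \<le> real n * real n" using n(3) by (intro mult_right_mono) auto
        then show ?thesis using n by linarith
      qed
      then have "ln X \<le> ln (real n * real n)" using X by (intro ln_mono) auto
      also have "\<dots> = 2 * ln (real n)" using n by (simp add: ln_mult)
      also have "\<dots> \<le> 2\<^sup>2 * ln (real n)" using n by simp
      finally have "sqrt (ln X) \<le> sqrt (2\<^sup>2 * ln (real n))" by (rule real_sqrt_le_mono)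
      also have "\<dots> = 2 * sqrt (ln (real n))" by (simp only: real_sqrt_mult real_sqrt_abs abs_numeral)
      finally have le: "sqrt (ln X) \<le> 2 * sqrt (ln (real n))" .
      have sp: "sqrt (ln (real n)) > 0" using n by simp
      have "real n / sqrt (ln (real n)) \<le> X / sqrt (ln (real n))" using n sp by (intro divide_right_mono) auto
      also have "\<dots> = 2 * X / (2 * sqrt (ln (real n)))" by simp
      also have "\<dots> \<le> 2 * X / sqrt (ln X)"
        using le lX X sp by (intro divide_left_mono mult_pos_pos) auto
      finally have "real n / sqrt (ln (real n)) \<le> 2 * (X / sqrt (ln X))" by simp
      then have "C * (real n / sqrt (ln (real n))) \<le> C * (2 * (X / sqrt (ln X)))" using C by (intro mult_left_mono) auto
      moreover have "(\<Sum>m\<in>odd_squarefrees n - {1}. g m) \<le> C * (real n / sqrt (ln (real n)))"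
        using X0[OF True] by blast
      ultimately have "(\<Sum>m\<in>odd_squarefrees n - {1}. g m) \<le> C * (2 * (X / sqrt (ln X)))"
        by (rule order.trans[rotated])
      also have "\<dots> = 2 * C * (X / sqrt (ln X))" by simp
      also have "\<dots> \<le> (2 * C + D) * (X / sqrt (ln X))" using D0 W1 by (intro mult_right_mono) auto
      finally show ?thesis .
    next
      case False
      have "(\<Sum>m\<in>odd_squarefrees n - {1}. g m) \<le> D"
        unfolding D_def using False by (intro sum_mono2) (auto simp: g0 odd_squarefrees_def)
      also have "D \<le> D * (X / sqrt (ln X))" using D0 W1 mult_left_mono[of 1 "X / sqrt (ln X)" D] by simp
      also have "\<dots> \<le> (2 * C + D) * (X / sqrt (ln X))" using C W1 by (intro mult_right_mono) auto
      finally show ?thesis .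
    qed
    finally show ?thesis .
  qed
  moreover have "2 * C + D > 0" using C D0 by simp
  ultimately show ?thesis by blast
qed

end
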